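(* Let $\Phi\subseteq V^*$ be an essential irreducible root system of classical type ($\mathrm A_n$, $\mathrm B_n$, $\mathrm C_n$ or $\mathrm D_n$), let $\mathcal V\subseteq V$ be the vertex set of the Euclidean Coxeter complex of type $\Phi$, and let $\mathcal L\subseteq V^*$ be the root lattice of $\Phi$. Let $f:\mathcal V\to\mathbb R\cup\{+\infty\}$ and $g:\mathcal L\to\mathbb R\cup\{+\infty\}$ be functions. (1) If $f$ is an integral L-convex function of type $\Phi$, then its discrete Fenchel–Legendre conjugate $f^\bullet:\mathcal L\to\mathbb R\cup\{+\infty\}$, $f^\bullet(p)=\sup\{\langle p,x\rangle-f(x):x\in\operatorname{dom} f\}$, is an integral M-convex function of type $\Phi$, and $f=(f^\bullet)^\bullet$. (2) If $g$ is an integral M-convex function of type $\Phi$, then its discrete Fenchel–Legendre conjugate $g^\bullet:\mathcal V\to\mathbb R\cup\{+\infty\}$, $g^\bullet(x)=\sup\{\langle p,x\rangle-g(p):p\in\operatorname{dom} g\}$, is an integral L-convex function of type $\Phi$, and $g=(g^\bullet)^\bullet$.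
   Context: Root systems. $V$ is a finite-dimensional real inner product space with dual $V^*$, $\langle p,x\rangle=p(x)$ for $p\in V^*,x\in V$; $V^*$ carries the induced inner product. For $\alpha\in V^*\setminus\{0\}$, $\alpha^\vee\in V$ is $2/\|\alpha\|^2$ times the vector of $V$ representing $\alpha$, and $s_\alpha(p)=p-\langle p,\alpha^\vee\rangle\alpha$. A root system is a nonempty finite set $\Phi\subseteq V^*\setminus\{0\}$ with $s_\alpha(\beta)\in\Phi$, $\mathbb R\alpha\cap\Phi=\{\alpha,-\alpha\}$ and $\langle\alpha,\beta^\vee\rangle\in\mathbb Z$ for all $\alpha,\beta\in\Phi$. It is essential if $\operatorname{span}\Phi=V^*$, and irreducible if it is not a disjoint union of two nonempty mutually orthogonal subsets. The root lattice $\mathcal L$ is the set of integer linear combinations of roots. Euclidean Coxeter complex. The hyperplanes $\{x\in V:\langle\alpha,x\rangle=k\}$, $(\alpha,k)\in\Phi\times\mathbb Z$, partition $V$ into relatively open cells: a cell is a nonempty set obtained by choosing, for every $(\alpha,k)$, one of the conditions $\langle\alpha,x\rangle=k$, $>k$, $<k$. Each cell is the relative interior of a geometric simplex. The Euclidean Coxeter complex consists of these cells and $\emptyset$; $\mathcal V$ is the set of its vertices (points forming one-point cells). General notions. $\operatorname{dom}$ denotes the set where a function is finite. A convex set is locally polyhedral if its intersection with every polytope is a polytope; a function is locally polyhedral convex if its epigraph is a locally polyhedral convex set. For a function $h$ on $V$ (resp. $V^*$), $\Pi(h)$ is the family of all nonempty sets $\operatorname{argmin}(h-p)$, $p\in V^*$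 (resp. $p\in V$), where $h-p$ is $h$ minus the linear function given by $p$. $h'(x;\cdot)$ is the one-sided directional derivative $h'(x;d)=\lim_{t\downarrow0}(h(x+td)-h(x))/t$. A polyhedral sublinear function is a function whose epigraph is a polyhedral cone. L-notions of type $\Phi$. An L-convex cone is a set $\{x\in V:\langle\alpha,x\rangle\le0\ \forall\alpha\in\Phi'\}$, $\Phi'\subseteq\Phi$. An L-convex polyhedron is a nonempty set $\{x\in V:\langle\alpha,x\rangle\le\gamma(\alpha)\ \forall\alpha\in\Phi\}$, $\gamma:\Phi\to\mathbb R\cup\{+\infty\}$; it is integral if $\gamma$ can be chosen with values in $\mathbb Z\cup\{+\infty\}$. An L-sublinear function is a proper polyhedral sublinear function $\sigma:V\to\mathbb R\cup\{+\infty\}$ such that every member of $\Pi(\sigma)$ is an L-convex cone; it is integral if there is a nonempty finite $B\subseteq\mathcal L$ with $\sigma(x)=\max_{p\in B}\langle p,x\rangle$ for $x\in\operatorname{dom}\sigma$. A proper locally polyhedral convex function $\hat f:V\to\mathbb R\cup\{+\infty\}$ is an integral locally polyhedral L-convex function if every member of $\Pi(\hat f)$ is an integral L-convex polyhedron and $\hat f'(x;\cdot)$ is an integral L-sublinear function for every $x\in\operatorname{dom}\hat f$. A function $f:\mathcal V\to\mathbb R\cup\{+\infty\}$ is integral L-convex if it is the restriction to $\mathcal V$ of such an $\hat f$. M-notions of type $\Phi$. An M-convex cone is $\operatorname{cone}\Phi'$, $\Phi'\subseteq\Phi$. An M-convex polyhedron is a nonempty closed convex set $P\subseteq V^*$ whose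 tangent cone $\operatorname{cl}(\operatorname{cone}(P-p))$ at every $p\in P$ is an M-convex cone; it is integral if $P=\operatorname{conv}(P\cap\mathcal L)$. For $\gamma:\Phi\to\mathbb R\cup\{+\infty\}$ let $(\operatorname{cone}\gamma)(p)=\inf\{\sum_{\alpha}\mu(\alpha)\gamma(\alpha):\mu\ge0,\ p=\sum_\alpha\mu(\alpha)\alpha\}$, sums over $\alpha$ with $\gamma(\alpha)<+\infty$ ($\inf\emptyset=+\infty$). An integral M-sublinear function is a function $\operatorname{cone}\gamma$ on $V^*$ with $\gamma:\Phi\to\mathbb Z\cup\{+\infty\}$ such that $\{x\in V:\langle\alpha,x\rangle\le\gamma(\alpha)\ \forall\alpha\}\neq\emptyset$. A proper locally polyhedral convex function $\hat g:V^*\to\mathbb R\cup\{+\infty\}$ is an integral locally polyhedral M-convex function if every member of $\Pi(\hat g)$ is an integral M-convex polyhedron and $\hat g'(p;\cdot)$ is an integral M-sublinear function for every $p\in\operatorname{dom}\hat g$. A function $g:\mathcal L\to\mathbb R\cup\{+\infty\}$ is integral M-convex if it is the restriction to $\mathcal L$ of such a $\hat g$. *)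

theory Defs
  imports "HOL-Analysis.Analysis"
begin

text \<open>The space \<open>V\<close> is a type of class \<open>euclidean_space\<close>, and its dual \<open>V*\<close> is the type of
  (automatically bounded) linear functionals on it.\<close>

type_synonym 'a dual = "('a, real) blinfun"


section \<open>Root systems\<close>

definition riesz :: "'a::euclidean_space dual \<Rightarrow> 'a" where
  "riesz p = (THE v. \<forall>x. blinfun_apply p x = v \<bullet> x)"

lemma blinfun_apply_eq_riesz: "blinfun_apply p x = riesz p \<bullet> x"
proof -
  have "\<exists>!v. \<forall>x. blinfun_apply p x = v \<bullet> x"
  proof (rule ex1I)
    show "\<forall>x. blinfun_apply p x = (\<Sum>b\<in>Basis. blinfun_apply p b *\<^sub>R b) \<bullet> x"
    proof
      fix x
      have "blinfun_apply p x = blinfun_apply p (\<Sum>b\<in>Basis. (x \<bullet> b) *\<^sub>R b)"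
        by (simp add: euclidean_representation)
      also have "\<dots> = (\<Sum>b\<in>Basis. blinfun_apply p b *\<^sub>R b) \<bullet> x"
        unfolding blinfun.sum_right blinfun.scaleR_right inner_sum_left inner_scaleR_left
        by (intro sum.cong refl) (simp add: inner_commute)
      finally show "blinfun_apply p x = (\<Sum>b\<in>Basis. blinfun_apply p b *\<^sub>R b) \<bullet> x" .
    qed
  next
    fix v
    assume v: "\<forall>x. blinfun_apply p x = v \<bullet> x"
    show "v = (\<Sum>b\<in>Basis. blinfun_apply p b *\<^sub>R b)"
      using v by (simp add: euclidean_representation)
  qed
  from theI'[OF this] have "\<forall>x. blinfun_apply p x = riesz p \<bullet> x"
    unfolding riesz_def .
  then show ?thesis ..
qed

text \<open>The induced inner product on \<open>V*\<close>; its norm is the operator norm of the type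
  \<open>'a dual\<close>, see \<open>dual_inner_self\<close> below.\<close>

definition dual_inner :: "'a::euclidean_space dual \<Rightarrow> 'a dual \<Rightarrow> real" where
  "dual_inner p q = riesz p \<bullet> riesz q"

lemma dual_inner_self: "dual_inner p p = (norm p)\<^sup>2"
proof -
  have "norm p = norm (riesz p)"
  proof (rule antisym)
    show "norm p \<le> norm (riesz p)"
    proof (rule norm_blinfun_bound)
      show "norm (blinfun_apply p x) \<le> norm (riesz p) * norm x" for x
        using Cauchy_Schwarz_ineq2[of "riesz p" x] unfolding blinfun_apply_eq_riesz real_norm_def .
    qed simp
    have "\<bar>riesz p \<bullet> riesz p\<bar> \<le> norm p * norm (riesz p)"
      using norm_blinfun[of p "riesz p"] unfolding blinfun_apply_eq_riesz real_norm_def .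
    then have "norm (riesz p) * norm (riesz p) \<le> norm p * norm (riesz p)"
      by (simp only: abs_of_nonneg[OF inner_ge_zero] dot_square_norm power2_eq_square)
    then show "norm (riesz p) \<le> norm p"
      by (metis mult_right_le_imp_le norm_ge_zero zero_less_norm_iff norm_zero)
  qed
  then show ?thesis
    by (simp add: dual_inner_def power2_norm_eq_inner)
qed

definition coroot :: "'a::euclidean_space dual \<Rightarrow> 'a" where
  "coroot \<alpha> = (2 / dual_inner \<alpha> \<alpha>) *\<^sub>R riesz \<alpha>"

definition reflection :: "'a::euclidean_space dual \<Rightarrow> 'a dual \<Rightarrow> 'a dual" where
  "reflection \<alpha> p = p - blinfun_apply p (coroot \<alpha>) *\<^sub>R \<alpha>"

definition root_system :: "'a::euclidean_space dual set \<Rightarrow> bool" where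
  "root_system \<Phi> \<longleftrightarrow> \<Phi> \<noteq> {} \<and> finite \<Phi> \<and> 0 \<notin> \<Phi> \<and>
    (\<forall>\<alpha>\<in>\<Phi>. \<forall>\<beta>\<in>\<Phi>. reflection \<alpha> \<beta> \<in> \<Phi>) \<and>
    (\<forall>\<alpha>\<in>\<Phi>. range (\<lambda>c::real. c *\<^sub>R \<alpha>) \<inter> \<Phi> = {\<alpha>, - \<alpha>}) \<and>
    (\<forall>\<alpha>\<in>\<Phi>. \<forall>\<beta>\<in>\<Phi>. blinfun_apply \<alpha> (coroot \<beta>) \<in> \<int>)"

definition essential :: "'a::euclidean_space dual set \<Rightarrow> bool" where
  "essential \<Phi> \<longleftrightarrow> span \<Phi> = UNIV"

definition irreducible_roots :: "'a::euclidean_space dual set \<Rightarrow> bool" where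
  "irreducible_roots \<Phi> \<longleftrightarrow> \<not> (\<exists>\<Phi>1 \<Phi>2. \<Phi>1 \<noteq> {} \<and> \<Phi>2 \<noteq> {} \<and> \<Phi>1 \<inter> \<Phi>2 = {} \<and> \<Phi>1 \<union> \<Phi>2 = \<Phi> \<and>
    (\<forall>\<alpha>\<in>\<Phi>1. \<forall>\<beta>\<in>\<Phi>2. dual_inner \<alpha> \<beta> = 0))"

text \<open>A root system has one of the classical types if it is the image of the standard
  realization in \<open>\<real>\<^sup>n\<close> (for \<open>A\<^sub>n\<close>: in the sum-zero hyperplane of \<open>\<real>\<^sup>n\<^sup>+\<^sup>1\<close>) under an injective
  linear map. Such a map is an isomorphism of root systems: the reflections of a root system,
  and hence the integers \<open>\<langle>\<alpha>, \<beta>\<^sup>\<or>\<rangle>\<close>, are determined on \<open>span \<Phi>\<close> by \<open>\<Phi>\<close> and the vector space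
  structure alone. An injective linear map out of \<open>\<real>\<^sup>n\<close> is given by the linearly independent family
  of the images \<open>e\<^sub>1, \<dots>, e\<^sub>n\<close> of the standard basis; one out of the sum-zero hyperplane, by an
  affinely independent family \<open>u\<^sub>0, \<dots>, u\<^sub>n\<close>, through \<open>e\<^sub>i - e\<^sub>j \<mapsto> u\<^sub>i - u\<^sub>j\<close>.\<close>

definition indep_family :: "nat \<Rightarrow> (nat \<Rightarrow> 'b::real_vector) \<Rightarrow> bool" where
  "indep_family n e \<longleftrightarrow> inj_on e {1..n} \<and> independent (e ` {1..n})"

definition aff_indep_family :: "nat \<Rightarrow> (nat \<Rightarrow> 'b::real_vector) \<Rightarrow> bool" where
  "aff_indep_family n u \<longleftrightarrow> inj_on u {0..n} \<and> \<not> affine_dependent (u ` {0..n})"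

definition type_A :: "nat \<Rightarrow> 'b::real_vector set \<Rightarrow> bool" where
  "type_A n \<Phi> \<longleftrightarrow> n \<ge> 1 \<and> (\<exists>u. aff_indep_family n u \<and>
    \<Phi> = {u i - u j | i j. i \<in> {0..n} \<and> j \<in> {0..n} \<and> i \<noteq> j})"

definition type_B :: "nat \<Rightarrow> 'b::real_vector set \<Rightarrow> bool" where
  "type_B n \<Phi> \<longleftrightarrow> n \<ge> 2 \<and> (\<exists>e. indep_family n e \<and>
    \<Phi> = {s *\<^sub>R e i | (s::real) i. s \<in> {1, - 1} \<and> i \<in> {1..n}} \<union>
        {s *\<^sub>R e i + t *\<^sub>R e j | (s::real) (t::real) i j. s \<in> {1, - 1} \<and> t \<in> {1, - 1} \<and>
           i \<in> {1..n} \<and> j \<in> {1..n} \<and> i \<noteq> j})"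

definition type_C :: "nat \<Rightarrow> 'b::real_vector set \<Rightarrow> bool" where
  "type_C n \<Phi> \<longleftrightarrow> n \<ge> 2 \<and> (\<exists>e. indep_family n e \<and>
    \<Phi> = {(2 * s) *\<^sub>R e i | (s::real) i. s \<in> {1, - 1} \<and> i \<in> {1..n}} \<union>
        {s *\<^sub>R e i + t *\<^sub>R e j | (s::real) (t::real) i j. s \<in> {1, - 1} \<and> t \<in> {1, - 1} \<and>
           i \<in> {1..n} \<and> j \<in> {1..n} \<and> i \<noteq> j})"

definition type_D :: "nat \<Rightarrow> 'b::real_vector set \<Rightarrow> bool" where
  "type_D n \<Phi> \<longleftrightarrow> n \<ge> 4 \<and> (\<exists>e. indep_family n e \<and>
    \<Phi> = {s *\<^sub>R e i + t *\<^sub>R e j | (s::real) (t::real) i j. s \<in> {1, - 1} \<and> t \<in> {1, - 1} \<and>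
           i \<in> {1..n} \<and> j \<in> {1..n} \<and> i \<noteq> j})"

definition classical_type :: "'b::real_vector set \<Rightarrow> bool" where
  "classical_type \<Phi> \<longleftrightarrow> (\<exists>n. type_A n \<Phi> \<or> type_B n \<Phi> \<or> type_C n \<Phi> \<or> type_D n \<Phi>)"

definition root_lattice :: "'a::euclidean_space dual set \<Rightarrow> 'a dual set" where
  "root_lattice \<Phi> = {\<Sum>\<alpha>\<in>\<Phi>. of_int (c \<alpha>) *\<^sub>R \<alpha> | c :: 'a dual \<Rightarrow> int. True}"


section \<open>The Euclidean Coxeter complex\<close>

text \<open>The sign \<open>s \<alpha> k\<close> encodes the condition chosen for \<open>(\<alpha>, k)\<close>: \<open>0\<close>, \<open>1\<close>, \<open>-1\<close> stand for
  \<open>\<langle>\<alpha>, x\<rangle> = k\<close>, \<open>> k\<close>, \<open>< k\<close>. Any other value of \<open>s\<close> would make the cell empty.\<close>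

definition coxeter_cells :: "'a::euclidean_space dual set \<Rightarrow> 'a set set" where
  "coxeter_cells \<Phi> = {C. C \<noteq> {} \<and>
    (\<exists>s :: 'a dual \<Rightarrow> int \<Rightarrow> real. C = {x. \<forall>\<alpha>\<in>\<Phi>. \<forall>k. sgn (blinfun_apply \<alpha> x - of_int k) = s \<alpha> k})}"

definition coxeter_vertices :: "'a::euclidean_space dual set \<Rightarrow> 'a set" where
  "coxeter_vertices \<Phi> = {x. {x} \<in> coxeter_cells \<Phi>}"


section \<open>Extended real-valued functions\<close>

text \<open>Functions into \<open>\<real> \<union> {+\<infinity>}\<close> are \<open>ereal\<close>-valued functions avoiding \<open>-\<infinity>\<close>.\<close>

definition edom :: "('b \<Rightarrow> ereal) \<Rightarrow> 'b set" where
  "edom h = {x. \<bar>h x\<bar> \<noteq> \<infinity>}"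

definition proper_fun :: "('b \<Rightarrow> ereal) \<Rightarrow> bool" where
  "proper_fun h \<longleftrightarrow> (\<forall>x. h x \<noteq> - \<infinity>) \<and> (\<exists>x. h x \<noteq> \<infinity>)"

definition epi :: "('b \<Rightarrow> ereal) \<Rightarrow> ('b \<times> real) set" where
  "epi h = {(x, t). h x \<le> ereal t}"

definition locally_polyhedral :: "'b::real_vector set \<Rightarrow> bool" where
  "locally_polyhedral S \<longleftrightarrow> convex S \<and> (\<forall>Q. polytope Q \<longrightarrow> polytope (S \<inter> Q))"

definition locally_polyhedral_convex_fun :: "('b::real_vector \<Rightarrow> ereal) \<Rightarrow> bool" where
  "locally_polyhedral_convex_fun h \<longleftrightarrow> locally_polyhedral (epi h)"

definition polyhedral_sublinear :: "('b::euclidean_space \<Rightarrow> ereal) \<Rightarrow> bool" where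
  "polyhedral_sublinear h \<longleftrightarrow> polyhedron (epi h) \<and> convex_cone (epi h)"

definition argmin_set :: "('b \<Rightarrow> ereal) \<Rightarrow> 'b set" where
  "argmin_set h = {x. \<forall>y. h x \<le> h y}"

text \<open>The family \<open>\<Pi>(h)\<close>, for functions on \<open>V\<close> and for functions on \<open>V*\<close>.\<close>

definition Pi_V :: "('a::euclidean_space \<Rightarrow> ereal) \<Rightarrow> 'a set set" where
  "Pi_V h = {S. S \<noteq> {} \<and> (\<exists>p. S = argmin_set (\<lambda>x. h x - ereal (blinfun_apply p x)))}"

definition Pi_dual :: "('a::euclidean_space dual \<Rightarrow> ereal) \<Rightarrow> 'a dual set set" where
  "Pi_dual h = {S. S \<noteq> {} \<and> (\<exists>x. S = argmin_set (\<lambda>p. h p - ereal (blinfun_apply p x)))}"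

definition dir_deriv :: "('b::real_vector \<Rightarrow> ereal) \<Rightarrow> 'b \<Rightarrow> 'b \<Rightarrow> ereal" where
  "dir_deriv h x d = Lim (at_right (0::real)) (\<lambda>t. (h (x + t *\<^sub>R d) - h x) / ereal t)"

definition Z_inf :: "ereal set" where
  "Z_inf = insert \<infinity> (range (\<lambda>k::int. ereal (of_int k)))"


section \<open>L-convexity\<close>

definition gamma_polyhedron :: "'a::euclidean_space dual set \<Rightarrow> ('a dual \<Rightarrow> ereal) \<Rightarrow> 'a set" where
  "gamma_polyhedron \<Phi> \<gamma> = {x. \<forall>\<alpha>\<in>\<Phi>. ereal (blinfun_apply \<alpha> x) \<le> \<gamma> \<alpha>}"

definition L_convex_cone :: "'a::euclidean_space dual set \<Rightarrow> 'a set \<Rightarrow> bool" where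
  "L_convex_cone \<Phi> C \<longleftrightarrow> (\<exists>\<Phi>'. \<Phi>' \<subseteq> \<Phi> \<and> C = {x. \<forall>\<alpha>\<in>\<Phi>'. blinfun_apply \<alpha> x \<le> 0})"

definition integral_L_convex_polyhedron :: "'a::euclidean_space dual set \<Rightarrow> 'a set \<Rightarrow> bool" where
  "integral_L_convex_polyhedron \<Phi> P \<longleftrightarrow>
    P \<noteq> {} \<and> (\<exists>\<gamma>. (\<forall>\<alpha>\<in>\<Phi>. \<gamma> \<alpha> \<in> Z_inf) \<and> P = gamma_polyhedron \<Phi> \<gamma>)"

definition L_sublinear :: "'a::euclidean_space dual set \<Rightarrow> ('a \<Rightarrow> ereal) \<Rightarrow> bool" where
  "L_sublinear \<Phi> \<sigma> \<longleftrightarrow>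
    proper_fun \<sigma> \<and> polyhedral_sublinear \<sigma> \<and> (\<forall>C\<in>Pi_V \<sigma>. L_convex_cone \<Phi> C)"

definition integral_L_sublinear :: "'a::euclidean_space dual set \<Rightarrow> ('a \<Rightarrow> ereal) \<Rightarrow> bool" where
  "integral_L_sublinear \<Phi> \<sigma> \<longleftrightarrow> L_sublinear \<Phi> \<sigma> \<and>
    (\<exists>B. B \<noteq> {} \<and> finite B \<and> B \<subseteq> root_lattice \<Phi> \<and>
      (\<forall>x\<in>edom \<sigma>. \<sigma> x = ereal (Max ((\<lambda>p. blinfun_apply p x) ` B))))"

definition integral_locpoly_L_convex ::
    "'a::euclidean_space dual set \<Rightarrow> ('a \<Rightarrow> ereal) \<Rightarrow> bool" where
  "integral_locpoly_L_convex \<Phi> h \<longleftrightarrow> proper_fun h \<and> locally_polyhedral_convex_fun h \<and>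
    (\<forall>P\<in>Pi_V h. integral_L_convex_polyhedron \<Phi> P) \<and>
    (\<forall>x\<in>edom h. integral_L_sublinear \<Phi> (dir_deriv h x))"

text \<open>A function on \<open>\<V>\<close> is represented by a function on all of \<open>V\<close> of which only the values
  on \<open>\<V>\<close> matter; similarly for functions on \<open>\<L>\<close>.\<close>

definition integral_L_convex :: "'a::euclidean_space dual set \<Rightarrow> ('a \<Rightarrow> ereal) \<Rightarrow> bool" where
  "integral_L_convex \<Phi> f \<longleftrightarrow>
    (\<exists>h. integral_locpoly_L_convex \<Phi> h \<and> (\<forall>x\<in>coxeter_vertices \<Phi>. f x = h x))"


section \<open>M-convexity\<close>

definition M_convex_cone :: "'a::euclidean_space dual set \<Rightarrow> 'a dual set \<Rightarrow> bool" where
  "M_convex_cone \<Phi> C \<longleftrightarrow> (\<exists>\<Phi>'. \<Phi>' \<subseteq> \<Phi> \<and> C = convex_cone hull \<Phi>')"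

definition tangent_cone :: "'b::real_normed_vector set \<Rightarrow> 'b \<Rightarrow> 'b set" where
  "tangent_cone P p = closure (convex_cone hull ((\<lambda>q. q - p) ` P))"

definition M_convex_polyhedron :: "'a::euclidean_space dual set \<Rightarrow> 'a dual set \<Rightarrow> bool" where
  "M_convex_polyhedron \<Phi> P \<longleftrightarrow> P \<noteq> {} \<and> closed P \<and> convex P \<and>
    (\<forall>p\<in>P. M_convex_cone \<Phi> (tangent_cone P p))"

definition integral_M_convex_polyhedron ::
    "'a::euclidean_space dual set \<Rightarrow> 'a dual set \<Rightarrow> bool" where
  "integral_M_convex_polyhedron \<Phi> P \<longleftrightarrow>
    M_convex_polyhedron \<Phi> P \<and> P = convex hull (P \<inter> root_lattice \<Phi>)"

definition cone_fun ::
    "'a::euclidean_space dual set \<Rightarrow> ('a dual \<Rightarrow> ereal) \<Rightarrow> 'a dual \<Rightarrow> ereal" where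
  "cone_fun \<Phi> \<gamma> p =
    Inf {\<Sum>\<alpha>\<in>{\<alpha>\<in>\<Phi>. \<gamma> \<alpha> < \<infinity>}. ereal (\<mu> \<alpha>) * \<gamma> \<alpha> | \<mu> :: 'a dual \<Rightarrow> real.
      (\<forall>\<alpha>. \<mu> \<alpha> \<ge> 0) \<and> p = (\<Sum>\<alpha>\<in>{\<alpha>\<in>\<Phi>. \<gamma> \<alpha> < \<infinity>}. \<mu> \<alpha> *\<^sub>R \<alpha>)}"

definition integral_M_sublinear ::
    "'a::euclidean_space dual set \<Rightarrow> ('a dual \<Rightarrow> ereal) \<Rightarrow> bool" where
  "integral_M_sublinear \<Phi> \<tau> \<longleftrightarrow>
    (\<exists>\<gamma>. (\<forall>\<alpha>\<in>\<Phi>. \<gamma> \<alpha> \<in> Z_inf) \<and> gamma_polyhedron \<Phi> \<gamma> \<noteq> {} \<and> \<tau> = cone_fun \<Phi> \<gamma>)"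

definition integral_locpoly_M_convex ::
    "'a::euclidean_space dual set \<Rightarrow> ('a dual \<Rightarrow> ereal) \<Rightarrow> bool" where
  "integral_locpoly_M_convex \<Phi> h \<longleftrightarrow> proper_fun h \<and> locally_polyhedral_convex_fun h \<and>
    (\<forall>P\<in>Pi_dual h. integral_M_convex_polyhedron \<Phi> P) \<and>
    (\<forall>p\<in>edom h. integral_M_sublinear \<Phi> (dir_deriv h p))"

definition integral_M_convex :: "'a::euclidean_space dual set \<Rightarrow> ('a dual \<Rightarrow> ereal) \<Rightarrow> bool" where
  "integral_M_convex \<Phi> g \<longleftrightarrow>
    (\<exists>h. integral_locpoly_M_convex \<Phi> h \<and> (\<forall>p\<in>root_lattice \<Phi>. g p = h p))"


section \<open>Discrete Fenchel--Legendre conjugates\<close>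

definition conj_L :: "'a::euclidean_space dual set \<Rightarrow> ('a \<Rightarrow> ereal) \<Rightarrow> 'a dual \<Rightarrow> ereal" where
  "conj_L \<Phi> f p = (SUP x \<in> coxeter_vertices \<Phi> \<inter> edom f. ereal (blinfun_apply p x) - f x)"

definition conj_M :: "'a::euclidean_space dual set \<Rightarrow> ('a dual \<Rightarrow> ereal) \<Rightarrow> 'a \<Rightarrow> ereal" where
  "conj_M \<Phi> g x = (SUP p \<in> root_lattice \<Phi> \<inter> edom g. ereal (blinfun_apply p x) - g p)"

end

theory Submission
  imports Defs
begin

text \<open>Everything is moved from \<open>V*\<close> to \<open>V\<close> by the Riesz isomorphism. For a finite set \<open>N\<close> of
  vectors, call a set saturated if with every point \<open>x\<close> it contains the closed cell of \<open>x\<close> in the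
  arrangement of all hyperplanes on which some \<open>n \<in> N\<close> takes an integer value. Integral L-convex
  polyhedra are saturated for \<open>N = \<Phi>\<close>. Integral M-convex polyhedra are saturated for a finite set
  of facet normals of the cones spanned by roots, scaled to be integral on \<open>\<Phi>\<close>: each of their
  supporting hyperplanes with such a normal contains a lattice point.

  Let \<open>h\<close> be closed convex with nonempty saturated subdifferentials. Their union is saturated, hence
  closed, and it is dense in the domain of the conjugate \<open>h*\<close>, so it is that domain. Therefore
  \<open>h*\<close> is affine on every cell of its domain, is locally polyhedral, and has as directional
  derivatives the support functions of its subdifferentials, which are the members of \<open>\<Pi>(h)\<close>.
  The members of \<open>\<Pi>(h*)\<close> are the subdifferentials of \<open>h\<close>. The remaining points are that support
  functions of integral L-convex polyhedra are M-sublinear (linear programming duality), that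
  support functions of integral M-convex polyhedra are L-sublinear, and that the subdifferentials
  of an integral L-convex function are convex hulls of lattice points.

  The suprema defining the discrete conjugates may be extended to all of \<open>V\<close> and \<open>V*\<close>, since every
  domain of linearity of \<open>h\<close> is the convex hull of its vertices of the Coxeter complex or of its
  lattice points. The theorem then reduces to \<open>h** = h\<close>.\<close>

subsection \<open>Cells of an integral arrangement\<close>

text \<open>For a general closed convex function the range of the subdifferential is only dense in
  the domain of the conjugate, and an infinite union of closed sets need not be closed. Saturation
  is the remedy: it passes to arbitrary unions, and it forces closedness because the arrangement is
  locally finite. In \<open>cell N x\<close> floor and ceiling agree where \<open>n\<close> has an
  integer value at \<open>x\<close>, which gives an equation there and a strip elsewhere.

  The order of the deductions is forced. Subgradients must exist before anything is known about
  cells; they come from the lattice points of the maximum representation in the L case and from the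
  points of the polyhedron of \<gamma> in the M case. Only then do the argmin sets make the function
  affine on cells, and only then is its directional derivative known to be the support function of
  the subdifferential.

  Integrality of subdifferentials cannot be read off from vertices, since these polyhedra may
  contain lines; \<open>root_tangent_integral\<close> moves along roots instead.\<close>

definition cell :: "'b::real_inner set \<Rightarrow> 'b \<Rightarrow> 'b set" where
  "cell N x = {y. \<forall>n\<in>N. of_int \<lfloor>n \<bullet> x\<rfloor> \<le> n \<bullet> y \<and> n \<bullet> y \<le> of_int \<lceil>n \<bullet> x\<rceil>}"

definition cell_saturated :: "'b::real_inner set \<Rightarrow> 'b set \<Rightarrow> bool" where
  "cell_saturated N S \<longleftrightarrow> (\<forall>x\<in>S. cell N x \<subseteq> S)"

lemma cell_self: "x \<in> cell N x"
  by (simp add: cell_def)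

lemma cell_alt:
  "cell N x = (\<Inter>n\<in>N. {y. n \<bullet> y \<ge> of_int \<lfloor>n \<bullet> x\<rfloor>} \<inter> {y. n \<bullet> y \<le> of_int \<lceil>n \<bullet> x\<rceil>})"
  by (auto simp: cell_def)

lemma convex_cell: "convex (cell N x)"
  unfolding cell_alt by (intro convex_INT convex_Int convex_halfspace_ge convex_halfspace_le)

lemma closed_cell: "closed (cell N x)"
  unfolding cell_alt by (intro closed_INT ballI closed_Int closed_halfspace_ge closed_halfspace_le)

text \<open>If \<open>b\<close> is shorter than the distance from \<open>a\<close> to the nearest
  other integers, the segment from \<open>a\<close> to \<open>a + b\<close> contains no integer
  except possibly \<open>a\<close>, so rounding any of its points beyond \<open>a\<close> brackets
  both ends.\<close>

lemma floor_ceiling_local: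
  fixes a :: real
  obtains e where "e > 0" "\<And>b s. \<lbrakk>\<bar>b\<bar> < e; 0 < s; s \<le> 1\<rbrakk> \<Longrightarrow>
    of_int \<lfloor>a + s * b\<rfloor> \<le> a \<and> a \<le> of_int \<lceil>a + s * b\<rceil> \<and>
    of_int \<lfloor>a + s * b\<rfloor> \<le> a + b \<and> a + b \<le> of_int \<lceil>a + s * b\<rceil>"
proof
  \<comment> \<open>Distances from \<open>a\<close> to the next integers strictly above and strictly
    below; both are positive even when \<open>a\<close> is an integer.\<close>
  define u l where "u = of_int \<lfloor>a\<rfloor> + 1 - a" and "l = a - (of_int \<lceil>a\<rceil> - 1)"
  show "min u l > 0" unfolding u_def l_def by linarith
  fix b s :: real
  assume b: "\<bar>b\<bar> < min u l" and s: "0 < s" "s \<le> 1"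
  define p where "p = s * b"
  have sb: "\<bar>p\<bar> \<le> \<bar>b\<bar>"
    using s mult_right_mono[of s 1 "\<bar>b\<bar>"] by (simp add: abs_mult p_def)
  have sg: "p \<ge> 0 \<longleftrightarrow> b \<ge> 0" "p > 0 \<longleftrightarrow> b > 0"
    using s by (auto simp: zero_le_mult_iff zero_less_mult_iff p_def)
  have bu: "\<bar>b\<bar> < u" "\<bar>b\<bar> < l" using b by auto
  have fl: "\<lfloor>a + p\<rfloor> = (if b \<ge> 0 then \<lfloor>a\<rfloor> else \<lceil>a\<rceil> - 1)"
    using bu sb sg unfolding u_def l_def by (cases "b \<ge> 0"; simp only: if_True if_False; linarith)
  have ce: "\<lceil>a + p\<rceil> = (if b > 0 then \<lfloor>a\<rfloor> + 1 else \<lceil>a\<rceil>)"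
    using bu sb sg unfolding u_def l_def by (cases "b > 0"; simp only: if_True if_False; linarith)
  have "of_int \<lfloor>a\<rfloor> \<le> a" "a \<le> of_int \<lceil>a\<rceil>" by linarith+
  then show "of_int \<lfloor>a + s * b\<rfloor> \<le> a \<and> a \<le> of_int \<lceil>a + s * b\<rceil> \<and>
    of_int \<lfloor>a + s * b\<rfloor> \<le> a + b \<and> a + b \<le> of_int \<lceil>a + s * b\<rceil>"
    using bu unfolding fl[unfolded p_def] ce[unfolded p_def] u_def l_def
    by (auto split: if_splits; linarith)
qed

text \<open>A short move from \<open>x\<close> can leave hyperplanes through \<open>x\<close> but
  cannot reach a new one. The parameter \<open>s\<close> serves to pass from feasibility of an
  arbitrarily small step along \<open>d\<close> to feasibility of the whole step.\<close>

lemma cell_local: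
  fixes x :: "'b::real_inner"
  assumes "finite N"
  obtains e where "e > 0" "\<And>d s. \<lbrakk>norm d < e; 0 < s; s \<le> 1\<rbrakk> \<Longrightarrow>
    x \<in> cell N (x + s *\<^sub>R d) \<and> x + d \<in> cell N (x + s *\<^sub>R d)"
proof -
  have "\<exists>e>0. \<forall>d s. norm d < e \<and> 0 < s \<and> s \<le> 1 \<longrightarrow>
    x \<in> cell N (x + s *\<^sub>R d) \<and> x + d \<in> cell N (x + s *\<^sub>R d)"
    using assms
  proof (induction N)
    case empty
    then show ?case by (auto simp: cell_def intro: exI[of _ 1])
  next
    case (insert m N)
    then obtain e where e: "e > 0" "\<And>d s. \<lbrakk>norm d < e; 0 < s; s \<le> 1\<rbrakk> \<Longrightarrow>
      x \<in> cell N (x + s *\<^sub>R d) \<and> x + d \<in> cell N (x + s *\<^sub>R d)"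
      by auto
    obtain f where f: "f > 0" "\<And>b s. \<lbrakk>\<bar>b\<bar> < f; 0 < s; s \<le> 1\<rbrakk> \<Longrightarrow>
      of_int \<lfloor>m \<bullet> x + s * b\<rfloor> \<le> m \<bullet> x \<and> m \<bullet> x \<le> of_int \<lceil>m \<bullet> x + s * b\<rceil> \<and>
      of_int \<lfloor>m \<bullet> x + s * b\<rfloor> \<le> m \<bullet> x + b \<and> m \<bullet> x + b \<le> of_int \<lceil>m \<bullet> x + s * b\<rceil>"
      using floor_ceiling_local[of "m \<bullet> x"] by metis
    \<comment> \<open>The \<open>+ 1\<close> covers \<open>m = 0\<close>.\<close>
    define g where "g = min e (f / (norm m + 1))"
    have nm: "norm m + 1 > 0" by (smt (verit) norm_ge_zero)
    have "x \<in> cell (insert m N) (x + s *\<^sub>R d) \<and> x + d \<in> cell (insert m N) (x + s *\<^sub>R d)"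
      if d: "norm d < g" "0 < s" "s \<le> 1" for d s
    proof -
      have "\<bar>m \<bullet> d\<bar> \<le> norm m * norm d" by (rule Cauchy_Schwarz_ineq2)
      also have "\<dots> \<le> (norm m + 1) * norm d" by (simp add: mult_right_mono)
      also have "\<dots> < (norm m + 1) * (f / (norm m + 1))"
        using d(1) nm by (intro mult_strict_left_mono) (auto simp: g_def)
      finally have "\<bar>m \<bullet> d\<bar> < f" using nm by simp
      from f(2)[OF this d(2,3)] e(2)[OF _ d(2,3)] d(1) show ?thesis
        by (simp add: cell_def g_def inner_add_right)
    qed
    moreover have "g > 0" using e(1) f(1) nm by (simp add: g_def)
    ultimately show ?case by blast
  qed
  then show ?thesis using that by blast
qed

text \<open>Points close to the limit have the limit in their cells, so one such point of
  \<open>S\<close> already puts the limit into \<open>S\<close>.\<close>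

lemma cell_saturated_imp_closed:
  assumes "finite N" "cell_saturated N S"
  shows "closed S"
  unfolding closed_sequential_limits
proof (intro allI impI, elim conjE)
  fix X y assume X: "\<forall>n. X n \<in> S" "X \<longlonglongrightarrow> y"
  obtain e where e: "e > 0" "\<And>d s. \<lbrakk>norm d < e; 0 < s; s \<le> 1\<rbrakk> \<Longrightarrow>
    y \<in> cell N (y + s *\<^sub>R d) \<and> y + d \<in> cell N (y + s *\<^sub>R d)"
    using cell_local[OF assms(1)] by metis
  obtain n where "norm (X n - y) < e"
    using X(2) e(1) by (auto simp: LIMSEQ_iff)
  then have "y \<in> cell N (X n)" using e(2)[of "X n - y" 1] by simp
  then show "y \<in> S" using X(1) assms(2) by (auto simp: cell_saturated_def)
qed

text \<open>A cell is coded by the floors and ceilings on \<open>N\<close>, and on a bounded set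
  these are bounded integers.\<close>

lemma finite_cells:
  assumes "finite N" "bounded S"
  shows "finite (cell N ` S)"
proof -
  obtain B where B: "\<And>x. x \<in> S \<Longrightarrow> norm x \<le> B"
    using assms(2) by (auto simp: bounded_iff)
  define c where "c n = \<lceil>norm n * B\<rceil>" for n :: 'a
  define F where "F = (\<lambda>x. restrict (\<lambda>n. (\<lfloor>n \<bullet> x\<rfloor>, \<lceil>n \<bullet> x\<rceil>)) N)"
  have "F ` S \<subseteq> PiE N (\<lambda>n. {- c n - 1..c n + 1} \<times> {- c n - 1..c n + 1})"
  proof (rule image_subsetI)
    fix x assume "x \<in> S"
    have "\<bar>n \<bullet> x\<bar> \<le> of_int (c n)" for n
    proof -
      have "\<bar>n \<bullet> x\<bar> \<le> norm n * norm x" by (rule Cauchy_Schwarz_ineq2)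
      also have "\<dots> \<le> norm n * B" using B[OF \<open>x \<in> S\<close>] by (simp add: mult_left_mono)
      also have "\<dots> \<le> of_int (c n)" by (simp add: c_def)
      finally show ?thesis .
    qed
    then have *: "\<bar>n \<bullet> x\<bar> \<le> of_int (c n)" for n .
    have "\<lfloor>n \<bullet> x\<rfloor> \<in> {- c n - 1..c n + 1} \<and> \<lceil>n \<bullet> x\<rceil> \<in> {- c n - 1..c n + 1}" for n
      using *[of n] unfolding atLeastAtMost_iff by linarith
    then show "F x \<in> PiE N (\<lambda>n. {- c n - 1..c n + 1} \<times> {- c n - 1..c n + 1})"
      by (auto simp: F_def)
  qed
  moreover have "finite (PiE N (\<lambda>n. {- c n - 1..c n + 1} \<times> {- c n - 1..c n + 1}))"
    using assms(1) by (intro finite_PiE) auto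
  ultimately have fF: "finite (F ` S)" by (rule finite_subset)
  define G where "G f = {y. \<forall>n\<in>N. of_int (fst (f n)) \<le> n \<bullet> y \<and> n \<bullet> y \<le> of_int (snd (f n))}"
    for f :: "'a \<Rightarrow> int \<times> int"
  have "cell N ` S = G ` F ` S"
    unfolding image_image by (intro image_cong) (auto simp: G_def F_def cell_def)
  then show ?thesis using fF by simp
qed

lemma polyhedron_cell_fst:
  fixes x :: "'b::euclidean_space"
  assumes "finite N"
  shows "polyhedron {z :: 'b \<times> real. fst z \<in> cell N x}"
proof -
  have eq: "{z :: 'b \<times> real. fst z \<in> cell N x} =
    (\<Inter>n\<in>N. {z. (n, 0) \<bullet> z \<ge> of_int \<lfloor>n \<bullet> x\<rfloor>} \<inter> {z. (n, 0) \<bullet> z \<le> of_int \<lceil>n \<bullet> x\<rceil>})"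
    by (auto simp: cell_def inner_prod_def)
  show ?thesis unfolding eq
    by (rule polyhedron_Inter)
      (use assms in \<open>auto simp: polyhedron_halfspace_ge polyhedron_halfspace_le\<close>)
qed

section \<open>Unions of polytopes, separation from cones, feasible directions\<close>

lemma polytope_finite_Union:
  assumes "finite F" "\<And>S. S \<in> F \<Longrightarrow> polytope S" "convex (\<Union>F)"
  shows "polytope (\<Union>F)"
proof -
  have "\<forall>S\<in>F. \<exists>W. finite W \<and> S = convex hull W"
    using assms(2) unfolding polytope_def by blast
  then obtain W where W: "\<And>S. S \<in> F \<Longrightarrow> finite (W S)" "\<And>S. S \<in> F \<Longrightarrow> S = convex hull (W S)"
    by metis
  \<comment> \<open>Pooled generators of the pieces generate no more than the union because the
    union is convex.\<close>
  have "\<Union>F = convex hull (\<Union>(W ` F))"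
  proof
    show "\<Union>F \<subseteq> convex hull (\<Union>(W ` F))"
    proof (rule Union_least)
      fix S assume "S \<in> F"
      then have "convex hull (W S) \<subseteq> convex hull (\<Union>(W ` F))"
        by (intro hull_mono) auto
      then show "S \<subseteq> convex hull (\<Union>(W ` F))" using W(2)[OF \<open>S \<in> F\<close>] by simp
    qed
    show "convex hull (\<Union>(W ` F)) \<subseteq> \<Union>F"
    proof (rule hull_minimal)
      have "W S \<subseteq> S" if "S \<in> F" for S
        using W(2)[OF that] hull_subset[of "W S" convex] by simp
      then show "\<Union>(W ` F) \<subseteq> \<Union>F" by blast
    qed (rule assms(3))
  qed
  then show ?thesis unfolding polytope_def
    using assms(1) W(1) by (intro exI[of _ "\<Union>(W ` F)"]) auto
qed

lemma convex_cone_separation: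
  fixes C :: "'b::euclidean_space set"
  assumes "convex_cone C" "closed C" "y \<notin> C"
  obtains n where "\<And>z. z \<in> C \<Longrightarrow> n \<bullet> z \<le> 0" "n \<bullet> y > 0"
proof -
  obtain a b where ab: "a \<bullet> y < b" "\<And>z. z \<in> C \<Longrightarrow> a \<bullet> z > b"
    using separating_hyperplane_closed_point[of C y] assms by (auto simp: convex_cone_def)
  have "b < 0" using ab(2)[OF convex_cone_contains_0[OF assms(1)]] by simp
  have "a \<bullet> z \<ge> 0" if "z \<in> C" for z
  proof (rule ccontr)
    assume neg: "\<not> a \<bullet> z \<ge> 0"
    \<comment> \<open>This positive multiple of \<open>z\<close> would take the value
      \<open>b\<close>, although all values on the cone exceed \<open>b\<close>.\<close>
    then have "b / (a \<bullet> z) > 0" using \<open>b < 0\<close> by (simp add: zero_less_divide_iff)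
    then have "(b / (a \<bullet> z)) *\<^sub>R z \<in> C" using that assms(1) by (intro convex_cone_scaleR) auto
    from ab(2)[OF this] neg show False by simp
  qed
  then show ?thesis using ab(1) \<open>b < 0\<close> by (intro that[of "- a"]) auto
qed

lemma feasible_direction_scale:
  assumes "convex E" "z \<in> E" "z + t *\<^sub>R v \<in> E" "0 \<le> s" "s \<le> t" "t > 0"
  shows "z + s *\<^sub>R v \<in> E"
proof -
  have "(1 - s / t) *\<^sub>R z + (s / t) *\<^sub>R (z + t *\<^sub>R v) \<in> E"
    using assms by (intro convexD) auto
  then show ?thesis using assms(6) by (simp add: algebra_simps)
qed

lemma convex_cone_feasible_directions:
  assumes "convex E" "z \<in> E"
  shows "convex_cone {v. \<exists>s>0. z + s *\<^sub>R v \<in> E}"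
  unfolding convex_cone_def
proof (intro conjI)
  define C where "C = {v. \<exists>s>0. z + s *\<^sub>R v \<in> E}"
  have "0 \<in> C" using assms(2) by (auto simp: C_def intro: exI[of _ 1])
  then show "{v. \<exists>s>0. z + s *\<^sub>R v \<in> E} \<noteq> {}" unfolding C_def by blast
  show "convex {v. \<exists>s>0. z + s *\<^sub>R v \<in> E}"
    unfolding convex_alt C_def[symmetric]
  proof (intro ballI allI impI)
    fix v w and u :: real assume vw: "v \<in> C" "w \<in> C" and u: "0 \<le> u \<and> u \<le> 1"
    then obtain s t where st: "s > 0" "z + s *\<^sub>R v \<in> E" "t > 0" "z + t *\<^sub>R w \<in> E"
      by (auto simp: C_def)
    define m where "m = min s t"
    have m: "m > 0" "m \<le> s" "m \<le> t" using st by (auto simp: m_def)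
    have "z + m *\<^sub>R v \<in> E" "z + m *\<^sub>R w \<in> E" 
        using feasible_direction_scale[OF assms st(2), of m] feasible_direction_scale[OF assms st(4), of m] st m
        by simp_all
    then have "(1 - u) *\<^sub>R (z + m *\<^sub>R v) + u *\<^sub>R (z + m *\<^sub>R w) \<in> E"
      using u by (intro convexD assms(1)) auto
    then have "z + m *\<^sub>R ((1 - u) *\<^sub>R v + u *\<^sub>R w) \<in> E" by (simp add: algebra_simps)
    then show "(1 - u) *\<^sub>R v + u *\<^sub>R w \<in> C" using m by (auto simp: C_def)
  qed
  show "conic {v. \<exists>s>0. z + s *\<^sub>R v \<in> E}"
    unfolding conic_def C_def[symmetric]
  proof (intro allI impI)
    fix v and c :: real assume v: "v \<in> C" and c: "0 \<le> c"
    obtain s where s: "s > 0" "z + s *\<^sub>R v \<in> E" using v by (auto simp: C_def)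
    show "c *\<^sub>R v \<in> C"
    proof (cases "c = 0")
      case True
      then show ?thesis using \<open>0 \<in> C\<close> by simp
    next
      case False
      then show ?thesis unfolding C_def using c s by (auto intro!: exI[of _ "s / c"])
    qed
  qed
qed

subsection \<open>Cellwise affine functions\<close>

text \<open>All convex analysis is done with a real function \<open>r\<close> on a set
  \<open>D\<close>, which keeps extended arithmetic away; \<open>fext D r\<close> is the function
  meant, so values of \<open>r\<close> off \<open>D\<close> are irrelevant.\<close>

definition fext :: "'b set \<Rightarrow> ('b \<Rightarrow> real) \<Rightarrow> 'b \<Rightarrow> ereal" where
  "fext D r x = (if x \<in> D then ereal (r x) else \<infinity>)"

definition repi :: "'b set \<Rightarrow> ('b \<Rightarrow> real) \<Rightarrow> ('b \<times> real) set" where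
  "repi D r = {(x, t). x \<in> D \<and> r x \<le> t}"

definition subgrad :: "'b::real_inner set \<Rightarrow> ('b \<Rightarrow> real) \<Rightarrow> 'b \<Rightarrow> 'b set" where
  "subgrad D r x = {p. \<forall>y\<in>D. r x + p \<bullet> (y - x) \<le> r y}"

text \<open>The affine formula is asked for every subgradient at \<open>x\<close>, not just for one.
  A subgradient then remains one on the whole cell, see
  \<open>cellwise_subgrad_mono\<close>.\<close>

definition cellwise_affine :: "'b::real_inner set \<Rightarrow> 'b set \<Rightarrow> ('b \<Rightarrow> real) \<Rightarrow> bool" where
  "cellwise_affine N D r \<longleftrightarrow> D \<noteq> {} \<and> convex (repi D r) \<and> (\<forall>x\<in>D. subgrad D r x \<noteq> {} \<and>
    (\<forall>p\<in>subgrad D r x. \<forall>y\<in>cell N x. y \<in> D \<and> r y = r x + p \<bullet> (y - x)))"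

lemma epi_fext: "epi (fext D r) = repi D r"
  by (auto simp: epi_def repi_def fext_def split: if_splits)

lemma edom_fext: "edom (fext D r) = D"
  by (auto simp: edom_def fext_def)

lemma proper_eq_fext:
  assumes "proper_fun h"
  shows "h = fext (edom h) (\<lambda>x. real_of_ereal (h x))" "edom h \<noteq> {}"
proof -
  show "h = fext (edom h) (\<lambda>x. real_of_ereal (h x))"
  proof
    fix x show "h x = fext (edom h) (\<lambda>x. real_of_ereal (h x)) x"
      using assms by (cases "h x") (auto simp: fext_def edom_def proper_fun_def)
  qed
  obtain x where "h x \<noteq> \<infinity>" "h x \<noteq> - \<infinity>" using assms by (auto simp: proper_fun_def)
  then have "x \<in> edom h" by (auto simp: edom_def)
  then show "edom h \<noteq> {}" by blast
qed

lemma proper_fext: "D \<noteq> {} \<Longrightarrow> proper_fun (fext D r)"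
  by (auto simp: proper_fun_def fext_def)

lemma convex_repiD:
  assumes "convex (repi D r)" "x \<in> D" "y \<in> D" "0 \<le> u" "u \<le> 1"
  shows "x + u *\<^sub>R (y - x) \<in> D" "r (x + u *\<^sub>R (y - x)) \<le> r x + u * (r y - r x)"
proof -
  have "(1 - u) *\<^sub>R (x, r x) + u *\<^sub>R (y, r y) \<in> repi D r"
    using assms by (intro convexD) (auto simp: repi_def)
  moreover have "(1 - u) *\<^sub>R (x, r x) + u *\<^sub>R (y, r y) =
      (x + u *\<^sub>R (y - x), r x + u * (r y - r x))"
    by (simp add: algebra_simps)
  ultimately show "x + u *\<^sub>R (y - x) \<in> D" "r (x + u *\<^sub>R (y - x)) \<le> r x + u * (r y - r x)"
    by (auto simp: repi_def)
qed

lemma convex_dom_repi: "convex (repi D r) \<Longrightarrow> convex D"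
  using convex_repiD(1)[of D r] by (auto simp: convex_alt algebra_simps)

text \<open>The members of \<Pi> are the fibres of the subdifferential, and every later use of \<Pi>
  goes through this. For empty \<open>D\<close> the function would be constantly \<infinity> and
  every point a minimizer.\<close>

lemma argmin_fext:
  assumes "D \<noteq> {}"
  shows "argmin_set (\<lambda>x. fext D r x - ereal (p \<bullet> x)) = {x\<in>D. p \<in> subgrad D r x}"
proof -
  obtain z where "z \<in> D" using assms by blast
  show ?thesis
  proof (rule set_eqI)
    fix x
    show "x \<in> argmin_set (\<lambda>x. fext D r x - ereal (p \<bullet> x)) \<longleftrightarrow> x \<in> {x\<in>D. p \<in> subgrad D r x}"
    proof (cases "x \<in> D")
      case False
      then have "\<not> (fext D r x - ereal (p \<bullet> x) \<le> fext D r z - ereal (p \<bullet> z))"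
        using \<open>z \<in> D\<close> by (simp add: fext_def)
      then show ?thesis using False by (auto simp: argmin_set_def)
    next
      case True
      then show ?thesis
        by (auto simp: argmin_set_def fext_def subgrad_def inner_diff_right algebra_simps)
    qed
  qed
qed

context
  fixes N :: "'b::euclidean_space set" and D r
  assumes fin: "finite N" and cw: "cellwise_affine N D r"
begin

lemma cellwise_facts:
  shows "D \<noteq> {}" "convex (repi D r)" "\<And>x. x \<in> D \<Longrightarrow> subgrad D r x \<noteq> {}"
    "\<And>x p y. \<lbrakk>x \<in> D; p \<in> subgrad D r x; y \<in> cell N x\<rbrakk> \<Longrightarrow> r y = r x + p \<bullet> (y - x)"
    "\<And>x y. \<lbrakk>x \<in> D; y \<in> cell N x\<rbrakk> \<Longrightarrow> y \<in> D"
  using cw by (fastforce simp: cellwise_affine_def)+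

lemma cellwise_saturated_dom: "cell_saturated N D"
  using cellwise_facts(5) by (auto simp: cell_saturated_def)

lemma cellwise_closed_dom: "closed D"
  using cell_saturated_imp_closed[OF fin cellwise_saturated_dom] .

lemma cellwise_subgrad_mono:
  assumes "x \<in> D" "p \<in> subgrad D r x" "y \<in> cell N x"
  shows "p \<in> subgrad D r y"
  using assms(2) cellwise_facts(4)[OF assms]
  by (auto simp: subgrad_def inner_diff_right algebra_simps)

text \<open>Only finitely many cells meet the projection of \<open>Q\<close>, and over each of them
  the epigraph is a polyhedron. Convexity of the whole epigraph allows the pieces to be
  glued.\<close>

lemma cellwise_polytope:
  assumes "polytope Q"
  shows "polytope (repi D r \<inter> Q)"
proof -
  define S where "S = D \<inter> fst ` Q"
  have "bounded (fst ` Q)" using polytope_imp_bounded[OF assms] bounded_fst by blast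
  then have "finite (cell N ` S)"
    by (intro finite_cells fin bounded_subset[of "fst ` Q" S]) (auto simp: S_def)
  have "\<forall>c\<in>cell N ` S. \<exists>x p. x \<in> S \<and> cell N x = c \<and> p \<in> subgrad D r x"
    using cellwise_facts(3) by (fastforce simp: S_def)
  then obtain X P where XP: "\<And>c. c \<in> cell N ` S \<Longrightarrow> X c \<in> S"
    "\<And>c. c \<in> cell N ` S \<Longrightarrow> cell N (X c) = c"
    "\<And>c. c \<in> cell N ` S \<Longrightarrow> P c \<in> subgrad D r (X c)" by metis
  \<comment> \<open>The second set is the half-space above the affine function of slope
    \<open>P c\<close> that agrees with \<open>r\<close> on \<open>c\<close>.\<close>
  define H where "H c = {z. fst z \<in> cell N (X c)} \<inter>
    {z. (P c, - 1 :: real) \<bullet> z \<le> P c \<bullet> X c - r (X c)}" for c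
  have H: "z \<in> H c \<longleftrightarrow> fst z \<in> c \<and> fst z \<in> D \<and> r (fst z) \<le> snd z" if "c \<in> cell N ` S" for c and z :: "'b \<times> real"
  proof (cases "fst z \<in> c")
    case True
    have XD: "X c \<in> D" using XP(1)[OF that] by (simp add: S_def)
    have z: "fst z \<in> cell N (X c)" using True XP(2)[OF that] by simp
    have "r (fst z) = r (X c) + P c \<bullet> (fst z - X c)" "fst z \<in> D"
      using cellwise_facts(4)[OF XD XP(3)[OF that] z] cellwise_facts(5)[OF XD z] by auto
    then show ?thesis using True z by (auto simp: H_def inner_prod_def inner_diff_right)
  next
    case False
    then show ?thesis using XP(2)[OF that] by (auto simp: H_def)
  qed
  have eq: "repi D r \<inter> Q = (\<Union>c\<in>cell N ` S. H c \<inter> Q)"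
  proof
    show "repi D r \<inter> Q \<subseteq> (\<Union>c\<in>cell N ` S. H c \<inter> Q)"
    proof
      fix z assume z: "z \<in> repi D r \<inter> Q"
      then have "fst z \<in> S" "r (fst z) \<le> snd z" by (auto simp: S_def repi_def)
      then have "z \<in> H (cell N (fst z))" using H[of "cell N (fst z)" z]
        by (auto simp: S_def cell_self)
      then show "z \<in> (\<Union>c\<in>cell N ` S. H c \<inter> Q)" using z \<open>fst z \<in> S\<close> by blast
    qed
    show "(\<Union>c\<in>cell N ` S. H c \<inter> Q) \<subseteq> repi D r \<inter> Q"
      using H by (auto simp: repi_def)
  qed
  have "polytope (\<Union>((\<lambda>c. H c \<inter> Q) ` (cell N ` S)))"
  proof (rule polytope_finite_Union)
    show "finite ((\<lambda>c. H c \<inter> Q) ` (cell N ` S))" using \<open>finite (cell N ` S)\<close> by blast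
    fix A assume "A \<in> (\<lambda>c. H c \<inter> Q) ` (cell N ` S)"
    then obtain c where "A = H c \<inter> Q" by blast
    moreover have "polyhedron (H c)"
      unfolding H_def
      by (intro polyhedron_Int polyhedron_cell_fst fin polyhedron_halfspace_le)
    ultimately show "polytope A" by (simp add: assms polyhedron_Int_polytope)
  next
    show "convex (\<Union>((\<lambda>c. H c \<inter> Q) ` (cell N ` S)))"
      using convex_Int[OF cellwise_facts(2) polytope_imp_convex[OF assms]] eq by simp
  qed
  then show ?thesis using eq by simp
qed

lemma cellwise_locally_polyhedral: "locally_polyhedral (repi D r)"
  using cellwise_polytope cellwise_facts(2) by (auto simp: locally_polyhedral_def)

text \<open>\<open>x\<close> lies in the cell of every nearby point, so a subgradient found at
  \<open>x + d\<close> is also one at \<open>x\<close>, and \<open>r\<close> is affine with that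
  slope on the segment between them.\<close>

lemma cellwise_direction:
  assumes "x \<in> D"
  obtains e where "e > 0"
    "\<And>d s. \<lbrakk>norm d < e; 0 < s; s \<le> 1; x + s *\<^sub>R d \<in> D\<rbrakk> \<Longrightarrow> x + d \<in> D"
    "\<And>d p u. \<lbrakk>norm d < e; x + d \<in> D; p \<in> subgrad D r (x + d); 0 \<le> u; u \<le> 1\<rbrakk> \<Longrightarrow>
       p \<in> subgrad D r x \<and> x + u *\<^sub>R d \<in> D \<and> r (x + u *\<^sub>R d) = r x + u * (p \<bullet> d)"
proof -
  obtain e where e: "e > 0" "\<And>d s. \<lbrakk>norm d < e; 0 < s; s \<le> 1\<rbrakk> \<Longrightarrow>
    x \<in> cell N (x + s *\<^sub>R d) \<and> x + d \<in> cell N (x + s *\<^sub>R d)"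
    using cell_local[OF fin] by metis
  show ?thesis
  proof (rule that[OF e(1)])
    show "x + d \<in> D" if "norm d < e" "0 < s" "s \<le> 1" "x + s *\<^sub>R d \<in> D" for d s
      using e(2)[OF that(1-3)] cellwise_facts(5)[OF that(4)] by blast
  next
    fix d p and u :: real
    assume d: "norm d < e" "x + d \<in> D" "p \<in> subgrad D r (x + d)" and u: "0 \<le> u" "u \<le> 1"
    have x: "x \<in> cell N (x + d)" using e(2)[OF d(1), of 1] by simp
    have "x + d \<in> cell N (x + d)" by (rule cell_self)
    with x have "(1 - u) *\<^sub>R x + u *\<^sub>R (x + d) \<in> cell N (x + d)"
      using u by (intro convexD[OF convex_cell]) auto
    then have xu: "x + u *\<^sub>R d \<in> cell N (x + d)" by (simp add: algebra_simps)
    have "p \<in> subgrad D r x" using cellwise_subgrad_mono[OF d(2,3) x] .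
    moreover have "x + u *\<^sub>R d \<in> D" using cellwise_facts(5)[OF d(2) xu] .
    moreover have "r (x + u *\<^sub>R d) = r x + u * (p \<bullet> d)"
      using cellwise_facts(4)[OF d(2,3) xu] cellwise_facts(4)[OF d(2,3) x]
      by (simp add: inner_diff_right inner_add_right algebra_simps)
    ultimately show "p \<in> subgrad D r x \<and> x + u *\<^sub>R d \<in> D \<and> r (x + u *\<^sub>R d) = r x + u * (p \<bullet> d)"
      by blast
  qed
qed

lemma cellwise_scaled_direction:
  assumes "x \<in> D" "s0 > 0" "x + s0 *\<^sub>R d \<in> D" "e > 0"
  obtains s where "s > 0" "norm (s *\<^sub>R d) < e" "x + s *\<^sub>R d \<in> D"
proof -
  define s where "s = min s0 (e / (norm d + 1))"
  have nd: "norm d + 1 > 0" by (smt (verit) norm_ge_zero)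
  then have s: "s > 0" "s \<le> s0" using assms by (auto simp: s_def)
  have "s * norm d \<le> e / (norm d + 1) * norm d"
    by (intro mult_right_mono) (auto simp: s_def)
  also have "\<dots> < e" using assms nd by (simp add: field_simps)
  finally have "norm (s *\<^sub>R d) < e" using s by simp
  moreover have "x + s *\<^sub>R d \<in> D"
    using feasible_direction_scale[OF convex_dom_repi[OF cellwise_facts(2)] assms(1,3)] s assms(2) by auto
  ultimately show ?thesis using that s by blast
qed

lemma cellwise_direction_in:
  assumes "x \<in> D" "s0 > 0" "x + s0 *\<^sub>R d \<in> D"
  obtains p s where "p \<in> subgrad D r x" "s > 0"
    "\<And>u. \<lbrakk>0 \<le> u; u \<le> s\<rbrakk> \<Longrightarrow> x + u *\<^sub>R d \<in> D \<and> r (x + u *\<^sub>R d) = r x + u * (p \<bullet> d)"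
proof -
  obtain e where e: "e > 0"
    "\<And>d s. \<lbrakk>norm d < e; 0 < s; s \<le> 1; x + s *\<^sub>R d \<in> D\<rbrakk> \<Longrightarrow> x + d \<in> D"
    "\<And>d p u. \<lbrakk>norm d < e; x + d \<in> D; p \<in> subgrad D r (x + d); 0 \<le> u; u \<le> 1\<rbrakk> \<Longrightarrow>
       p \<in> subgrad D r x \<and> x + u *\<^sub>R d \<in> D \<and> r (x + u *\<^sub>R d) = r x + u * (p \<bullet> d)"
    using cellwise_direction[OF assms(1)] by metis
  obtain s where s: "s > 0" "norm (s *\<^sub>R d) < e" "x + s *\<^sub>R d \<in> D"
    using cellwise_scaled_direction[OF assms e(1)] by metis
  obtain p where p: "p \<in> subgrad D r (x + s *\<^sub>R d)" using cellwise_facts(3)[OF s(3)] by blast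
  show ?thesis
  proof (rule that)
    show "p \<in> subgrad D r x" using e(3)[OF s(2,3) p, of 0] by simp
    show "s > 0" by fact
    show "x + u *\<^sub>R d \<in> D \<and> r (x + u *\<^sub>R d) = r x + u * (p \<bullet> d)" if "0 \<le> u" "u \<le> s" for u
      using e(3)[OF s(2,3) p, of "u / s"] that s(1) by simp
  qed
qed

text \<open>The feasible directions form a cone \<open>T\<close> that agrees with
  \<open>D - x\<close> near the origin and is therefore closed like \<open>D\<close>. A functional
  separating \<open>d\<close> from \<open>T\<close> is nonpositive on \<open>D - x\<close>, so large
  multiples of it can be added to any subgradient.\<close>

lemma cellwise_direction_out:
  assumes "x \<in> D" "\<And>s. s > 0 \<Longrightarrow> x + s *\<^sub>R d \<notin> D"
  obtains p where "p \<in> subgrad D r x" "p \<bullet> d > M"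
proof -
  obtain e where e: "e > 0"
    "\<And>d s. \<lbrakk>norm d < e; 0 < s; s \<le> 1; x + s *\<^sub>R d \<in> D\<rbrakk> \<Longrightarrow> x + d \<in> D"
    using cellwise_direction[OF assms(1)] by metis
  define T where "T = {v. \<exists>s>0. x + s *\<^sub>R v \<in> D}"
  note conv = convex_dom_repi[OF cellwise_facts(2)]
  have coneT: "convex_cone T"
    unfolding T_def by (rule convex_cone_feasible_directions[OF conv assms(1)])
  have small: "x + v \<in> D" if v: "v \<in> T" and nv: "norm v < e" for v
  proof -
    obtain s where s: "s > 0" "x + s *\<^sub>R v \<in> D" using v by (auto simp: T_def)
    have "x + (min s 1) *\<^sub>R v \<in> D"
      using feasible_direction_scale[OF conv assms(1) s(2), of "min s 1"] s(1) by auto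
    then show ?thesis using e(2)[OF nv, of "min s 1"] s(1) by auto
  qed
  have closT: "closed T"
    unfolding closed_sequential_limits
  proof (intro allI impI, elim conjE)
    fix X v assume X: "\<forall>n. X n \<in> T" "X \<longlonglongrightarrow> v"
    \<comment> \<open>Scales the limit into the ball where \<open>T\<close> and \<open>D - x\<close>
      agree, so that closedness of \<open>D\<close> applies.\<close>
    define c where "c = e / (norm v + 1)"
    have nv: "norm v + 1 > 0" by (smt (verit) norm_ge_zero)
    then have c: "c > 0" "norm (c *\<^sub>R v) < e" using e(1) by (auto simp: c_def field_simps)
    have lim: "(\<lambda>n. c *\<^sub>R X n) \<longlonglongrightarrow> c *\<^sub>R v" by (intro tendsto_intros X(2))
    have "\<forall>\<^sub>F n in sequentially. norm (c *\<^sub>R X n) < e"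
      using tendsto_norm[OF lim] c(2) by (rule order_tendstoD(2))
    then have "\<forall>\<^sub>F n in sequentially. x + c *\<^sub>R X n \<in> D"
      by eventually_elim (use small X(1) c(1) convex_cone_scaleR[OF coneT] in auto)
    moreover have "(\<lambda>n. x + c *\<^sub>R X n) \<longlonglongrightarrow> x + c *\<^sub>R v" by (intro tendsto_intros lim X(2))
    ultimately have "x + c *\<^sub>R v \<in> D"
      using Lim_in_closed_set[OF cellwise_closed_dom] by (metis sequentially_bot)
    then show "v \<in> T" using c(1) by (auto simp: T_def)
  qed
  have "d \<notin> T" using assms(2) by (auto simp: T_def)
  then obtain a where a: "\<And>v. v \<in> T \<Longrightarrow> a \<bullet> v \<le> 0" "a \<bullet> d > 0"
    using convex_cone_separation[OF coneT closT] by metis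
  obtain q where q: "q \<in> subgrad D r x" using cellwise_facts(3)[OF assms(1)] by blast
  define l where "l = (\<bar>M\<bar> + \<bar>q \<bullet> d\<bar> + 1) / (a \<bullet> d)"
  have "l \<ge> 0" unfolding l_def using a(2) by (intro divide_nonneg_pos) auto
  show ?thesis
  proof
    have "y - x \<in> T" if "y \<in> D" for y using that by (auto simp: T_def intro: exI[of _ 1])
    then have "l * (a \<bullet> (y - x)) \<le> 0" if "y \<in> D" for y
      using that a(1) \<open>l \<ge> 0\<close> by (simp add: mult_nonneg_nonpos)
    then show "q + l *\<^sub>R a \<in> subgrad D r x"
      using q by (force simp: subgrad_def inner_add_left)
    have "l * (a \<bullet> d) = \<bar>M\<bar> + \<bar>q \<bullet> d\<bar> + 1" using a(2) by (simp add: l_def)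
    then show "(q + l *\<^sub>R a) \<bullet> d > M" by (simp add: inner_add_left)
  qed
qed

section \<open>Directional derivatives of cellwise affine functions\<close>

lemma cellwise_dir_deriv_in:
  assumes "x \<in> D" "s > 0"
    "\<And>u. \<lbrakk>0 \<le> u; u \<le> s\<rbrakk> \<Longrightarrow> x + u *\<^sub>R d \<in> D \<and> r (x + u *\<^sub>R d) = r x + u * c"
  shows "dir_deriv (fext D r) x d = ereal c"
proof -
  have "\<forall>\<^sub>F t in at_right (0::real). (fext D r (x + t *\<^sub>R d) - fext D r x) / ereal t = ereal c"
    using assms(1,2) assms(3)
    by (auto simp: eventually_at_right_field fext_def intro!: exI[of _ s])
  then have "((\<lambda>t. (fext D r (x + t *\<^sub>R d) - fext D r x) / ereal t) \<longlongrightarrow> ereal c) (at_right 0)"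
    by (rule tendsto_eventually)
  then show ?thesis unfolding dir_deriv_def
    by (intro tendsto_Lim) auto
qed

lemma cellwise_dir_deriv_out:
  assumes "x \<in> D" "\<And>s. s > 0 \<Longrightarrow> x + s *\<^sub>R d \<notin> D"
  shows "dir_deriv (fext D r) x d = \<infinity>"
proof -
  have "\<forall>\<^sub>F t in at_right (0::real). (fext D r (x + t *\<^sub>R d) - fext D r x) / ereal t = \<infinity>"
    using assms by (auto simp: eventually_at_right_field fext_def intro!: exI[of _ 1])
  then have "((\<lambda>t. (fext D r (x + t *\<^sub>R d) - fext D r x) / ereal t) \<longlongrightarrow> \<infinity>) (at_right 0)"
    by (rule tendsto_eventually)
  then show ?thesis unfolding dir_deriv_def
    by (intro tendsto_Lim) auto
qed

lemma cellwise_subgrad_le: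
  assumes "x \<in> D" "p \<in> subgrad D r x" "s > 0" "x + s *\<^sub>R d \<in> D" "r (x + s *\<^sub>R d) = r x + s * c"
  shows "p \<bullet> d \<le> c"
proof -
  have "r x + p \<bullet> ((x + s *\<^sub>R d) - x) \<le> r (x + s *\<^sub>R d)" using assms by (auto simp: subgrad_def)
  then have "s * (p \<bullet> d) \<le> s * c" using assms(5) by simp
  then show ?thesis using assms(3) by simp
qed

text \<open>In a feasible direction the supremum is attained by a subgradient picked up at a nearby
  point; in any other direction both sides are \<infinity>. For a general convex function the
  support function is only the lower semicontinuous hull of the derivative.\<close>

lemma cellwise_dir_deriv_support:
  assumes "x \<in> D"
  shows "dir_deriv (fext D r) x d = (SUP p\<in>subgrad D r x. ereal (p \<bullet> d))"
proof (cases "\<exists>s>0. x + s *\<^sub>R d \<in> D")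
  case True
  then obtain p s where p: "p \<in> subgrad D r x" and s: "s > 0"
    "\<And>u. \<lbrakk>0 \<le> u; u \<le> s\<rbrakk> \<Longrightarrow> x + u *\<^sub>R d \<in> D \<and> r (x + u *\<^sub>R d) = r x + u * (p \<bullet> d)"
    using cellwise_direction_in[OF assms] by metis
  have "(SUP p\<in>subgrad D r x. ereal (p \<bullet> d)) = ereal (p \<bullet> d)"
  proof (intro antisym SUP_least)
    show "ereal (q \<bullet> d) \<le> ereal (p \<bullet> d)" if "q \<in> subgrad D r x" for q
      using cellwise_subgrad_le[OF assms that s(1)] s by simp
  qed (use p in \<open>auto intro: SUP_upper2\<close>)
  then show ?thesis using cellwise_dir_deriv_in[OF assms s] by simp
next
  case False
  have "(SUP p\<in>subgrad D r x. ereal (p \<bullet> d)) = \<infinity>"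
  proof (rule SUP_PInfty)
    fix n :: nat
    show "\<exists>p\<in>subgrad D r x. ereal (real n) \<le> ereal (p \<bullet> d)"
      using cellwise_direction_out[of x d "real n"] False assms by (metis ereal_less_eq(3) less_imp_le)
  qed
  then show ?thesis using cellwise_dir_deriv_out[of x d] False assms by auto
qed

end

text \<open>Inside a box around \<open>z\<close> the set is a polytope, and its finitely many
  generators, shifted by \<open>- z\<close>, generate all feasible directions.\<close>

lemma feasible_directions_polyhedral:
  fixes E :: "'c::euclidean_space set"
  assumes "convex E" "z \<in> E" "\<And>Q. polytope Q \<Longrightarrow> polytope (E \<inter> Q)"
  shows "polyhedron {v. \<exists>s>0. z + s *\<^sub>R v \<in> E}" "convex_cone {v. \<exists>s>0. z + s *\<^sub>R v \<in> E}"
proof -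
  define C where "C = {v. \<exists>s>0. z + s *\<^sub>R v \<in> E}"
  note sc = feasible_direction_scale[OF assms(1,2)]
  show cc: "convex_cone {v. \<exists>s>0. z + s *\<^sub>R v \<in> E}"
    by (rule convex_cone_feasible_directions[OF assms(1,2)])
  obtain a where a: "cball z 1 \<subseteq> cbox (- a) a"
    using bounded_subset_cbox_symmetric[OF bounded_cball] by blast
  have "polytope (E \<inter> cbox (- a) a)" by (intro assms(3) polytope_interval)
  then obtain W where W: "finite W" "E \<inter> cbox (- a) a = convex hull W"
    by (auto simp: polytope_def)
  have "C = convex_cone hull ((\<lambda>w. w - z) ` W)"
  proof
    show "C \<subseteq> convex_cone hull ((\<lambda>w. w - z) ` W)"
    proof
      fix v assume "v \<in> C"
      then obtain s where s: "s > 0" "z + s *\<^sub>R v \<in> E" by (auto simp: C_def)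
      define t where "t = min s (1 / (norm v + 1))"
      have nv: "norm v + 1 > 0" by (smt (verit) norm_ge_zero)
      then have t: "t > 0" "t \<le> s" using s by (auto simp: t_def)
      have "t * norm v \<le> 1 / (norm v + 1) * norm v"
        by (intro mult_right_mono) (auto simp: t_def)
      also have "\<dots> \<le> 1" using nv by (simp add: field_simps)
      finally have "z + t *\<^sub>R v \<in> cball z 1" using t by (simp add: dist_norm)
      then have "z + t *\<^sub>R v \<in> cbox (- a) a" using a by blast
      moreover have "z + t *\<^sub>R v \<in> E" using sc[OF s(2)] t s(1) by simp
      ultimately have "z + t *\<^sub>R v \<in> convex hull W" using W(2) by blast
      then have "(z + t *\<^sub>R v) - z \<in> (\<lambda>w. w - z) ` (convex hull W)" by blast
      also have "(\<lambda>w. w - z) ` (convex hull W) = convex hull ((\<lambda>w. w - z) ` W)"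
        using convex_hull_translation[of "- z" W] by simp
      also have "\<dots> \<subseteq> convex_cone hull ((\<lambda>w. w - z) ` W)"
        by (rule convex_hull_subset_convex_cone_hull)
      finally have "t *\<^sub>R v \<in> convex_cone hull ((\<lambda>w. w - z) ` W)" by simp
      from convex_cone_hull_mul[OF this, of "1 / t"]
      show "v \<in> convex_cone hull ((\<lambda>w. w - z) ` W)" using t(1) by simp
    qed
    have "W \<subseteq> E" using W(2) hull_subset[of W convex] by blast
    then have "w - z \<in> C" if "w \<in> W" for w
      using that by (auto simp: C_def intro!: exI[of _ 1])
    then show "convex_cone hull ((\<lambda>w. w - z) ` W) \<subseteq> C"
      using cc by (intro hull_minimal) (auto simp: C_def)
  qed
  then show "polyhedron {v. \<exists>s>0. z + s *\<^sub>R v \<in> E}"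
    using polyhedron_convex_cone_hull[of "(\<lambda>w. w - z) ` W"] W(1) by (simp add: C_def)
qed

text \<open>\<open>r\<close> is linear on an initial segment of every feasible direction, so the
  epigraph of the derivative is exactly the cone of feasible directions of \<open>repi D r\<close>
  at \<open>(x, r x)\<close>.\<close>

lemma cellwise_dir_deriv_polyhedral:
  fixes N :: "'b::euclidean_space set"
  assumes fin: "finite N" and cw: "cellwise_affine N D r" and x: "x \<in> D"
  shows "polyhedral_sublinear (dir_deriv (fext D r) x)"
proof -
  have "epi (dir_deriv (fext D r) x) = {v. \<exists>s>0. (x, r x) + s *\<^sub>R v \<in> repi D r}"
  proof (rule set_eqI, clarify)
    fix d t
    show "(d, t) \<in> epi (dir_deriv (fext D r) x) \<longleftrightarrow>
        (d, t) \<in> {v. \<exists>s>0. (x, r x) + s *\<^sub>R v \<in> repi D r}"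
    proof (cases "\<exists>s>0. x + s *\<^sub>R d \<in> D")
      case True
      then obtain p s where p: "p \<in> subgrad D r x" and s: "s > 0"
        "\<And>u. \<lbrakk>0 \<le> u; u \<le> s\<rbrakk> \<Longrightarrow> x + u *\<^sub>R d \<in> D \<and> r (x + u *\<^sub>R d) = r x + u * (p \<bullet> d)"
        using cellwise_direction_in[OF fin cw x] by metis
      have *: "dir_deriv (fext D r) x d = ereal (p \<bullet> d)"
        using cellwise_dir_deriv_in[OF fin cw x s] .
      show ?thesis
      proof
        assume "(d, t) \<in> epi (dir_deriv (fext D r) x)"
        then have "p \<bullet> d \<le> t" using * by (simp add: epi_def)
        then have "(x, r x) + s *\<^sub>R (d, t) \<in> repi D r"
          using s(1) s(2)[of s] by (simp add: repi_def)
        then show "(d, t) \<in> {v. \<exists>s>0. (x, r x) + s *\<^sub>R v \<in> repi D r}" using s(1) by blast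
      next
        assume "(d, t) \<in> {v. \<exists>s>0. (x, r x) + s *\<^sub>R v \<in> repi D r}"
        then obtain u where u: "u > 0" "x + u *\<^sub>R d \<in> D" "r (x + u *\<^sub>R d) \<le> r x + u * t"
          by (auto simp: repi_def)
        have "r x + p \<bullet> ((x + u *\<^sub>R d) - x) \<le> r (x + u *\<^sub>R d)" using p u(2) by (auto simp: subgrad_def)
        then have "u * (p \<bullet> d) \<le> u * t" using u(3) by simp
        then show "(d, t) \<in> epi (dir_deriv (fext D r) x)" using * u(1) by (simp add: epi_def)
      qed
    next
      case False
      then show ?thesis
        using cellwise_dir_deriv_out[OF fin cw x, of d] by (auto simp: epi_def repi_def)
    qed
  qed
  moreover have "(x, r x) \<in> repi D r" using x by (simp add: repi_def)
  note fd = feasible_directions_polyhedral[OF cellwise_facts(2)[OF fin cw] this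
      cellwise_polytope[OF fin cw]]
  ultimately show ?thesis
    unfolding polyhedral_sublinear_def using fd by simp
qed

subsection \<open>Conjugates\<close>

definition conj_dom :: "'b::real_inner set \<Rightarrow> ('b \<Rightarrow> real) \<Rightarrow> 'b set" where
  "conj_dom D r = {p. bdd_above ((\<lambda>x. p \<bullet> x - r x) ` D)}"

definition conj_val :: "'b::real_inner set \<Rightarrow> ('b \<Rightarrow> real) \<Rightarrow> 'b \<Rightarrow> real" where
  "conj_val D r p = (SUP x\<in>D. p \<bullet> x - r x)"

text \<open>A closed epigraph does not guarantee subgradients at boundary points of the domain, so
  their existence is part of the notion. It gives biconjugation on \<open>D\<close> without a
  separation argument.\<close>

definition closed_subdiff :: "'b::real_inner set \<Rightarrow> ('b \<Rightarrow> real) \<Rightarrow> bool" where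
  "closed_subdiff D r \<longleftrightarrow> D \<noteq> {} \<and> convex (repi D r) \<and> closed (repi D r) \<and>
    (\<forall>x\<in>D. subgrad D r x \<noteq> {})"

lemma conj_val_upper: "\<lbrakk>p \<in> conj_dom D r; x \<in> D\<rbrakk> \<Longrightarrow> p \<bullet> x - r x \<le> conj_val D r p"
  unfolding conj_val_def conj_dom_def by (auto intro: cSUP_upper)

lemma conj_domI: "(\<And>x. x \<in> D \<Longrightarrow> p \<bullet> x - r x \<le> M) \<Longrightarrow> p \<in> conj_dom D r"
  by (auto simp: conj_dom_def intro!: bdd_aboveI2)

lemma conj_val_least: "\<lbrakk>D \<noteq> {}; \<And>x. x \<in> D \<Longrightarrow> p \<bullet> x - r x \<le> M\<rbrakk> \<Longrightarrow> conj_val D r p \<le> M"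
  unfolding conj_val_def by (rule cSUP_least)

lemma subgrad_conj:
  assumes "x \<in> D" "p \<in> subgrad D r x"
  shows "p \<in> conj_dom D r" "conj_val D r p = p \<bullet> x - r x" "x \<in> subgrad (conj_dom D r) (conj_val D r) p"
proof -
  have *: "p \<bullet> y - r y \<le> p \<bullet> x - r x" if "y \<in> D" for y
    using assms(2) that by (auto simp: subgrad_def inner_diff_right algebra_simps)
  show p: "p \<in> conj_dom D r" using * by (rule conj_domI)
  show v: "conj_val D r p = p \<bullet> x - r x"
  proof (rule antisym)
    show "conj_val D r p \<le> p \<bullet> x - r x" using * assms(1) by (intro conj_val_least) auto
  qed (rule conj_val_upper[OF p assms(1)])
  show "x \<in> subgrad (conj_dom D r) (conj_val D r) p"
    using conj_val_upper[OF _ assms(1)] by (fastforce simp: subgrad_def v inner_diff_right inner_commute)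
qed

text \<open>Fenchel-Moreau. On \<open>D\<close> a subgradient gives equality at once. Off
  \<open>D\<close> the point \<open>(x, M)\<close> is separated from the epigraph for every
  \<open>M\<close>, which makes the biconjugate infinite there.\<close>

lemma biconj:
  fixes D :: "'b::euclidean_space set"
  assumes "closed_subdiff D r"
  shows "conj_dom (conj_dom D r) (conj_val D r) = D"
    and "x \<in> D \<Longrightarrow> conj_val (conj_dom D r) (conj_val D r) x = r x"
    and "x \<notin> D \<Longrightarrow> \<exists>q\<in>conj_dom D r. q \<bullet> x - conj_val D r q > M"
proof -
  have a: "D \<noteq> {}" "convex (repi D r)" "closed (repi D r)" "\<And>x. x \<in> D \<Longrightarrow> subgrad D r x \<noteq> {}"
    using assms by (auto simp: closed_subdiff_def)
  obtain y0 q0 where q0: "y0 \<in> D" "q0 \<in> subgrad D r y0" using a by blast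
  note q0' = subgrad_conj(1)[OF q0]
  have le: "x \<bullet> q - conj_val D r q \<le> r x" if "x \<in> D" "q \<in> conj_dom D r" for x q
    using conj_val_upper[OF that(2,1)] by (simp add: inner_commute)
  have out: "\<exists>q\<in>conj_dom D r. q \<bullet> x - conj_val D r q > M" if x: "x \<notin> D" for x M
  proof -
    have "(x, M) \<notin> repi D r" using x by (simp add: repi_def)
    then obtain ac b where acb: "ac \<bullet> (x, M) < b" "\<And>z. z \<in> repi D r \<Longrightarrow> ac \<bullet> z > b"
      using separating_hyperplane_closed_point[OF a(2,3)] by metis
    obtain a' c where ac: "ac = (a', c)" by force
    have sep: "a' \<bullet> x + c * M < b" "\<And>y t. \<lbrakk>y \<in> D; r y \<le> t\<rbrakk> \<Longrightarrow> a' \<bullet> y + c * t > b"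
      using acb by (auto simp: ac inner_prod_def repi_def)
    have c: "c \<ge> 0"
    proof (rule ccontr)
      assume c: "\<not> c \<ge> 0"
      \<comment> \<open>With \<open>c < 0\<close> high points over \<open>y0\<close> would lie on
        the wrong side of the hyperplane.\<close>
      define t where "t = max (r y0) ((b - a' \<bullet> y0) / c)"
      have "a' \<bullet> y0 + c * t > b" using sep(2)[OF q0(1), of t] by (simp add: t_def)
      moreover have "(b - a' \<bullet> y0) / c \<le> t" by (simp add: t_def)
      then have "c * t \<le> b - a' \<bullet> y0" using c by (simp add: field_simps)
      ultimately show False by simp
    qed
    show ?thesis
    proof (cases "c = 0")
      case False
      then have c: "c > 0" using c by simp
      \<comment> \<open>A hyperplane that is not vertical is the graph of an affine minorant of this
        slope.\<close>
      define q where "q = (- 1 / c) *\<^sub>R a'"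
      have qy: "q \<bullet> y = - (a' \<bullet> y) / c" for y by (simp add: q_def)
      have ub: "q \<bullet> y - r y \<le> - b / c" if "y \<in> D" for y
      proof -
        have "(- (a' \<bullet> y) - c * r y) / c \<le> - b / c"
          using sep(2)[OF that, of "r y"] c by (intro divide_right_mono) auto
        then show ?thesis using c by (simp add: qy diff_divide_distrib)
      qed
      have "q \<in> conj_dom D r" by (rule conj_domI[OF ub])
      moreover have "conj_val D r q \<le> - b / c" by (rule conj_val_least[OF a(1) ub])
      moreover have "M < (b - a' \<bullet> x) / c" using sep(1) c by (simp add: pos_less_divide_eq mult.commute)
      then have "q \<bullet> x - (- b / c) > M" by (simp add: qy diff_divide_distrib)
      ultimately show ?thesis by force
    next
      case True
      \<comment> \<open>A vertical hyperplane gives no slope; a large multiple of it tilts the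
        affine minorant that belongs to \<open>q0\<close>.\<close>
      define k where "k = (\<bar>M\<bar> + \<bar>q0 \<bullet> x - conj_val D r q0\<bar> + 1) / (b - a' \<bullet> x)"
      have pos: "b - a' \<bullet> x > 0" using sep(1) True by simp
      then have k: "k \<ge> 0" unfolding k_def by (intro divide_nonneg_pos) auto
      define q where "q = q0 - k *\<^sub>R a'"
      have ub: "q \<bullet> y - r y \<le> conj_val D r q0 - k * b" if "y \<in> D" for y
      proof -
        have "k * b \<le> k * (a' \<bullet> y)" using sep(2)[OF that, of "r y"] True k by (intro mult_left_mono) auto
        then show ?thesis using conj_val_upper[OF q0' that] by (simp add: q_def inner_diff_left)
      qed
      have "q \<in> conj_dom D r" by (rule conj_domI[OF ub])
      moreover have "conj_val D r q \<le> conj_val D r q0 - k * b" by (rule conj_val_least[OF a(1) ub])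
      moreover have "k * (b - a' \<bullet> x) = \<bar>M\<bar> + \<bar>q0 \<bullet> x - conj_val D r q0\<bar> + 1"
        using pos by (simp add: k_def)
      then have "q \<bullet> x - (conj_val D r q0 - k * b) > M"
        by (simp add: q_def inner_diff_left algebra_simps)
      ultimately show ?thesis by force
    qed
  qed
  show "x \<notin> D \<Longrightarrow> \<exists>q\<in>conj_dom D r. q \<bullet> x - conj_val D r q > M" by (rule out)
  show "conj_dom (conj_dom D r) (conj_val D r) = D"
  proof (rule set_eqI)
    fix x
    show "x \<in> conj_dom (conj_dom D r) (conj_val D r) \<longleftrightarrow> x \<in> D"
    proof
      assume x: "x \<in> conj_dom (conj_dom D r) (conj_val D r)"
      show "x \<in> D"
      proof (rule ccontr)
        assume "x \<notin> D"
        then obtain q where "q \<in> conj_dom D r"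
          "q \<bullet> x - conj_val D r q > conj_val (conj_dom D r) (conj_val D r) x" using out by blast
        then show False using conj_val_upper[OF x] by (fastforce simp: inner_commute)
      qed
    qed (use le in \<open>auto intro: conj_domI\<close>)
  qed
  show "conj_val (conj_dom D r) (conj_val D r) x = r x" if x: "x \<in> D"
  proof -
    obtain p where p: "p \<in> subgrad D r x" using a(4)[OF x] by blast
    note sc = subgrad_conj[OF x p]
    have "x \<in> conj_dom (conj_dom D r) (conj_val D r)" using le x by (auto intro: conj_domI)
    from conj_val_upper[OF this sc(1)] have "r x \<le> conj_val (conj_dom D r) (conj_val D r) x"
      using sc(2) by (simp add: inner_commute)
    moreover have "conj_val (conj_dom D r) (conj_val D r) x \<le> r x"
      using sc(1) le x by (intro conj_val_least) auto
    ultimately show ?thesis by simp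
  qed
qed

text \<open>The last hypothesis bounds the biconjugate at \<open>x\<close> by
  \<open>x \<bullet> p - conj_val D r p\<close>. By \<open>biconj\<close> this puts \<open>x\<close>
  into \<open>D\<close> and bounds \<open>r x\<close>.\<close>

lemma subgrad_conj_converse:
  fixes D :: "'b::euclidean_space set"
  assumes "closed_subdiff D r" "p \<in> conj_dom D r" "x \<in> subgrad (conj_dom D r) (conj_val D r) p"
  shows "x \<in> D" "p \<in> subgrad D r x"
proof -
  have ub: "x \<bullet> q - conj_val D r q \<le> x \<bullet> p - conj_val D r p" if "q \<in> conj_dom D r" for q
    using assms(3) that by (auto simp: subgrad_def inner_diff_right algebra_simps)
  note * = conj_domI[of "conj_dom D r" x "conj_val D r", OF ub]
    conj_val_least[of "conj_dom D r" x "conj_val D r", OF _ ub]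
  show x: "x \<in> D" using *(1) biconj(1)[OF assms(1)] by simp
  have "r x \<le> x \<bullet> p - conj_val D r p" using *(2) assms(2) biconj(2)[OF assms(1) x] by force
  then show "p \<in> subgrad D r x"
    using conj_val_upper[OF assms(2)] by (fastforce simp: subgrad_def inner_diff_right inner_commute)
qed

text \<open>A perturbation argument: if \<open>x\<close> minimizes \<open>r - p + (e/2) |x|\<^sup>2\<close>, then \<open>p - e x\<close> is a
  subgradient at \<open>x\<close>, and \<open>e x\<close> tends to \<open>0\<close> with \<open>e\<close> because \<open>r - p\<close> is bounded below.\<close>

lemma quadratic_minimizer:
  fixes D :: "'b::euclidean_space set"
  assumes "D \<noteq> {}" "closed (repi D r)" "e > 0" and m: "\<And>x. x \<in> D \<Longrightarrow> m \<le> r x - p \<bullet> x"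
  obtains x where "x \<in> D"
    "\<And>y. y \<in> D \<Longrightarrow> r x - p \<bullet> x + e / 2 * (x \<bullet> x) \<le> r y - p \<bullet> y + e / 2 * (y \<bullet> y)"
proof -
  define F where "F z = snd z - p \<bullet> fst z + e / 2 * (fst z \<bullet> fst z)" for z :: "'b \<times> real"
  obtain x1 where x1: "x1 \<in> D" using assms(1) by blast
  \<comment> \<open>Minimizing over the epigraph keeps the objective continuous, whereas
    \<open>r\<close> itself is only lower semicontinuous.\<close>
  define K where "K = repi D r \<inter> {z. F z \<le> F (x1, r x1)}"
  have contF: "continuous_on A F" for A
    unfolding F_def by (intro continuous_intros)
  define B where "B = 2 / e * (F (x1, r x1) - m)"
  have bd: "norm (fst z) \<le> sqrt B \<and> \<bar>snd z\<bar> \<le> \<bar>m\<bar> + \<bar>F (x1, r x1)\<bar> + norm p * sqrt B" if "z \<in> K" for z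
  proof -
    obtain x t where z: "z = (x, t)" by force
    have xt: "x \<in> D" "r x \<le> t" "F (x, t) \<le> F (x1, r x1)" using that by (auto simp: K_def z repi_def)
    have lb: "m \<le> t - p \<bullet> x" using m[OF xt(1)] xt(2) by simp
    have nn: "e / 2 * (x \<bullet> x) \<ge> 0" using assms(3) by simp
    have "e / 2 * (x \<bullet> x) \<le> F (x1, r x1) - m" using xt(3) lb by (simp add: F_def)
    then have "x \<bullet> x \<le> B" using assms(3) by (simp add: B_def field_simps)
    then have nx: "norm x \<le> sqrt B" by (simp add: norm_eq_sqrt_inner)
    have "\<bar>p \<bullet> x\<bar> \<le> norm p * norm x" by (rule Cauchy_Schwarz_ineq2)
    also have "\<dots> \<le> norm p * sqrt B" using nx by (simp add: mult_left_mono)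
    finally have "\<bar>p \<bullet> x\<bar> \<le> norm p * sqrt B" .
    moreover have "t - p \<bullet> x \<le> F (x1, r x1)" using xt(3) nn by (simp add: F_def)
    ultimately have "\<bar>t\<bar> \<le> \<bar>m\<bar> + \<bar>F (x1, r x1)\<bar> + norm p * sqrt B" using lb by linarith
    then show ?thesis using nx z by simp
  qed
  have "K \<subseteq> cball 0 (sqrt B) \<times> cball 0 (\<bar>m\<bar> + \<bar>F (x1, r x1)\<bar> + norm p * sqrt B)"
  proof
    fix z assume "z \<in> K"
    from bd[OF this] show "z \<in> cball 0 (sqrt B) \<times> cball 0 (\<bar>m\<bar> + \<bar>F (x1, r x1)\<bar> + norm p * sqrt B)"
      by (cases z) auto
  qed
  then have "bounded K"
    by (rule bounded_subset[rotated]) (intro bounded_Times bounded_cball)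
  moreover have "closed K"
    unfolding K_def
    by (intro closed_Int assms(2) closed_Collect_le contF continuous_on_const)
  ultimately have "compact K" by (simp add: compact_eq_bounded_closed)
  moreover have K1: "(x1, r x1) \<in> K" using x1 by (simp add: K_def repi_def)
  then have "K \<noteq> {}" by blast
  ultimately obtain z where z: "z \<in> K" "\<And>w. w \<in> K \<Longrightarrow> F z \<le> F w"
    using continuous_attains_inf[OF _ _ contF] by metis
  obtain x t where xt: "z = (x, t)" by force
  have xD: "x \<in> D" "r x \<le> t" using z(1) by (auto simp: K_def xt repi_def)
  show ?thesis
  proof
    show "x \<in> D" by fact
    fix y assume "y \<in> D"
    have "F (x, r x) \<le> F z" using xD by (simp add: F_def xt)
    also have "F z \<le> F (y, r y)"
    proof (cases "F (y, r y) \<le> F (x1, r x1)")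
      case True
      then show ?thesis using z(2) \<open>y \<in> D\<close> by (auto simp: K_def repi_def)
    next
      case False
      then show ?thesis using z(2)[OF K1] by simp
    qed
    finally show "r x - p \<bullet> x + e / 2 * (x \<bullet> x) \<le> r y - p \<bullet> y + e / 2 * (y \<bullet> y)"
      by (simp add: F_def)
  qed
qed

lemma quadratic_minimizer_subgrad:
  fixes D :: "'b::euclidean_space set"
  assumes "convex (repi D r)" "x \<in> D"
    and min: "\<And>y. y \<in> D \<Longrightarrow> r x - p \<bullet> x + e / 2 * (x \<bullet> x) \<le> r y - p \<bullet> y + e / 2 * (y \<bullet> y)"
  shows "p - e *\<^sub>R x \<in> subgrad D r x"
  unfolding subgrad_def
proof (intro CollectI ballI)
  fix y assume y: "y \<in> D"
  define v where "v = y - x"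
  \<comment> \<open>First-order change along \<open>v\<close>; the quadratic remainder is of order
    \<open>u\<close> after division by \<open>u\<close> and vanishes in the limit.\<close>
  define A where "A = r y - r x - p \<bullet> v + e * (x \<bullet> v)"
  have "A + u * (e / 2 * (v \<bullet> v)) \<ge> 0" if u: "0 < u" "u \<le> 1" for u
  proof -
    have D: "x + u *\<^sub>R v \<in> D" "r (x + u *\<^sub>R v) \<le> r x + u * (r y - r x)"
      using convex_repiD[OF assms(1,2) y, of u] u by (auto simp: v_def)
    have "r x - p \<bullet> x + e / 2 * (x \<bullet> x) \<le>
      r x + u * (r y - r x) - p \<bullet> (x + u *\<^sub>R v) + e / 2 * ((x + u *\<^sub>R v) \<bullet> (x + u *\<^sub>R v))"
      using min[OF D(1)] D(2) by linarith
    then have "u * (A + u * (e / 2 * (v \<bullet> v))) \<ge> 0"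
      by (simp add: A_def inner_add_left inner_add_right inner_commute algebra_simps)
    then show ?thesis using u by (simp add: zero_le_mult_iff)
  qed
  then have "\<forall>\<^sub>F u in at_right 0. A + u * (e / 2 * (v \<bullet> v)) \<ge> 0"
    by (auto simp: eventually_at_right_field intro!: exI[of _ 1])
  moreover have "((\<lambda>u. A + u * (e / 2 * (v \<bullet> v))) \<longlongrightarrow> A + 0 * (e / 2 * (v \<bullet> v))) (at_right 0)"
    by (intro tendsto_intros)
  ultimately have "A + 0 * (e / 2 * (v \<bullet> v)) \<ge> 0"
    by (intro tendsto_lowerbound) auto
  then show "r x + (p - e *\<^sub>R x) \<bullet> (y - x) \<le> r y"
    by (simp add: A_def v_def inner_diff_left algebra_simps)
qed

lemma conj_dom_in_closure:
  fixes D :: "'b::euclidean_space set"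
  assumes "closed_subdiff D r" "p \<in> conj_dom D r"
  shows "p \<in> closure (\<Union>x\<in>D. subgrad D r x)"
  unfolding closure_approachable
proof (intro allI impI)
  fix d :: real assume d: "d > 0"
  have a: "D \<noteq> {}" "convex (repi D r)" "closed (repi D r)"
    using assms by (auto simp: closed_subdiff_def)
  obtain x1 where x1: "x1 \<in> D" using a by blast
  define m where "m = - conj_val D r p"
  have m: "m \<le> r x - p \<bullet> x" if "x \<in> D" for x
    using conj_val_upper[OF assms(2) that] by (simp add: m_def)
  define C where "C = r x1 - p \<bullet> x1 - m"
  have C: "C \<ge> 0" using m[OF x1] by (simp add: C_def)
  \<comment> \<open>For \<open>e \<le> 1\<close>, minimality against \<open>x1\<close> bounds
    \<open>e * (x \<bullet> x)\<close> by \<open>2 * C + x1 \<bullet> x1\<close>. Multiplied by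
    \<open>e\<close>, this brings the norm of \<open>e x\<close> below \<open>d\<close>.\<close>
  define e where "e = min 1 (d\<^sup>2 / (2 * C + x1 \<bullet> x1 + 1))"
  have den: "2 * C + x1 \<bullet> x1 + 1 > 0" using C inner_ge_zero[of x1] by linarith
  have e: "e > 0" "e \<le> 1" using d den by (auto simp: e_def)
  obtain x where x: "x \<in> D"
    "\<And>y. y \<in> D \<Longrightarrow> r x - p \<bullet> x + e / 2 * (x \<bullet> x) \<le> r y - p \<bullet> y + e / 2 * (y \<bullet> y)"
    using quadratic_minimizer[OF a(1,3) e(1) m] by metis
  have sub: "p - e *\<^sub>R x \<in> subgrad D r x" by (rule quadratic_minimizer_subgrad[OF a(2) x])
  have "e / 2 * (x \<bullet> x) \<le> C + e / 2 * (x1 \<bullet> x1)"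
    using x(2)[OF x1] m[OF x(1)] by (simp add: C_def)
  then have "e * (x \<bullet> x) \<le> 2 * C + e * (x1 \<bullet> x1)" by simp
  also have "\<dots> \<le> 2 * C + x1 \<bullet> x1"
    using mult_right_mono[OF e(2) inner_ge_zero[of x1]] by simp
  finally have "e * (x \<bullet> x) < 2 * C + x1 \<bullet> x1 + 1" by simp
  then have "e * (e * (x \<bullet> x)) < e * (2 * C + x1 \<bullet> x1 + 1)" using e(1) by (intro mult_strict_left_mono) auto
  also have "e * (2 * C + x1 \<bullet> x1 + 1) \<le> d\<^sup>2 / (2 * C + x1 \<bullet> x1 + 1) * (2 * C + x1 \<bullet> x1 + 1)"
    using den by (intro mult_right_mono) (auto simp: e_def)
  also have "\<dots> = d\<^sup>2" using den by simp
  finally have "(norm (e *\<^sub>R x))\<^sup>2 < d\<^sup>2"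
    by (simp only: power2_norm_eq_inner inner_scaleR_left inner_scaleR_right)
  then have "norm (e *\<^sub>R x) < d" using d by (simp add: power_less_imp_less_base)
  then show "\<exists>y\<in>\<Union>x\<in>D. subgrad D r x. dist y p < d"
    using sub x(1) by (intro bexI[of _ "p - e *\<^sub>R x"]) (auto simp: dist_norm)
qed

lemma conj_dom_eq:
  fixes D :: "'b::euclidean_space set"
  assumes "finite N" "closed_subdiff D r" "\<And>x. x \<in> D \<Longrightarrow> cell_saturated N (subgrad D r x)"
  shows "conj_dom D r = (\<Union>x\<in>D. subgrad D r x)"
proof
  have "cell_saturated N (\<Union>x\<in>D. subgrad D r x)"
    using assms(3) by (fastforce simp: cell_saturated_def)
  then have "closed (\<Union>x\<in>D. subgrad D r x)" by (rule cell_saturated_imp_closed[OF assms(1)])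
  then show "conj_dom D r \<subseteq> (\<Union>x\<in>D. subgrad D r x)"
    using conj_dom_in_closure[OF assms(2)] by (auto simp: closure_closed)
  show "(\<Union>x\<in>D. subgrad D r x) \<subseteq> conj_dom D r"
    by (intro UN_least subsetI) (rule subgrad_conj(1))
qed

lemma convex_repi_conj: "D \<noteq> {} \<Longrightarrow> convex (repi (conj_dom D r) (conj_val D r))"
  unfolding convex_alt
proof (intro ballI allI impI)
  fix z w and u :: real
  assume D: "D \<noteq> {}" and z: "z \<in> repi (conj_dom D r) (conj_val D r)"
    and w: "w \<in> repi (conj_dom D r) (conj_val D r)" and u: "0 \<le> u \<and> u \<le> 1"
  obtain p s q t where pq: "z = (p, s)" "w = (q, t)" by (cases z; cases w)
  have p: "p \<in> conj_dom D r" "conj_val D r p \<le> s" and q: "q \<in> conj_dom D r" "conj_val D r q \<le> t"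
    using z w by (auto simp: pq repi_def)
  have ub: "((1 - u) *\<^sub>R p + u *\<^sub>R q) \<bullet> x - r x \<le> (1 - u) * s + u * t" if "x \<in> D" for x
  proof -
    have "(1 - u) * (p \<bullet> x - r x) \<le> (1 - u) * s" "u * (q \<bullet> x - r x) \<le> u * t"
      using conj_val_upper[OF p(1) that] conj_val_upper[OF q(1) that] p(2) q(2) u
      by (auto intro!: mult_left_mono)
    then show ?thesis by (simp add: inner_add_left algebra_simps)
  qed
  show "(1 - u) *\<^sub>R z + u *\<^sub>R w \<in> repi (conj_dom D r) (conj_val D r)"
    using conj_domI[OF ub] conj_val_least[OF D ub] by (simp add: pq repi_def)
qed

text \<open>A subgradient \<open>x\<close> of the conjugate at \<open>p\<close> is a point whose
  subdifferential contains \<open>p\<close>, hence the whole cell of \<open>p\<close>. On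
  \<open>subgrad D r x\<close> the conjugate is \<open>q \<bullet> x - r x\<close>, which is affine
  in \<open>q\<close>.\<close>

lemma cellwise_affine_conj:
  fixes D :: "'b::euclidean_space set"
  assumes "finite N" "closed_subdiff D r" "\<And>x. x \<in> D \<Longrightarrow> cell_saturated N (subgrad D r x)"
  shows "cellwise_affine N (conj_dom D r) (conj_val D r)"
proof -
  note dom = conj_dom_eq[OF assms]
  have D: "D \<noteq> {}" "\<And>x. x \<in> D \<Longrightarrow> subgrad D r x \<noteq> {}"
    using assms(2) by (auto simp: closed_subdiff_def)
  show ?thesis
    unfolding cellwise_affine_def
  proof (intro conjI ballI)
    show "conj_dom D r \<noteq> {}" using dom D by blast
    show "convex (repi (conj_dom D r) (conj_val D r))" by (rule convex_repi_conj[OF D(1)])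
  next
    fix p assume "p \<in> conj_dom D r"
    then obtain x where "x \<in> D" "p \<in> subgrad D r x" using dom by blast
    then show "subgrad (conj_dom D r) (conj_val D r) p \<noteq> {}" using subgrad_conj(3) by blast
  next
    fix p x q
    assume p: "p \<in> conj_dom D r" and x: "x \<in> subgrad (conj_dom D r) (conj_val D r) p"
      and q: "q \<in> cell N p"
    note xD = subgrad_conj_converse[OF assms(2) p x]
    have qx: "q \<in> subgrad D r x" using assms(3)[OF xD(1)] xD(2) q by (auto simp: cell_saturated_def)
    show "q \<in> conj_dom D r" by (rule subgrad_conj(1)[OF xD(1) qx])
    show "conj_val D r q = conj_val D r p + x \<bullet> (q - p)"
      using subgrad_conj(2)[OF xD] subgrad_conj(2)[OF xD(1) qx]
      by (simp add: inner_diff_right inner_commute)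
  qed
qed

subsection \<open>Integral normals of cones spanned by roots\<close>

lemma spanning_orthogonal_zero:
  fixes x :: "'b::real_inner"
  assumes "span C = UNIV" "\<And>c. c \<in> C \<Longrightarrow> x \<bullet> c = 0"
  shows "x = 0"
proof -
  have "x \<bullet> x = 0"
    using assms orthogonal_to_span[of x C x] by (auto simp: orthogonal_def)
  then show ?thesis by simp
qed

lemma convex_cone_hull_finite:
  assumes "finite S"
  shows "convex_cone hull S = {\<Sum>s\<in>S. u s *\<^sub>R s | u. \<forall>s\<in>S. 0 \<le> u s}" (is "_ = ?T")
proof
  show "convex_cone hull S \<subseteq> ?T"
  proof (rule hull_minimal)
    show "S \<subseteq> ?T"
    proof
      fix a assume "a \<in> S"
      then have "a = (\<Sum>s\<in>S. (if s = a then 1 else 0) *\<^sub>R s)"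
        using assms by (simp add: if_distrib[of "\<lambda>x. x *\<^sub>R _"] sum.delta cong: if_cong)
      then show "a \<in> ?T" by (auto intro!: exI[of _ "\<lambda>s. if s = a then 1 else 0"])
    qed
    have conic: "c *\<^sub>R x \<in> ?T" if "x \<in> ?T" "0 \<le> c" for c x
    proof -
      obtain u where u: "x = (\<Sum>s\<in>S. u s *\<^sub>R s)" "\<forall>s\<in>S. 0 \<le> u s" using \<open>x \<in> ?T\<close> by blast
      then show ?thesis using \<open>0 \<le> c\<close>
        by (auto simp: scaleR_sum_right intro!: exI[of _ "\<lambda>s. c * u s"])
    qed
    have add: "x + y \<in> ?T" if xy: "x \<in> ?T" "y \<in> ?T" for x y
    proof -
      obtain u v where "x = (\<Sum>s\<in>S. u s *\<^sub>R s)" "\<forall>s\<in>S. 0 \<le> u s"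
        "y = (\<Sum>s\<in>S. v s *\<^sub>R s)" "\<forall>s\<in>S. 0 \<le> v s" using xy by blast
      then show ?thesis
        by (auto simp: sum.distrib scaleR_left_distrib intro!: exI[of _ "\<lambda>s. u s + v s"])
    qed
    have "0 \<in> ?T" by (auto intro!: exI[of _ "\<lambda>_. 0"])
    moreover have "convex ?T" by (rule convexI) (intro add conic)
    moreover have "conic ?T" unfolding conic_def using conic by blast
    ultimately show "convex_cone ?T" unfolding convex_cone_def by blast
  qed
  show "?T \<subseteq> convex_cone hull S"
  proof clarify
    fix u :: "'a \<Rightarrow> real" assume u: "\<forall>s\<in>S. 0 \<le> u s"
    have "(\<Sum>s\<in>F. u s *\<^sub>R s) \<in> convex_cone hull S" if "finite F" "F \<subseteq> S" for F
      using that
    proof (induction F)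
      case empty
      then show ?case by (simp add: convex_cone_hull_contains_0)
    next
      case (insert s F)
      then have "u s *\<^sub>R s \<in> convex_cone hull S" using u by (intro convex_cone_hull_mul[OF hull_inc]) auto
      then show ?case using insert by (auto intro!: convex_cone_hull_add)
    qed
    then show "(\<Sum>s\<in>S. u s *\<^sub>R s) \<in> convex_cone hull S" using assms by blast
  qed
qed

text \<open>Write \<open>a\<close> as a combination of \<open>S\<close> with real coefficients. The multiples of \<open>a\<close>, reduced modulo
  the lattice generated by \<open>S\<close>, lie in a bounded part of a discrete set, so two of them coincide.\<close>

lemma rational_ratio:
  fixes C :: "'b::euclidean_space set"
  assumes "finite C" "span C = UNIV" "finite S" "b \<in> S" "a \<in> span S"
    and int: "\<And>x c. \<lbrakk>x \<in> insert a S; c \<in> C\<rbrakk> \<Longrightarrow> x \<bullet> c \<in> \<int>"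
    and orth: "\<And>x. \<lbrakk>x \<in> S; x \<noteq> b\<rbrakk> \<Longrightarrow> n \<bullet> x = 0"
  obtains M :: nat and K :: int where "M > 0" "of_nat M * (n \<bullet> a) = of_int K * (n \<bullet> b)"
proof -
  obtain k where k: "a = (\<Sum>x\<in>S. k x *\<^sub>R x)"
    using assms(5) span_finite[OF assms(3)] by auto
  define v where "v m = of_nat m *\<^sub>R a - (\<Sum>x\<in>S. of_int \<lfloor>of_nat m * k x\<rfloor> *\<^sub>R x)" for m :: nat
  have v: "v m = (\<Sum>x\<in>S. frac (of_nat m * k x) *\<^sub>R x)" for m
    unfolding v_def k by (simp add: scaleR_sum_right sum_subtractf[symmetric] frac_def algebra_simps)
  define B where "B = (\<Sum>x\<in>S. norm x)"
  have nv: "norm (v m) \<le> B" for m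
    unfolding v B_def
    by (intro order_trans[OF norm_sum] sum_mono)
      (simp add: mult_left_le_one_le frac_ge_0 less_imp_le[OF frac_lt_1])
  have vint: "v m \<bullet> c \<in> \<int>" if "c \<in> C" for m c
    unfolding v_def inner_diff_left inner_sum_left inner_scaleR_left
    using int that by (intro Ints_diff Ints_sum Ints_mult) auto
  \<comment> \<open>The pairings with the spanning set \<open>C\<close> are integral and bounded,
    and they determine \<open>v m\<close>.\<close>
  define G where "G m = restrict (\<lambda>c. \<lfloor>v m \<bullet> c\<rfloor>) C" for m
  have "range G \<subseteq> PiE C (\<lambda>c. {- \<lceil>B * norm c\<rceil> - 1..\<lceil>B * norm c\<rceil> + 1})"
  proof (rule image_subsetI)
    fix m
    have "\<bar>v m \<bullet> c\<bar> \<le> B * norm c" for c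
      using Cauchy_Schwarz_ineq2[of "v m" c] mult_right_mono[OF nv[of m], of "norm c"] by simp
    then have *: "\<bar>v m \<bullet> c\<bar> \<le> of_int \<lceil>B * norm c\<rceil>" for c
      by (meson order_trans le_of_int_ceiling)
    have "\<lfloor>v m \<bullet> c\<rfloor> \<in> {- \<lceil>B * norm c\<rceil> - 1..\<lceil>B * norm c\<rceil> + 1}" for c
      using *[of c] unfolding atLeastAtMost_iff by linarith
    then show "G m \<in> PiE C (\<lambda>c. {- \<lceil>B * norm c\<rceil> - 1..\<lceil>B * norm c\<rceil> + 1})"
      by (auto simp: G_def)
  qed
  moreover have "finite (PiE C (\<lambda>c. {- \<lceil>B * norm c\<rceil> - 1..\<lceil>B * norm c\<rceil> + 1}))"
    using assms(1) by (intro finite_PiE) auto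
  ultimately have "finite (range G)" by (rule finite_subset)
  then have "\<not> inj G" using finite_imageD infinite_UNIV_nat by blast
  then obtain m1 m2 where m12: "m1 < m2" "G m1 = G m2"
    by (metis injI linorder_neqE_nat)
  have "v m2 - v m1 = 0"
  proof (rule spanning_orthogonal_zero[OF assms(2)])
    fix c assume c: "c \<in> C"
    have "\<lfloor>v m1 \<bullet> c\<rfloor> = \<lfloor>v m2 \<bullet> c\<rfloor>" using fun_cong[OF m12(2), of c] c by (simp add: G_def)
    moreover have "v m \<bullet> c = of_int \<lfloor>v m \<bullet> c\<rfloor>" for m
      using vint[OF c, of m] by (auto elim: Ints_cases)
    ultimately show "(v m2 - v m1) \<bullet> c = 0"
      unfolding inner_diff_left by (metis diff_self)
  qed
  then have "n \<bullet> (v m2 - v m1) = 0" by simp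
  \<comment> \<open>All members of \<open>S\<close> except \<open>b\<close> are orthogonal to
    \<open>n\<close>, so only the coefficient of \<open>b\<close> survives.\<close>
  moreover have nS: "n \<bullet> (\<Sum>x\<in>S. f x *\<^sub>R x) = f b * (n \<bullet> b)" for f :: "'b \<Rightarrow> real"
  proof -
    have "n \<bullet> (\<Sum>x\<in>S. f x *\<^sub>R x) = (\<Sum>x\<in>S. f x * (n \<bullet> x))" by (simp add: inner_sum_right)
    also have "\<dots> = (\<Sum>x\<in>{b}. f x * (n \<bullet> x))"
      using assms(3,4) orth by (intro sum.mono_neutral_right) auto
    finally show ?thesis by simp
  qed
  ultimately have "(of_nat m2 - of_nat m1) * (n \<bullet> a) =
      (of_int \<lfloor>of_nat m2 * k b\<rfloor> - of_int \<lfloor>of_nat m1 * k b\<rfloor>) * (n \<bullet> b)"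
    unfolding v_def inner_diff_right nS by (simp add: algebra_simps)
  then show ?thesis
    using m12(1) by (intro that[of "m2 - m1" "\<lfloor>of_nat m2 * k b\<rfloor> - \<lfloor>of_nat m1 * k b\<rfloor>"])
      (auto simp: of_nat_diff)
qed

lemma common_multiplier:
  assumes "finite S" "\<And>x. x \<in> S \<Longrightarrow> \<exists>M::nat. M > 0 \<and> of_nat M * f x \<in> (\<int> :: real set)"
  shows "\<exists>M::nat. M > 0 \<and> (\<forall>x\<in>S. of_nat M * f x \<in> (\<int> :: real set))"
  using assms
proof (induction S)
  case empty
  then show ?case by (auto intro: exI[of _ 1])
next
  case (insert a S)
  obtain M where M: "M > 0" "\<forall>x\<in>S. of_nat M * f x \<in> (\<int> :: real set)"
    using insert.IH insert.prems by auto
  obtain L where L: "L > 0" "of_nat L * f a \<in> (\<int> :: real set)" using insert.prems by blast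
  have "of_nat (M * L) * f x \<in> (\<int> :: real set)" if x: "x \<in> insert a S" for x
  proof (cases "x = a")
    case True
    have "of_nat M * (of_nat L * f a) \<in> (\<int> :: real set)" by (rule Ints_mult[OF Ints_of_nat L(2)])
    then show ?thesis using True by (simp add: mult.assoc)
  next
    case False
    have "of_nat L * (of_nat M * f x) \<in> (\<int> :: real set)"
      using M(2) False x by (auto intro: Ints_mult[OF Ints_of_nat])
    then show ?thesis by (simp add: ac_simps)
  qed
  then show ?case using M(1) L(1) by (intro exI[of _ "M * L"]) auto
qed

text \<open>One finite list serves all cones spanned by subsets of \<open>R\<close>. It is described
  by separation and not by facets because a cone of lower dimension has no unique facet normals.
  Integrality on \<open>R\<close> extends to the lattice generated by \<open>R\<close>.\<close>

definition cone_normals :: "'b::real_inner set \<Rightarrow> 'b set \<Rightarrow> bool" where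
  "cone_normals R N \<longleftrightarrow> finite N \<and> (\<forall>n\<in>N. \<forall>a\<in>R. n \<bullet> a \<in> \<int>) \<and>
    (\<forall>R'\<subseteq>R. \<forall>y. y \<notin> convex_cone hull R' \<longrightarrow> (\<exists>n\<in>N. (\<forall>a\<in>R'. n \<bullet> a \<le> 0) \<and> n \<bullet> y > 0))"

text \<open>Equivalently, the elements of \<open>R\<close> orthogonal to \<open>n\<close> span the
  hyperplane orthogonal to \<open>n\<close>.\<close>

definition determined :: "'b::real_inner set \<Rightarrow> 'b \<Rightarrow> bool" where
  "determined R n \<longleftrightarrow> n \<noteq> 0 \<and>
    (\<forall>m. (\<forall>a\<in>R. n \<bullet> a = 0 \<longrightarrow> m \<bullet> a = 0) \<longrightarrow> (\<exists>c. m = c *\<^sub>R n))"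

text \<open>A pivoting step: move \<open>n\<close> along \<open>m\<close> until one more root becomes orthogonal to it. A
  separating functional with the maximal number of orthogonal roots is therefore determined by
  them up to a scalar.\<close>

lemma more_orthogonal_roots:
  fixes R :: "'b::euclidean_space set"
  assumes fin: "finite R" and sp: "span R = UNIV" and R': "R' \<subseteq> R"
    and n: "\<And>a. a \<in> R' \<Longrightarrow> n \<bullet> a \<le> 0"
    and m: "\<And>a. \<lbrakk>a \<in> R; n \<bullet> a = 0\<rbrakk> \<Longrightarrow> m \<bullet> a = 0" "m \<noteq> 0" "m \<bullet> y = 0"
  obtains n' where "\<And>a. a \<in> R' \<Longrightarrow> n' \<bullet> a \<le> 0" "n' \<bullet> y = n \<bullet> y"
    "card {a\<in>R. n \<bullet> a = 0} < card {a\<in>R. n' \<bullet> a = 0}"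
proof -
  note witness = that
  have *: "thesis" if t: "\<And>a. a \<in> R' \<Longrightarrow> (n + t *\<^sub>R m) \<bullet> a \<le> 0"
    "b \<in> R" "m \<bullet> b \<noteq> 0" "(n + t *\<^sub>R m) \<bullet> b = 0" for t b
  proof (rule witness[of "n + t *\<^sub>R m"])
    show "(n + t *\<^sub>R m) \<bullet> y = n \<bullet> y" using m(3) by (simp add: inner_add_left)
    have "{a\<in>R. n \<bullet> a = 0} \<subset> {a\<in>R. (n + t *\<^sub>R m) \<bullet> a = 0}"
      using m(1) t(2-4) by (auto simp: inner_add_left)
    then show "card {a\<in>R. n \<bullet> a = 0} < card {a\<in>R. (n + t *\<^sub>R m) \<bullet> a = 0}"
      using fin by (intro psubset_card_mono) auto
  qed (rule t(1))
  have main: "thesis" if pos: "\<exists>a\<in>R'. s * (m \<bullet> a) > 0" for s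
  proof -
    define S where "S = {a\<in>R'. s * (m \<bullet> a) > 0}"
    \<comment> \<open>Ratio test: the longest step along \<open>s m\<close> that violates no
      inequality from \<open>R'\<close>; it makes one of them tight.\<close>
    define t where "t = Min ((\<lambda>a. - (n \<bullet> a) / (s * (m \<bullet> a))) ` S)"
    have S: "finite S" "S \<noteq> {}" using fin R' pos by (auto simp: S_def intro: finite_subset)
    then have "t \<in> (\<lambda>a. - (n \<bullet> a) / (s * (m \<bullet> a))) ` S" unfolding t_def by (intro Min_in) auto
    then obtain b where b: "b \<in> S" "t = - (n \<bullet> b) / (s * (m \<bullet> b))" by blast
    have tle: "t \<le> - (n \<bullet> a) / (s * (m \<bullet> a))" if "a \<in> S" for a
      unfolding t_def using that S by (intro Min_le) auto
    have sb: "s * (m \<bullet> b) > 0" "b \<in> R'" using b(1) by (auto simp: S_def)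
    have t0: "t \<ge> 0" unfolding b(2) using n[OF sb(2)] sb(1) by (intro divide_nonneg_pos) auto
    show thesis
    proof (rule *[of "t * s" b])
      fix a assume a: "a \<in> R'"
      have "n \<bullet> a + t * (s * (m \<bullet> a)) \<le> 0"
      proof (cases "s * (m \<bullet> a) > 0")
        case True
        then have "t * (s * (m \<bullet> a)) \<le> - (n \<bullet> a)"
          using tle[of a] a by (simp only: S_def mem_Collect_eq pos_le_divide_eq simp_thms)
        then show ?thesis by simp
      next
        case False
        then have "t * (s * (m \<bullet> a)) \<le> 0"
          using mult_nonneg_nonpos[OF t0, of "s * (m \<bullet> a)"] by linarith
        then show ?thesis using n[OF a] by simp
      qed
      then show "(n + (t * s) *\<^sub>R m) \<bullet> a \<le> 0" by (simp add: inner_add_left mult.assoc)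
    next
      show "b \<in> R" "m \<bullet> b \<noteq> 0" using sb R' by auto
      have "t * (s * (m \<bullet> b)) = - (n \<bullet> b)" using sb(1) unfolding b(2) by auto
      then show "(n + (t * s) *\<^sub>R m) \<bullet> b = 0" by (simp add: inner_add_left mult.assoc)
    qed
  qed
  show thesis
  proof (cases "\<exists>a\<in>R'. m \<bullet> a \<noteq> 0")
    case True
    then obtain a where "a \<in> R'" "m \<bullet> a \<noteq> 0" by blast
    then have "1 * (m \<bullet> a) > 0 \<or> (- 1) * (m \<bullet> a) > 0" by auto
    then show ?thesis using main \<open>a \<in> R'\<close> by blast
  next
    case False
    \<comment> \<open>No inequality from \<open>R'\<close> changes along \<open>m\<close>, so the
      step is free and can be chosen to make such a \<open>b\<close> orthogonal.\<close>
    obtain b where b: "b \<in> R" "m \<bullet> b \<noteq> 0" using spanning_orthogonal_zero[OF sp, of m] m(2) by blast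
    show ?thesis
    proof (rule *[OF _ b, of "- (n \<bullet> b) / (m \<bullet> b)"])
      show "(n + (- (n \<bullet> b) / (m \<bullet> b)) *\<^sub>R m) \<bullet> a \<le> 0" if "a \<in> R'" for a
        using False that n by (simp add: inner_left_distrib inner_diff_left)
      show "(n + (- (n \<bullet> b) / (m \<bullet> b)) *\<^sub>R m) \<bullet> b = 0"
        using b by (simp add: inner_left_distrib inner_diff_left)
    qed
  qed
qed

lemma determined_separator:
  fixes R :: "'b::euclidean_space set"
  assumes fin: "finite R" and sp: "span R = UNIV" and R': "R' \<subseteq> R" and y: "y \<notin> convex_cone hull R'"
  obtains n where "determined R n" "\<And>a. a \<in> R' \<Longrightarrow> n \<bullet> a \<le> 0" "n \<bullet> y > 0"
proof -
  define P where "P n \<longleftrightarrow> (\<forall>a\<in>R'. n \<bullet> a \<le> 0) \<and> n \<bullet> y > 0" for n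
  have "finite R'" using fin R' finite_subset by blast
  then obtain n0 where "\<And>z. z \<in> convex_cone hull R' \<Longrightarrow> n0 \<bullet> z \<le> 0" "n0 \<bullet> y > 0"
    using convex_cone_separation[OF convex_cone_convex_cone_hull closed_convex_cone_hull y] by blast
  then have "P n0" by (auto simp: P_def hull_inc)
  moreover have "\<forall>n. P n \<longrightarrow> card {a\<in>R. n \<bullet> a = 0} \<le> card R"
    using fin by (auto intro: card_mono)
  ultimately obtain n where n: "P n" "\<And>m. P m \<Longrightarrow> card {a\<in>R. m \<bullet> a = 0} \<le> card {a\<in>R. n \<bullet> a = 0}"
    using Lattices_Big.ex_has_greatest_nat[of P n0 "\<lambda>n. card {a\<in>R. n \<bullet> a = 0}" "Suc (card R)"]
    by (auto simp: less_Suc_eq_le)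
  have ny: "n \<bullet> y > 0" and nR: "\<And>a. a \<in> R' \<Longrightarrow> n \<bullet> a \<le> 0" using n(1) by (auto simp: P_def)
  have "\<exists>c. m = c *\<^sub>R n" if m: "\<forall>a\<in>R. n \<bullet> a = 0 \<longrightarrow> m \<bullet> a = 0" for m
  proof (rule ccontr)
    assume neg: "\<nexists>c. m = c *\<^sub>R n"
    \<comment> \<open>Removing a multiple of \<open>n\<close> makes \<open>m'\<close> orthogonal to
      \<open>y\<close>, so pivoting along it keeps the value at \<open>y\<close>.\<close>
    define m' where "m' = m - (m \<bullet> y / (n \<bullet> y)) *\<^sub>R n"
    have m'1: "m' \<noteq> 0" using neg by (auto simp: m'_def)
    have m'2: "m' \<bullet> y = 0" using ny by (simp add: m'_def inner_diff_left)
    have m'3: "m' \<bullet> a = 0" if "a \<in> R" "n \<bullet> a = 0" for a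
      using m that by (simp add: m'_def inner_diff_left)
    show False
    proof (rule more_orthogonal_roots[OF fin sp R' nR m'3 m'1 m'2])
      fix n' assume "\<And>a. a \<in> R' \<Longrightarrow> n' \<bullet> a \<le> 0" "n' \<bullet> y = n \<bullet> y"
        "card {a\<in>R. n \<bullet> a = 0} < card {a\<in>R. n' \<bullet> a = 0}"
      then show False using n(2)[of n'] ny by (auto simp: P_def)
    qed
  qed
  then have "determined R n" using ny by (auto simp: determined_def)
  then show ?thesis using that nR ny by blast
qed

text \<open>The roots orthogonal to \<open>n\<close> span its orthogonal complement, so each root is
  a multiple of one fixed root \<open>b\<close> plus a vector in that span. By
  \<open>rational_ratio\<close> the quotients \<open>(n \<bullet> a) / (n \<bullet> b)\<close> are
  rational, and finitely many denominators can be cleared.\<close>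

lemma determined_integral:
  fixes R :: "'b::euclidean_space set"
  assumes fin: "finite R" and sp: "span R = UNIV"
    and C: "finite C" "span C = UNIV" "\<And>a c. \<lbrakk>a \<in> R; c \<in> C\<rbrakk> \<Longrightarrow> a \<bullet> c \<in> \<int>"
    and n: "determined R n"
  obtains k where "k > 0" "\<And>a. a \<in> R \<Longrightarrow> (k *\<^sub>R n) \<bullet> a \<in> \<int>"
proof -
  have "n \<noteq> 0" using n by (simp add: determined_def)
  then obtain b where b: "b \<in> R" "n \<bullet> b \<noteq> 0" using spanning_orthogonal_zero[OF sp, of n] by blast
  define Z where "Z = {a\<in>R. n \<bullet> a = 0}"
  have perp: "z \<in> span Z" if z: "n \<bullet> z = 0" for z
  proof -
    obtain p q where pq: "p \<in> span Z" "\<And>w. w \<in> span Z \<Longrightarrow> orthogonal q w" "z = p + q"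
      using orthogonal_subspace_decomp_exists[of Z z] by metis
    have "q \<bullet> a = 0" if "a \<in> Z" for a using pq(2)[OF span_base[OF that]] by (simp add: orthogonal_def)
    then have "\<forall>a\<in>R. n \<bullet> a = 0 \<longrightarrow> q \<bullet> a = 0" by (simp add: Z_def)
    then obtain c where c: "q = c *\<^sub>R n" using n unfolding determined_def by blast
    have "orthogonal n p" by (rule orthogonal_to_span[OF pq(1)]) (auto simp: Z_def orthogonal_def)
    then have "n \<bullet> q = 0" using z pq(3) by (simp add: orthogonal_def inner_add_right)
    then have "q \<bullet> q = 0" using c by simp
    then show ?thesis using pq by simp
  qed
  have "\<exists>M::nat. M > 0 \<and> of_nat M * ((n \<bullet> a) / (n \<bullet> b)) \<in> (\<int> :: real set)" if a: "a \<in> R" for a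
  proof -
    define c where "c = (n \<bullet> a) / (n \<bullet> b)"
    have "n \<bullet> (a - c *\<^sub>R b) = 0" using b by (simp add: c_def inner_diff_right)
    then have "a - c *\<^sub>R b \<in> span (insert b Z)" using perp span_mono[of Z "insert b Z"] by blast
    from span_add[OF this span_scale[OF span_base[of b]], of c]
    have sp: "a \<in> span (insert b Z)" by simp
    have "finite (insert b Z)" using fin by (simp add: Z_def)
    then obtain M :: nat and K :: int where "M > 0" "of_nat M * (n \<bullet> a) = of_int K * (n \<bullet> b)"
    proof (rule rational_ratio[of C "insert b Z" b a n, OF C(1,2) _ insertI1 sp])
      show "x \<bullet> c \<in> \<int>" if "x \<in> insert a (insert b Z)" "c \<in> C" for x c
        using C(3) that a b(1) by (auto simp: Z_def)
      show "n \<bullet> x = 0" if "x \<in> insert b Z" "x \<noteq> b" for x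
        using that by (simp add: Z_def)
    qed
    then have "of_nat M * ((n \<bullet> a) / (n \<bullet> b)) = of_int K" using b by (simp add: field_simps)
    then show ?thesis using \<open>M > 0\<close> by (metis Ints_of_int)
  qed
  then have "\<exists>M::nat. M > 0 \<and> (\<forall>a\<in>R. of_nat M * ((n \<bullet> a) / (n \<bullet> b)) \<in> (\<int> :: real set))"
    by (rule common_multiplier[OF fin])
  then obtain M :: nat where
    M: "M > 0" "\<And>a. a \<in> R \<Longrightarrow> of_nat M * ((n \<bullet> a) / (n \<bullet> b)) \<in> (\<int> :: real set)" by auto
  \<comment> \<open>The absolute value makes the factor positive, so the direction of
    \<open>n\<close> is preserved.\<close>
  show ?thesis
  proof (rule that[of "of_nat M / \<bar>n \<bullet> b\<bar>"])
    show "0 < of_nat M / \<bar>n \<bullet> b\<bar>" using M(1) b by simp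
    fix a assume "a \<in> R"
    have "((of_nat M / \<bar>n \<bullet> b\<bar>) *\<^sub>R n) \<bullet> a = sgn (n \<bullet> b) * (of_nat M * ((n \<bullet> a) / (n \<bullet> b)))"
      using b by (simp add: sgn_if abs_if)
    also have "\<dots> \<in> \<int>" by (rule Ints_mult[OF _ M(2)[OF \<open>a \<in> R\<close>]]) (simp add: sgn_if)
    finally show "((of_nat M / \<bar>n \<bullet> b\<bar>) *\<^sub>R n) \<bullet> a \<in> \<int>" .
  qed
qed

text \<open>Up to scaling, a determined functional is known from its set of orthogonal roots, of
  which there are finitely many. \<open>\<nu>\<close> chooses an integral representative for each,
  and negatives are added because the choice fixes no sign.\<close>

lemma cone_normals_exist:
  fixes R :: "'b::euclidean_space set"
  assumes fin: "finite R" and sp: "span R = UNIV"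
    and C: "finite C" "span C = UNIV" "\<And>a c. \<lbrakk>a \<in> R; c \<in> C\<rbrakk> \<Longrightarrow> a \<bullet> c \<in> \<int>"
  obtains N where "cone_normals R N"
proof -
  define I where "I = {n. determined R n \<and> (\<forall>a\<in>R. n \<bullet> a \<in> \<int>)}"
  define Z where "Z n = {a\<in>R. n \<bullet> a = 0}" for n
  define \<nu> where "\<nu> Y = (SOME n. n \<in> I \<and> Z n = Y)" for Y
  define N where "N = (\<nu> ` (Z ` I)) \<union> (uminus ` \<nu> ` (Z ` I))"
  have \<nu>: "\<nu> Y \<in> I \<and> Z (\<nu> Y) = Y" if Y: "Y \<in> Z ` I" for Y
    unfolding \<nu>_def by (rule someI_ex) (use Y in blast)
  have "Z ` I \<subseteq> Pow R" by (auto simp: Z_def)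
  then have "finite (Z ` I)" using fin finite_subset by blast
  then have finN: "finite N" by (simp add: N_def)
  have intN: "n \<bullet> a \<in> \<int>" if "n \<in> N" "a \<in> R" for n a
    using that \<nu> by (auto simp: N_def I_def)
  have "\<exists>n\<in>N. (\<forall>a\<in>R'. n \<bullet> a \<le> 0) \<and> n \<bullet> y > 0"
    if R': "R' \<subseteq> R" and y: "y \<notin> convex_cone hull R'" for R' y
  proof -
    obtain n0 where n0: "determined R n0" "\<And>a. a \<in> R' \<Longrightarrow> n0 \<bullet> a \<le> 0" "n0 \<bullet> y > 0"
      using determined_separator[OF fin sp R' y] by metis
    obtain k where k: "k > 0" "\<And>a. a \<in> R \<Longrightarrow> (k *\<^sub>R n0) \<bullet> a \<in> \<int>"
      using determined_integral[OF fin sp C n0(1)] by metis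
    define n where "n = k *\<^sub>R n0"
    have "determined R n"
      unfolding determined_def
    proof (intro conjI allI impI)
      show "n \<noteq> 0" using n0(1) k(1) by (simp add: n_def determined_def)
      fix m assume "\<forall>a\<in>R. n \<bullet> a = 0 \<longrightarrow> m \<bullet> a = 0"
      then have "\<forall>a\<in>R. n0 \<bullet> a = 0 \<longrightarrow> m \<bullet> a = 0" using k(1) by (simp add: n_def)
      then obtain c where "m = c *\<^sub>R n0" using n0(1) by (auto simp: determined_def)
      then have "m = (c / k) *\<^sub>R n" using k(1) by (simp add: n_def)
      then show "\<exists>c. m = c *\<^sub>R n" by blast
    qed
    then have nI: "n \<in> I" using k(2) by (simp add: I_def n_def)
    define w where "w = \<nu> (Z n)"
    have w: "w \<in> I" "Z w = Z n" using \<nu>[of "Z n"] nI by (auto simp: w_def)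
    have "\<forall>a\<in>R. n \<bullet> a = 0 \<longrightarrow> w \<bullet> a = 0" using w(2) by (auto simp: Z_def)
    then obtain c where c: "w = c *\<^sub>R n" using \<open>determined R n\<close> by (auto simp: determined_def)
    have "c \<noteq> 0" using c w(1) by (auto simp: I_def determined_def)
    have nn: "\<And>a. a \<in> R' \<Longrightarrow> n \<bullet> a \<le> 0" "n \<bullet> y > 0"
      using n0 k(1) by (auto simp: n_def mult_nonneg_nonpos)
    \<comment> \<open>\<open>sgn c\<close> selects the listed sign that is a positive multiple of
      \<open>n\<close>.\<close>
    define u where "u = sgn c *\<^sub>R w"
    have u: "u = \<bar>c\<bar> *\<^sub>R n" by (simp add: u_def c mult.commute abs_sgn)
    have "w \<in> \<nu> ` (Z ` I)" using nI by (auto simp: w_def)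
    then have "u \<in> N" using \<open>c \<noteq> 0\<close> by (auto simp: u_def N_def sgn_if)
    moreover have "u \<bullet> y > 0" using nn(2) \<open>c \<noteq> 0\<close> by (simp add: u)
    moreover have "u \<bullet> a \<le> 0" if "a \<in> R'" for a using nn(1)[OF that] by (simp add: u mult_nonneg_nonpos)
    ultimately show ?thesis by blast
  qed
  then have "cone_normals R N" using finN intN by (auto simp: cone_normals_def)
  then show ?thesis by (rule that)
qed

subsection \<open>M-convex polyhedra\<close>

text \<open>This is \<open>M_convex_polyhedron\<close> read in \<open>V\<close>, with \<open>R\<close> the set of Riesz representatives of the roots.\<close>

definition root_tangent :: "'b::real_normed_vector set \<Rightarrow> 'b set \<Rightarrow> bool" where
  "root_tangent R P \<longleftrightarrow> P \<noteq> {} \<and> closed P \<and> convex P \<and>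
    (\<forall>p\<in>P. \<exists>R'\<subseteq>R. tangent_cone P p = convex_cone hull R')"

lemma tangent_cone_le:
  fixes P :: "'b::real_inner set"
  assumes "\<And>z. z \<in> P \<Longrightarrow> n \<bullet> z \<le> n \<bullet> q" "v \<in> tangent_cone P q"
  shows "n \<bullet> v \<le> 0"
proof -
  have "convex_cone hull ((\<lambda>z. z - q) ` P) \<subseteq> {v. n \<bullet> v \<le> 0}"
    using assms(1) by (intro hull_minimal convex_cone_halfspace_le) (auto simp: inner_diff_right)
  then have "tangent_cone P q \<subseteq> {v. n \<bullet> v \<le> 0}"
    unfolding tangent_cone_def by (rule closure_minimal[OF _ closed_halfspace_le])
  then show ?thesis using assms(2) by blast
qed

lemma in_tangent_cone: "z \<in> P \<Longrightarrow> z - q \<in> tangent_cone P q"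
  unfolding tangent_cone_def using closure_subset by (fastforce intro: hull_inc)

text \<open>If \<open>q\<close> is the point of \<open>P\<close> closest to \<open>y\<close>, then
  \<open>y - q\<close> is not in the tangent cone at \<open>q\<close>. That cone is spanned by
  roots, so a normal in \<open>N\<close> separates; it is maximal over \<open>P\<close> at
  \<open>q\<close> because \<open>P - q\<close> lies in the tangent cone. Thus \<open>P\<close> is
  cut out by supporting half-spaces with normals in \<open>N\<close>.\<close>

lemma root_tangent_outer:
  fixes P :: "'b::euclidean_space set"
  assumes N: "cone_normals R N" and P: "root_tangent R P" and y: "y \<notin> P"
  obtains n q where "n \<in> N" "q \<in> P" "\<And>z. z \<in> P \<Longrightarrow> n \<bullet> z \<le> n \<bullet> q" "n \<bullet> q < n \<bullet> y"
proof -
  have P': "P \<noteq> {}" "closed P" "convex P" using P by (auto simp: root_tangent_def)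
  define q where "q = closest_point P y"
  have q: "q \<in> P" unfolding q_def by (rule closest_point_in_set[OF P'(2,1)])
  have "(y - q) \<bullet> z \<le> (y - q) \<bullet> q" if "z \<in> P" for z
    using closest_point_dot[OF P'(3,2) that, of y] by (simp add: q_def inner_diff_right)
  then have le: "(y - q) \<bullet> v \<le> 0" if "v \<in> tangent_cone P q" for v
    using that by (rule tangent_cone_le)
  have nt: "y - q \<notin> tangent_cone P q"
  proof
    assume "y - q \<in> tangent_cone P q"
    then have "(y - q) \<bullet> (y - q) \<le> 0" by (rule le)
    moreover have "y - q \<noteq> 0" using y q by auto
    ultimately show False by (simp only: inner_gt_zero_iff[symmetric])
  qed
  obtain R' where R': "R' \<subseteq> R" "tangent_cone P q = convex_cone hull R'"
    using P q unfolding root_tangent_def by blast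
  obtain n where n: "n \<in> N" "\<forall>a\<in>R'. n \<bullet> a \<le> 0" "n \<bullet> (y - q) > 0"
    using N R' nt unfolding cone_normals_def by metis
  have "convex_cone hull R' \<subseteq> {v. n \<bullet> v \<le> 0}"
    using n(2) by (intro hull_minimal convex_cone_halfspace_le) auto
  then have "n \<bullet> (z - q) \<le> 0" if "z \<in> P" for z using in_tangent_cone[OF that, of q] R'(2) by blast
  then show ?thesis using n q by (intro that[of n q]) (auto simp: inner_diff_right)
qed

lemma hull_attains:
  fixes x :: "'b::real_inner"
  assumes "x \<in> convex hull S"
  obtains z where "z \<in> S" "n \<bullet> x \<le> n \<bullet> z"
proof (rule ccontr)
  assume "\<not> thesis"
  then have "S \<subseteq> {z. n \<bullet> z < n \<bullet> x}" using that by fastforce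
  then have "convex hull S \<subseteq> {z. n \<bullet> z < n \<bullet> x}" by (intro hull_minimal convex_halfspace_lt)
  then show False using assms by blast
qed

text \<open>The level of a supporting hyperplane with normal in \<open>N\<close> is attained at a
  lattice point and hence an integer. Rounding \<open>n \<bullet> p\<close> up cannot exceed it, so
  no point of the cell of \<open>p\<close> is cut off.\<close>

lemma integral_root_tangent_saturated:
  fixes P :: "'b::euclidean_space set"
  assumes N: "cone_normals R N" and P: "root_tangent R P" "P = convex hull (P \<inter> L)"
    and L: "\<And>n z. \<lbrakk>n \<in> N; z \<in> L\<rbrakk> \<Longrightarrow> n \<bullet> z \<in> \<int>"
  shows "cell_saturated N P"
  unfolding cell_saturated_def
proof (intro ballI subsetI, rule ccontr)
  fix p y assume p: "p \<in> P" and y: "y \<in> cell N p" "y \<notin> P"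
  obtain n q where n: "n \<in> N" "q \<in> P" "\<And>z. z \<in> P \<Longrightarrow> n \<bullet> z \<le> n \<bullet> q" "n \<bullet> q < n \<bullet> y"
    using root_tangent_outer[OF N P(1) y(2)] by metis
  have "q \<in> convex hull (P \<inter> L)" using n(2) P(2) by blast
  then obtain z where z: "z \<in> P \<inter> L" "n \<bullet> q \<le> n \<bullet> z" by (rule hull_attains)
  then have "n \<bullet> z = n \<bullet> q" using n(3)[of z] by simp
  then have "n \<bullet> q \<in> \<int>" using L[OF n(1), of z] z(1) by simp
  then obtain k where k: "n \<bullet> q = of_int k" by (auto elim: Ints_cases)
  have "\<lceil>n \<bullet> p\<rceil> \<le> k" using n(3)[OF p] k by (simp add: ceiling_le_iff)
  moreover have "n \<bullet> y \<le> of_int \<lceil>n \<bullet> p\<rceil>" using y(1) n(1) by (auto simp: cell_def)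
  ultimately show False using n(4) k by (smt (verit) of_int_le_iff)
qed

text \<open>Vectors of the tangent cone are a priori only limits of feasible directions. By
  \<open>root_tangent_outer\<close> finitely many normals decide membership in \<open>P\<close>:
  those in \<open>F\<close> have slack at \<open>q\<close> and admit a short step, and the other
  supporting ones are nonpositive on \<open>a\<close>.\<close>

lemma root_tangent_feasible:
  fixes P :: "'b::euclidean_space set"
  assumes N: "cone_normals R N" and P: "root_tangent R P" and q: "q \<in> P" and a: "a \<in> tangent_cone P q"
  obtains e where "e > 0" "q + e *\<^sub>R a \<in> P"
proof -
  define F where "F = {n\<in>N. \<exists>w\<in>P. (\<forall>z\<in>P. n \<bullet> z \<le> n \<bullet> w) \<and> n \<bullet> q < n \<bullet> w}"
  have "finite F" using N by (simp add: F_def cone_normals_def)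
  have "\<forall>\<^sub>F e in at_right 0. \<forall>n\<in>F. \<exists>w\<in>P. n \<bullet> (q + e *\<^sub>R a) < n \<bullet> w"
  proof (rule eventually_ball_finite[OF \<open>finite F\<close>], rule ballI)
    fix n assume "n \<in> F"
    then obtain w where w: "w \<in> P" "n \<bullet> q < n \<bullet> w" by (auto simp: F_def)
    have "((\<lambda>e. n \<bullet> (q + e *\<^sub>R a)) \<longlongrightarrow> n \<bullet> (q + 0 *\<^sub>R a)) (at_right 0)"
      by (intro tendsto_intros)
    then have "\<forall>\<^sub>F e in at_right 0. n \<bullet> (q + e *\<^sub>R a) < n \<bullet> w"
      using w(2) by (intro order_tendstoD(2)) auto
    then show "\<forall>\<^sub>F e in at_right 0. \<exists>w\<in>P. n \<bullet> (q + e *\<^sub>R a) < n \<bullet> w"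
      by eventually_elim (use w(1) in blast)
  qed
  then obtain e0 :: real where "e0 > 0"
    "\<And>e. \<lbrakk>0 < e; e < e0\<rbrakk> \<Longrightarrow> \<forall>n\<in>F. \<exists>w\<in>P. n \<bullet> (q + e *\<^sub>R a) < n \<bullet> w"
    by (auto simp: eventually_at_right_field)
  then have e: "\<forall>n\<in>F. \<exists>w\<in>P. n \<bullet> (q + (e0 / 2) *\<^sub>R a) < n \<bullet> w" "e0 / 2 > 0" by auto
  have "q + (e0 / 2) *\<^sub>R a \<in> P"
  proof (rule ccontr)
    assume "q + (e0 / 2) *\<^sub>R a \<notin> P"
    then obtain n w where n: "n \<in> N" "w \<in> P" "\<And>z. z \<in> P \<Longrightarrow> n \<bullet> z \<le> n \<bullet> w"
      "n \<bullet> w < n \<bullet> (q + (e0 / 2) *\<^sub>R a)"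
      using root_tangent_outer[OF N P] by metis
    show False
    proof (cases "n \<bullet> q < n \<bullet> w")
      case True
      then have "n \<in> F" using n by (auto simp: F_def)
      then obtain w' where "w' \<in> P" "n \<bullet> (q + (e0 / 2) *\<^sub>R a) < n \<bullet> w'" using e(1) by blast
      then show False using n(3)[of w'] n(4) by simp
    next
      case False
      then have "n \<bullet> z \<le> n \<bullet> q" if "z \<in> P" for z using n(3)[OF that] by simp
      then have "n \<bullet> a \<le> 0" using a by (rule tangent_cone_le)
      then have "e0 / 2 * (n \<bullet> a) \<le> 0" using e(2) by (intro mult_nonneg_nonpos) auto
      then show False using n(3)[OF q] n(4) by (simp add: inner_add_right)
    qed
  qed
  then show ?thesis using e(2) that by blast
qed

section \<open>Segments, rays and end points in convex sets\<close>

lemma convex_between: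
  assumes "convex P" "q + s *\<^sub>R a \<in> P" "q + t *\<^sub>R a \<in> P" "s \<le> u" "u \<le> t"
  shows "q + u *\<^sub>R a \<in> P"
proof (cases "s = t")
  case False
  define l where "l = (u - s) / (t - s)"
  have l: "0 \<le> l" "l \<le> 1" using assms False by (auto simp: l_def)
  then have "(1 - l) *\<^sub>R (q + s *\<^sub>R a) + l *\<^sub>R (q + t *\<^sub>R a) \<in> P"
    using assms by (intro convexD) auto
  moreover have "(1 - l) *\<^sub>R (q + s *\<^sub>R a) + l *\<^sub>R (q + t *\<^sub>R a) = q + ((1 - l) * s + l * t) *\<^sub>R a"
    by (simp add: algebra_simps)
  moreover have "l * (t - s) = u - s" using False by (simp add: l_def)
  then have "(1 - l) * s + l * t = u" by (simp add: algebra_simps)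
  ultimately show ?thesis by simp
qed (use assms in auto)

text \<open>One ray suffices for a recession direction: the points \<open>X k\<close> lie on
  segments from \<open>z\<close> to ever farther points of the ray and converge to the required
  point.\<close>

lemma closed_convex_ray:
  fixes P :: "'b::real_normed_vector set"
  assumes "closed P" "convex P" "\<And>t. t \<ge> 0 \<Longrightarrow> q + t *\<^sub>R a \<in> P" "z \<in> P" "t \<ge> 0"
  shows "z + t *\<^sub>R a \<in> P"
proof -
  define X where "X k = (1 - 1 / real (Suc k)) *\<^sub>R z + (1 / real (Suc k)) *\<^sub>R (q + (real (Suc k) * t) *\<^sub>R a)" for k
  have "X k \<in> P" for k
    unfolding X_def using assms by (intro convexD) auto
  moreover have eq: "X k = z + t *\<^sub>R a + (1 / real (Suc k)) *\<^sub>R (q - z)" for k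
  proof -
    define c m where "c = 1 / real (Suc k)" and "m = real (Suc k) * t"
    have "c * m = t" by (simp add: c_def m_def)
    then have "(1 - c) *\<^sub>R z + c *\<^sub>R (q + m *\<^sub>R a) = z + t *\<^sub>R a + c *\<^sub>R (q - z)"
      by (simp add: algebra_simps)
    then show ?thesis by (simp add: X_def c_def m_def)
  qed
  have "X \<longlonglongrightarrow> z + t *\<^sub>R a + 0 *\<^sub>R (q - z)"
    unfolding eq using LIMSEQ_inverse_real_of_nat
    by (intro tendsto_intros) (simp add: inverse_eq_divide)
  ultimately show ?thesis using assms(1) closed_sequentially[of P X] by fastforce
qed

lemma closed_convex_endpoint:
  fixes P :: "'b::real_normed_vector set"
  assumes "closed P" "convex P" "q \<in> P" "\<exists>t\<ge>0. q + t *\<^sub>R a \<notin> P"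
  obtains t where "t \<ge> 0" "q + t *\<^sub>R a \<in> P" "\<And>s. s > t \<Longrightarrow> q + s *\<^sub>R a \<notin> P"
proof -
  obtain t0 where t0: "t0 \<ge> 0" "q + t0 *\<^sub>R a \<notin> P" using assms(4) by blast
  define I where "I = {t. 0 \<le> t \<and> q + t *\<^sub>R a \<in> P}"
  have ub: "t \<le> t0" if "t \<in> I" for t
    using convex_between[OF assms(2), of q 0 a t t0] assms(3) t0 that
    by (cases "t0 \<le> t") (auto simp: I_def)
  have "I = {0..} \<inter> (\<lambda>t. q + t *\<^sub>R a) -` P" by (auto simp: I_def)
  moreover have "closed ((\<lambda>t. q + t *\<^sub>R a) -` P)"
    by (intro closed_vimage assms(1) continuous_intros)
  ultimately have "closed I" by auto
  have "0 \<in> I" using assms(3) by (simp add: I_def)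
  have bdd: "bdd_above I" using ub by (rule bdd_aboveI)
  have "Sup I \<in> I" using closed_contains_Sup[OF _ bdd \<open>closed I\<close>] \<open>0 \<in> I\<close> by blast
  moreover have "q + s *\<^sub>R a \<notin> P" if "s > Sup I" for s
  proof
    assume "q + s *\<^sub>R a \<in> P"
    moreover have "s \<ge> 0" using that cSup_upper[OF \<open>0 \<in> I\<close> bdd] by simp
    ultimately have "s \<in> I" by (simp add: I_def)
    then show False using cSup_upper[OF _ bdd] that by fastforce
  qed
  ultimately show ?thesis using that by (auto simp: I_def)
qed

text \<open>Integer steps along \<open>a\<close> stay in \<open>P\<close> and in \<open>L\<close>,
  and a real step lies between two of them.\<close>

lemma hull_lattice_ray:
  fixes P :: "'b::real_vector set"
  assumes ray: "\<And>z t. \<lbrakk>z \<in> P; t \<ge> 0\<rbrakk> \<Longrightarrow> z + t *\<^sub>R a \<in> P" and L: "\<And>z. z \<in> L \<Longrightarrow> z + a \<in> L"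
    and z: "z \<in> convex hull (P \<inter> L)" and t: "t \<ge> 0"
  shows "z + t *\<^sub>R a \<in> convex hull (P \<inter> L)"
proof -
  have step: "z + real k *\<^sub>R a \<in> P \<inter> L" if "z \<in> P \<inter> L" for z k
  proof
    show "z + real k *\<^sub>R a \<in> P" using ray that by simp
    show "z + real k *\<^sub>R a \<in> L"
    proof (induction k)
      case (Suc k)
      then have "(z + real k *\<^sub>R a) + a \<in> L" by (rule L)
      then show ?case by (simp add: algebra_simps)
    qed (use that in simp)
  qed
  have "P \<inter> L \<subseteq> {z. z + t *\<^sub>R a \<in> convex hull (P \<inter> L)}"
  proof
    fix z assume z: "z \<in> P \<inter> L"
    obtain k where k: "t \<le> real k" using real_arch_simple by blast
    have "z + 0 *\<^sub>R a \<in> convex hull (P \<inter> L)" "z + real k *\<^sub>R a \<in> convex hull (P \<inter> L)"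
      using step[OF z, of k] z by (auto intro: hull_inc)
    from convex_between[OF convex_convex_hull this t k]
    show "z \<in> {z. z + t *\<^sub>R a \<in> convex hull (P \<inter> L)}" by simp
  qed
  moreover have "convex {z. z + t *\<^sub>R a \<in> convex hull (P \<inter> L)}"
  proof (rule convexI)
    fix x y and u v :: real
    assume xy: "x \<in> {z. z + t *\<^sub>R a \<in> convex hull (P \<inter> L)}" "y \<in> {z. z + t *\<^sub>R a \<in> convex hull (P \<inter> L)}"
      and uv: "0 \<le> u" "0 \<le> v" "u + v = 1"
    have "u *\<^sub>R (x + t *\<^sub>R a) + v *\<^sub>R (y + t *\<^sub>R a) \<in> convex hull (P \<inter> L)"
      using xy uv by (intro convexD) auto
    moreover have "u *\<^sub>R (x + t *\<^sub>R a) + v *\<^sub>R (y + t *\<^sub>R a) = u *\<^sub>R x + v *\<^sub>R y + ((u + v) * t) *\<^sub>R a"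
      by (simp add: algebra_simps)
    ultimately show "u *\<^sub>R x + v *\<^sub>R y \<in> {z. z + t *\<^sub>R a \<in> convex hull (P \<inter> L)}" using uv by simp
  qed
  ultimately have "convex hull (P \<inter> L) \<subseteq> {z. z + t *\<^sub>R a \<in> convex hull (P \<inter> L)}" by (rule hull_minimal)
  then show ?thesis using z by blast
qed

text \<open>The roots along which one can move from \<open>q\<close> in both directions inside \<open>P\<close>. Moving as far as
  possible along one of them reduces their number, which drives the induction in
  \<open>root_tangent_integral\<close>; in the terminal case they all span lines contained in \<open>P\<close>.\<close>

definition two_sided :: "'b::real_vector set \<Rightarrow> 'b set \<Rightarrow> 'b \<Rightarrow> 'b set" where
  "two_sided R P q = {a\<in>R. \<exists>e>0. q + e *\<^sub>R a \<in> P \<and> q + (- e) *\<^sub>R a \<in> P}"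

lemma two_sidedI:
  assumes "convex P" "q \<in> P" "a \<in> R" "e > 0" "q + e *\<^sub>R a \<in> P" "f > 0" "q + (- f) *\<^sub>R a \<in> P"
  shows "a \<in> two_sided R P q"
proof -
  have "q + min e f *\<^sub>R a \<in> P"
    by (rule convex_between[OF assms(1,7,5)]) (use assms in auto)
  moreover have "q + (- min e f) *\<^sub>R a \<in> P"
    by (rule convex_between[OF assms(1,7,5)]) (use assms in auto)
  moreover have "min e f > 0" using assms by simp
  ultimately show ?thesis using assms(3) unfolding two_sided_def by blast
qed

text \<open>The homothety with centre \<open>q - e d\<close> and factor
  \<open>l = e / (e + t)\<close> sends the end point \<open>w\<close> to \<open>q\<close> and maps
  \<open>P\<close> into itself, so a root that is two-sided at \<open>w\<close> is two-sided at
  \<open>q\<close>. The root \<open>a\<close> is lost because \<open>w\<close> is the last point of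
  \<open>P\<close> in its direction.\<close>

lemma two_sided_endpoint:
  fixes P :: "'b::real_normed_vector set"
  assumes "convex P" "finite R" "a \<in> two_sided R P q" "s = 1 \<or> s = - 1"
    and "t \<ge> 0" "q + t *\<^sub>R (s *\<^sub>R a) \<in> P" "\<And>u. u > t \<Longrightarrow> q + u *\<^sub>R (s *\<^sub>R a) \<notin> P"
  shows "card (two_sided R P (q + t *\<^sub>R (s *\<^sub>R a))) < card (two_sided R P q)"
proof -
  define d where "d = s *\<^sub>R a"
  define w where "w = q + t *\<^sub>R d"
  obtain e where e: "e > 0" "q + e *\<^sub>R a \<in> P" "q + (- e) *\<^sub>R a \<in> P"
    using assms(3) by (auto simp: two_sided_def)
  then have e': "q + e *\<^sub>R d \<in> P" "q + (- e) *\<^sub>R d \<in> P" using assms(4) by (auto simp: d_def)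
  have "t \<ge> e" using assms(7)[of e] e'(1) by (force simp: d_def)
  have "two_sided R P w \<subseteq> two_sided R P q"
  proof
    fix b assume "b \<in> two_sided R P w"
    then obtain f where f: "b \<in> R" "f > 0" "w + f *\<^sub>R b \<in> P" "w + (- f) *\<^sub>R b \<in> P"
      by (auto simp: two_sided_def)
    define l where "l = e / (e + t)"
    have l: "0 < l" "l \<le> 1" "l * (e + t) = e" using e(1) \<open>t \<ge> e\<close> by (auto simp: l_def)
    have "q + (l * g) *\<^sub>R b \<in> P" if "w + g *\<^sub>R b \<in> P" for g
    proof -
      have "(1 - l) *\<^sub>R (q + (- e) *\<^sub>R d) + l *\<^sub>R (w + g *\<^sub>R b) \<in> P"
        using that e'(2) l by (intro convexD assms(1)) auto
      moreover have "(1 - l) *\<^sub>R (q + (- e) *\<^sub>R d) + l *\<^sub>R (w + g *\<^sub>R b) =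
          q + (l * (e + t) - e) *\<^sub>R d + (l * g) *\<^sub>R b"
        by (simp add: w_def algebra_simps)
      ultimately show ?thesis using l(3) by simp
    qed
    from this[OF f(3)] this[OF f(4)] show "b \<in> two_sided R P q"
      using f(1,2) l(1) by (auto simp: two_sided_def intro!: exI[of _ "l * f"])
  qed
  moreover have "a \<notin> two_sided R P w"
  proof
    assume "a \<in> two_sided R P w"
    then obtain f where f: "f > 0" "w + f *\<^sub>R a \<in> P" "w + (- f) *\<^sub>R a \<in> P"
      by (auto simp: two_sided_def)
    then have "w + f *\<^sub>R d \<in> P" using assms(4) by (auto simp: d_def)
    then have "q + (t + f) *\<^sub>R d \<in> P" by (simp add: w_def algebra_simps)
    then show False using assms(7)[of "t + f"] f(1) by (simp add: d_def)
  qed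
  ultimately have "two_sided R P w \<subset> two_sided R P q" using assms(3) by blast
  then show ?thesis using assms(2) psubset_card_mono[of "two_sided R P q"]
    by (simp add: w_def d_def two_sided_def)
qed

text \<open>A functional \<open>d\<close> in the relative interior of the normal cone at
  \<open>q\<close> has a maximizing lattice point \<open>b\<close>, and \<open>b - q\<close>
  involves only generators in the lineality space of the tangent cone. These are directions of whole
  lines in \<open>P\<close>, along which the hull of the lattice points is invariant, so
  \<open>b\<close> can be moved back to \<open>q\<close>.\<close>

lemma root_tangent_terminal:
  fixes P :: "'b::euclidean_space set"
  assumes fin: "finite R" and N: "cone_normals R N" and P: "root_tangent R P" and q: "q \<in> P"
    and L: "\<And>z a. \<lbrakk>z \<in> L; a \<in> R\<rbrakk> \<Longrightarrow> z + a \<in> L \<and> z - a \<in> L"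
    and sup: "\<And>d q. \<lbrakk>q \<in> P; \<And>z. z \<in> P \<Longrightarrow> d \<bullet> z \<le> d \<bullet> q\<rbrakk> \<Longrightarrow> \<exists>b\<in>P \<inter> L. d \<bullet> b = d \<bullet> q"
    and line: "\<And>a t. a \<in> two_sided R P q \<Longrightarrow> q + t *\<^sub>R a \<in> P"
  shows "q \<in> convex hull (P \<inter> L)"
proof -
  have P': "closed P" "convex P" using P by (auto simp: root_tangent_def)
  obtain R' where R': "R' \<subseteq> R" "tangent_cone P q = convex_cone hull R'"
    using P q unfolding root_tangent_def by blast
  have finR': "finite R'" using R' fin finite_subset by blast
  \<comment> \<open>The generators in the lineality space of the tangent cone.\<close>
  define R0 where "R0 = {a\<in>R'. - a \<in> convex_cone hull R'}"
  have move: "z + t *\<^sub>R a \<in> convex hull (P \<inter> L)"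
    if a: "a \<in> R0" and z: "z \<in> convex hull (P \<inter> L)" for a z and t :: real
  proof -
    have "a \<in> convex_cone hull R'" "- a \<in> convex_cone hull R'" "a \<in> R"
      using a R' by (auto simp: R0_def hull_inc)
    then obtain e f where "e > 0" "q + e *\<^sub>R a \<in> P" "f > 0" "q + f *\<^sub>R (- a) \<in> P"
      using root_tangent_feasible[OF N P q] R'(2) by metis
    then have "a \<in> two_sided R P q" using \<open>a \<in> R\<close> q P' by (intro two_sidedI[of P q a R e f]) auto
    then have ln: "q + t *\<^sub>R a \<in> P" for t using line by blast
    have ray: "w + t *\<^sub>R a \<in> P" if "w \<in> P" "t \<ge> 0" for w t
      using closed_convex_ray[OF P', of q a w t] ln that by blast
    have ray': "w + t *\<^sub>R (- a) \<in> P" if "w \<in> P" "t \<ge> 0" for w t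
      using closed_convex_ray[OF P', of q "- a" w t] ln[of "- _"] that by simp
    show ?thesis
    proof (cases "t \<ge> 0")
      case True
      then show ?thesis using hull_lattice_ray[of P a L z t] ray L \<open>a \<in> R\<close> z by blast
    next
      case False
      then have "z + (- t) *\<^sub>R (- a) \<in> convex hull (P \<inter> L)"
        using L[OF _ \<open>a \<in> R\<close>] z by (intro hull_lattice_ray[of P "- a" L z "- t", OF ray']) auto
      then show ?thesis by simp
    qed
  qed
  have "\<forall>a\<in>R' - R0. \<exists>d. (\<forall>z\<in>convex_cone hull R'. d \<bullet> z \<le> 0) \<and> d \<bullet> (- a) > 0"
  proof
    fix a assume "a \<in> R' - R0"
    then have "- a \<notin> convex_cone hull R'" by (auto simp: R0_def)
    then show "\<exists>d. (\<forall>z\<in>convex_cone hull R'. d \<bullet> z \<le> 0) \<and> d \<bullet> (- a) > 0"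
      using convex_cone_separation[OF convex_cone_convex_cone_hull closed_convex_cone_hull[OF finR']] by metis
  qed
  then obtain D where D: "\<And>a z. \<lbrakk>a \<in> R' - R0; z \<in> convex_cone hull R'\<rbrakk> \<Longrightarrow> D a \<bullet> z \<le> 0"
    "\<And>a. a \<in> R' - R0 \<Longrightarrow> D a \<bullet> a < 0" by (metis inner_minus_right neg_0_less_iff_less)
  \<comment> \<open>Each summand is negative on its own generator and nonpositive on all
    others.\<close>
  define d where "d = (\<Sum>a\<in>R' - R0. D a)"
  have dle: "d \<bullet> z \<le> 0" if "z \<in> convex_cone hull R'" for z
    unfolding d_def inner_sum_left using D(1) that by (intro sum_nonpos) auto
  have dneg: "d \<bullet> a < 0" if a: "a \<in> R' - R0" for a
  proof -
    have "d \<bullet> a = D a \<bullet> a + (\<Sum>b\<in>R' - R0 - {a}. D b \<bullet> a)"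
      unfolding d_def inner_sum_left using finR' a by (intro sum.remove) auto
    moreover have "(\<Sum>b\<in>R' - R0 - {a}. D b \<bullet> a) \<le> 0"
      using a D(1) by (intro sum_nonpos) (auto simp: hull_inc)
    ultimately show ?thesis using D(2)[OF a] by simp
  qed
  have "d \<bullet> z \<le> d \<bullet> q" if "z \<in> P" for z
    using dle[of "z - q"] in_tangent_cone[OF that, of q] R'(2) by (simp add: inner_diff_right)
  then obtain b where b: "b \<in> P \<inter> L" "d \<bullet> b = d \<bullet> q" using sup[OF q] by blast
  have "b - q \<in> convex_cone hull R'" using in_tangent_cone[of b P q] b(1) R'(2) by auto
  then obtain u where u: "b - q = (\<Sum>a\<in>R'. u a *\<^sub>R a)" "\<forall>a\<in>R'. 0 \<le> u a"
    by (auto simp: convex_cone_hull_finite[OF finR'])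
  have "(\<Sum>a\<in>R'. u a * (d \<bullet> a)) = 0"
    using b(2) arg_cong[OF u(1), of "\<lambda>x. d \<bullet> x"] by (simp add: inner_sum_right inner_diff_right)
  moreover have "u a * (d \<bullet> a) \<le> 0" if "a \<in> R'" for a
    using u(2) dle[of a] that by (auto simp: hull_inc intro!: mult_nonneg_nonpos)
  ultimately have "\<forall>a\<in>R'. u a * (d \<bullet> a) = 0"
    using sum_nonneg_eq_0_iff[of R' "\<lambda>a. - (u a * (d \<bullet> a))"] finR' by (simp add: sum_negf)
  then have "u a = 0" if "a \<in> R' - R0" for a using dneg[OF that] that by force
  then have u0: "b - q = (\<Sum>a\<in>R0. u a *\<^sub>R a)"
    unfolding u(1) using finR' by (intro sum.mono_neutral_right) (auto simp: R0_def)
  have "b - (\<Sum>a\<in>F. u a *\<^sub>R a) \<in> convex hull (P \<inter> L)" if "finite F" "F \<subseteq> R0" for F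
    using that
  proof (induction F)
    case empty
    then show ?case using b(1) by (simp add: hull_inc)
  next
    case (insert a F)
    then have "(b - (\<Sum>a\<in>F. u a *\<^sub>R a)) + (- u a) *\<^sub>R a \<in> convex hull (P \<inter> L)" by (intro move) auto
    then show ?case using insert by (simp add: algebra_simps)
  qed
  from this[of R0] have "b - (b - q) \<in> convex hull (P \<inter> L)"
    using finR' u0 by (simp add: R0_def)
  then show ?thesis by simp
qed

text \<open>A minimal face of \<open>P\<close> may be an affine subspace without vertices. Hence
  \<open>q\<close> is moved along a two-sided root to the ends of its line in \<open>P\<close>,
  where the induction hypothesis applies. If only one end exists, \<open>q\<close> is recovered from
  it along the opposite ray by \<open>hull_lattice_ray\<close>, since \<open>L\<close> is stable
  under adding roots.\<close>

lemma root_tangent_integral: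
  fixes P :: "'b::euclidean_space set"
  assumes fin: "finite R" and N: "cone_normals R N" and P: "root_tangent R P"
    and L: "\<And>z a. \<lbrakk>z \<in> L; a \<in> R\<rbrakk> \<Longrightarrow> z + a \<in> L \<and> z - a \<in> L"
    and sup: "\<And>d q. \<lbrakk>q \<in> P; \<And>z. z \<in> P \<Longrightarrow> d \<bullet> z \<le> d \<bullet> q\<rbrakk> \<Longrightarrow> \<exists>b\<in>P \<inter> L. d \<bullet> b = d \<bullet> q"
  shows "P = convex hull (P \<inter> L)"
proof
  have P': "closed P" "convex P" using P by (auto simp: root_tangent_def)
  show "convex hull (P \<inter> L) \<subseteq> P" using P'(2) by (intro hull_minimal) auto
  have "q \<in> convex hull (P \<inter> L)" if "q \<in> P" for q
    using that
  proof (induction "card (two_sided R P q)" arbitrary: q rule: less_induct)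
    case less
    show ?case
    proof (cases "\<forall>a\<in>two_sided R P q. \<forall>t. q + t *\<^sub>R a \<in> P")
      case True
      show ?thesis
      proof (rule root_tangent_terminal[OF fin N P less.prems])
        show "z + a \<in> L \<and> z - a \<in> L" if "z \<in> L" "a \<in> R" for z a using that by (rule L)
        show "\<exists>b\<in>P \<inter> L. d \<bullet> b = d \<bullet> w" if "w \<in> P" "\<And>z. z \<in> P \<Longrightarrow> d \<bullet> z \<le> d \<bullet> w" for d w
          using that by (rule sup)
        show "q + t *\<^sub>R a \<in> P" if "a \<in> two_sided R P q" for a t using True that by blast
      qed
    next
      case False
      then obtain a t0 where a: "a \<in> two_sided R P q" and t0: "q + t0 *\<^sub>R a \<notin> P" by blast
      have aR: "a \<in> R" using a by (simp add: two_sided_def)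
      have end_in: "\<exists>t\<ge>0. q + t *\<^sub>R (s *\<^sub>R a) \<in> convex hull (P \<inter> L)"
        if s: "s = 1 \<or> s = - 1" and ex: "\<exists>t\<ge>0. q + t *\<^sub>R (s *\<^sub>R a) \<notin> P" for s
      proof -
        obtain t where t: "t \<ge> 0" "q + t *\<^sub>R (s *\<^sub>R a) \<in> P" "\<And>u. u > t \<Longrightarrow> q + u *\<^sub>R (s *\<^sub>R a) \<notin> P"
          by (rule closed_convex_endpoint[OF P' less.prems ex]) blast
        have "q + t *\<^sub>R (s *\<^sub>R a) \<in> convex hull (P \<inter> L)"
          using less.hyps[OF two_sided_endpoint[OF P'(2) fin a s t] t(2)] .
        then show ?thesis using t(1) by blast
      qed
      have opposite: "q \<in> convex hull (P \<inter> L)"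
        if s: "s = 1 \<or> s = - 1" and ex: "\<exists>t\<ge>0. q + t *\<^sub>R (s *\<^sub>R a) \<notin> P" for s
      proof -
        obtain t where t: "t \<ge> 0" "q + t *\<^sub>R (s *\<^sub>R a) \<in> convex hull (P \<inter> L)"
          using end_in[OF s ex] by blast
        have s': "- s = 1 \<or> - s = - 1" using s by auto
        show ?thesis
        proof (cases "\<exists>t\<ge>0. q + t *\<^sub>R ((- s) *\<^sub>R a) \<notin> P")
          case True
          obtain u where u: "u \<ge> 0" "q + u *\<^sub>R ((- s) *\<^sub>R a) \<in> convex hull (P \<inter> L)"
            using end_in[OF s' True] by blast
          then have "q + (- u) *\<^sub>R (s *\<^sub>R a) \<in> convex hull (P \<inter> L)" by simp
          then have "q + 0 *\<^sub>R (s *\<^sub>R a) \<in> convex hull (P \<inter> L)"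
            by (rule convex_between[OF convex_convex_hull _ t(2)]) (use t(1) u(1) in auto)
          then show ?thesis by simp
        next
          case False
          then have ln: "q + t *\<^sub>R ((- s) *\<^sub>R a) \<in> P" if "t \<ge> 0" for t using that by blast
          have "z + t *\<^sub>R ((- s) *\<^sub>R a) \<in> P" if "z \<in> P" "t \<ge> 0" for z t
            by (rule closed_convex_ray[OF P' ln that])
          moreover have "z + (- s) *\<^sub>R a \<in> L" if "z \<in> L" for z using L[OF that aR] s by auto
          ultimately have "(q + t *\<^sub>R (s *\<^sub>R a)) + t *\<^sub>R ((- s) *\<^sub>R a) \<in> convex hull (P \<inter> L)"
            by (rule hull_lattice_ray[OF _ _ t(2,1)])
          then show ?thesis by simp
        qed
      qed
      show ?thesis
      proof (cases "t0 \<ge> 0")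
        case True
        then show ?thesis using opposite[of 1] t0 by auto
      next
        case False
        then have "\<exists>t\<ge>0. q + t *\<^sub>R ((- 1) *\<^sub>R a) \<notin> P" using t0 by (intro exI[of _ "- t0"]) auto
        then show ?thesis using opposite[of "- 1"] by blast
      qed
    qed
  qed
  then show "P \<subseteq> convex hull (P \<inter> L)" by blast
qed

subsection \<open>The Riesz isomorphism\<close>

abbreviation dualv :: "'a::euclidean_space \<Rightarrow> 'a dual" where
  "dualv \<equiv> blinfun_inner_right"

lemma dualv_apply: "blinfun_apply (dualv v) x = v \<bullet> x"
  by (simp add: blinfun_inner_right.rep_eq)

lemma riesz_dualv: "riesz (dualv v) = v"
proof -
  have "\<forall>x. riesz (dualv v) \<bullet> x = v \<bullet> x"
    by (simp add: blinfun_apply_eq_riesz[symmetric] dualv_apply)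
  then show ?thesis by (simp only: vector_eq_rdot)
qed

lemma dualv_riesz: "dualv (riesz p) = p"
  by (rule blinfun_eqI) (simp add: dualv_apply blinfun_apply_eq_riesz)

lemma bounded_linear_dualv: "bounded_linear dualv"
  by (rule bounded_linear_blinfun_inner_right)

lemma riesz_image: "riesz ` S = {v. dualv v \<in> S}"
  by (auto simp: dualv_riesz) (metis image_eqI riesz_dualv)

lemma linear_dualv: "linear dualv"
  using bounded_linear_dualv by (rule bounded_linear.linear)

lemma bounded_linear_riesz: "bounded_linear riesz"
proof (rule bounded_linear_intro[where K = 1])
  fix p q :: "'a dual"
  have "riesz (dualv (riesz p + riesz q)) = riesz p + riesz q" by (rule riesz_dualv)
  then show "riesz (p + q) = riesz p + riesz q"
    by (simp only: linear_add[OF linear_dualv] dualv_riesz)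
next
  fix c and p :: "'a dual"
  have "riesz (dualv (c *\<^sub>R riesz p)) = c *\<^sub>R riesz p" by (rule riesz_dualv)
  then show "riesz (c *\<^sub>R p) = c *\<^sub>R riesz p"
    by (simp only: linear_scale[OF linear_dualv] dualv_riesz)
next
  fix p :: "'a dual"
  have "(norm (riesz p))\<^sup>2 = (norm p)\<^sup>2"
    using dual_inner_self[of p] by (simp add: dual_inner_def power2_norm_eq_inner)
  then show "norm (riesz p) \<le> norm p * 1" by simp
qed

lemma linear_riesz: "linear riesz"
  using bounded_linear_riesz by (rule bounded_linear.linear)

lemma inj_riesz: "inj riesz"
  by (metis dualv_riesz injI)

lemma riesz_eq_0_iff: "riesz p = 0 \<longleftrightarrow> p = 0"
  using inj_riesz linear_0[OF linear_riesz] by (metis injD)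

lemma closure_linear_bij:
  assumes "bounded_linear f" "bounded_linear g" "\<And>x. f (g x) = x" "\<And>x. g (f x) = x"
  shows "closure (f ` S) = f ` closure S"
proof
  show "f ` closure S \<subseteq> closure (f ` S)" by (rule closure_bounded_linear_image_subset[OF assms(1)])
  have "g ` closure (f ` S) \<subseteq> closure (g ` f ` S)" by (rule closure_bounded_linear_image_subset[OF assms(2)])
  then have "g ` closure (f ` S) \<subseteq> closure S" by (simp add: image_image assms(4))
  then have "f ` g ` closure (f ` S) \<subseteq> f ` closure S" by (rule image_mono)
  then show "closure (f ` S) \<subseteq> f ` closure S" using assms(3) by (simp add: image_image)
qed

lemma tangent_cone_riesz: "tangent_cone (riesz ` S) (riesz p) = riesz ` tangent_cone S p"
proof -
  have "(\<lambda>q. q - riesz p) ` (riesz ` S) = riesz ` ((\<lambda>q. q - p) ` S)"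
    by (simp add: image_image linear_diff[OF linear_riesz])
  then show ?thesis
    unfolding tangent_cone_def
    by (simp add: convex_cone_hull_linear_image[OF linear_riesz]
        closure_linear_bij[OF bounded_linear_riesz bounded_linear_dualv riesz_dualv dualv_riesz])
qed

lemma riesz_image_eq_iff: "riesz ` A = riesz ` B \<longleftrightarrow> A = B"
  using inj_riesz by (rule inj_image_eq_iff)

lemma integral_M_convex_polyhedron_riesz:
  "integral_M_convex_polyhedron \<Phi> S \<longleftrightarrow> root_tangent (riesz ` \<Phi>) (riesz ` S) \<and>
     riesz ` S = convex hull (riesz ` S \<inter> riesz ` root_lattice \<Phi>)"
proof -
  have "closed (riesz ` S) \<longleftrightarrow> closed S"
    unfolding closure_eq[symmetric]
      closure_linear_bij[OF bounded_linear_riesz bounded_linear_dualv riesz_dualv dualv_riesz]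
    by (rule riesz_image_eq_iff)
  moreover have "convex (riesz ` S) \<longleftrightarrow> convex S"
    by (rule convex_linear_image_eq[OF linear_riesz inj_riesz])
  moreover have "M_convex_cone \<Phi> C \<longleftrightarrow> (\<exists>R'\<subseteq>riesz ` \<Phi>. riesz ` C = convex_cone hull R')" for C
  proof -
    have "(\<exists>R'\<subseteq>riesz ` \<Phi>. riesz ` C = convex_cone hull R') \<longleftrightarrow>
        (\<exists>\<Phi>'\<subseteq>\<Phi>. riesz ` C = convex_cone hull (riesz ` \<Phi>'))"
      by (auto simp: subset_image_iff)
    then show ?thesis
      unfolding M_convex_cone_def convex_cone_hull_linear_image[OF linear_riesz] riesz_image_eq_iff
      by blast
  qed
  moreover have "riesz ` S = convex hull (riesz ` S \<inter> riesz ` root_lattice \<Phi>) \<longleftrightarrow>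
      S = convex hull (S \<inter> root_lattice \<Phi>)"
    by (simp only: image_Int[OF inj_riesz, symmetric] convex_hull_linear_image[OF linear_riesz, symmetric] riesz_image_eq_iff)
  ultimately show ?thesis
    unfolding integral_M_convex_polyhedron_def M_convex_polyhedron_def root_tangent_def
    by (auto simp: tangent_cone_riesz)
qed

text \<open>A polytope is the hull of a finite set, which involves neither norm nor inner product,
  so any linear bijection transports the notion.\<close>

lemma locally_polyhedral_linear_bij:
  fixes f :: "'b::real_vector \<Rightarrow> 'c::real_vector"
  assumes "linear f" "linear g" "\<And>x. f (g x) = x" "\<And>x. g (f x) = x" "locally_polyhedral S"
  shows "locally_polyhedral (f ` S)"
  unfolding locally_polyhedral_def
proof (intro conjI allI impI)
  show "convex (f ` S)"
    using assms(5) by (intro convex_linear_image assms(1)) (simp add: locally_polyhedral_def)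
  fix Q :: "'c set" assume "polytope Q"
  then obtain W where W: "finite W" "Q = convex hull W" by (auto simp: polytope_def)
  have "g ` Q = convex hull (g ` W)" by (simp add: W convex_hull_linear_image[OF assms(2)])
  then have "polytope (g ` Q)" using W(1) by (auto simp: polytope_def)
  then have "polytope (S \<inter> g ` Q)" using assms(5) unfolding locally_polyhedral_def by blast
  then obtain U where U: "finite U" "S \<inter> g ` Q = convex hull U" by (auto simp: polytope_def)
  have "f ` S \<inter> Q = f ` (S \<inter> g ` Q)"
  proof (intro equalityI subsetI)
    fix y assume y: "y \<in> f ` S \<inter> Q"
    then obtain x where x: "x \<in> S" "y = f x" by blast
    then have "x \<in> g ` Q" using y assms(4) by (metis IntD2 image_eqI)
    then show "y \<in> f ` (S \<inter> g ` Q)" using x by blast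
  qed (use assms(3) in auto)
  also have "\<dots> = convex hull (f ` U)" by (simp add: U convex_hull_linear_image[OF assms(1)])
  finally show "polytope (f ` S \<inter> Q)" using U(1) by (auto simp: polytope_def)
qed

lemma locally_polyhedral_epi_riesz:
  "locally_polyhedral (epi (\<lambda>p. h (riesz p))) \<longleftrightarrow> locally_polyhedral (epi h)"
proof -
  define f where "f = (\<lambda>z :: 'a \<times> real. (dualv (fst z), snd z))"
  define g where "g = (\<lambda>z :: 'a dual \<times> real. (riesz (fst z), snd z))"
  have lin: "linear f" "linear g"
    unfolding f_def g_def
    by (auto intro!: linearI simp: linear_add[OF linear_dualv] linear_scale[OF linear_dualv]
        linear_add[OF linear_riesz] linear_scale[OF linear_riesz])
  have inv: "f (g z) = z" "g (f w) = w" for z w by (auto simp: f_def g_def dualv_riesz riesz_dualv)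
  have "z \<in> f ` epi h \<longleftrightarrow> z \<in> epi (\<lambda>p. h (riesz p))" for z
  proof -
    have "z \<in> f ` epi h \<longleftrightarrow> g z \<in> epi h" using inv by (metis image_iff)
    then show ?thesis by (simp add: g_def epi_def case_prod_unfold)
  qed
  then have e1: "f ` epi h = epi (\<lambda>p. h (riesz p))" by blast
  then have e2: "g ` epi (\<lambda>p. h (riesz p)) = epi h" using inv by (auto simp: image_image simp flip: e1)
  show ?thesis
    using locally_polyhedral_linear_bij[OF lin inv, of "epi h"]
      locally_polyhedral_linear_bij[OF lin(2,1) inv(2,1), of "epi (\<lambda>p. h (riesz p))"] e1 e2 by auto
qed

lemma dir_deriv_riesz: "dir_deriv (\<lambda>p. h (riesz p)) p d = dir_deriv h (riesz p) (riesz d)"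
  by (simp add: dir_deriv_def linear_add[OF linear_riesz] linear_scale[OF linear_riesz])

lemma all_riesz: "(\<forall>q. P (riesz q)) \<longleftrightarrow> (\<forall>v. P v)"
proof
  assume P: "\<forall>q. P (riesz q)"
  show "\<forall>v. P v"
  proof
    show "P v" for v using spec[OF P, of "dualv v"] by (simp add: riesz_dualv)
  qed
qed simp

lemma argmin_riesz: "argmin_set (\<lambda>p. h (riesz p) - ereal (blinfun_apply p x)) =
    dualv ` argmin_set (\<lambda>p. h p - ereal (x \<bullet> p))"
proof (rule set_eqI)
  fix p
  have "p \<in> argmin_set (\<lambda>p. h (riesz p) - ereal (blinfun_apply p x)) \<longleftrightarrow>
      riesz p \<in> argmin_set (\<lambda>p. h p - ereal (x \<bullet> p))"
    using all_riesz[of "\<lambda>q. h (riesz p) - ereal (x \<bullet> riesz p) \<le> h q - ereal (x \<bullet> q)"]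
    by (simp add: argmin_set_def blinfun_apply_eq_riesz inner_commute)
  also have "\<dots> \<longleftrightarrow> p \<in> dualv ` argmin_set (\<lambda>p. h p - ereal (x \<bullet> p))"
  proof
    assume "riesz p \<in> argmin_set (\<lambda>p. h p - ereal (x \<bullet> p))"
    then have "dualv (riesz p) \<in> dualv ` argmin_set (\<lambda>p. h p - ereal (x \<bullet> p))" by (rule imageI)
    then show "p \<in> dualv ` argmin_set (\<lambda>p. h p - ereal (x \<bullet> p))" by (simp only: dualv_riesz)
  qed (auto simp: riesz_dualv)
  finally show "p \<in> argmin_set (\<lambda>p. h (riesz p) - ereal (blinfun_apply p x)) \<longleftrightarrow>
      p \<in> dualv ` argmin_set (\<lambda>p. h p - ereal (x \<bullet> p))" .
qed

subsection \<open>Roots, lattice points and vertices\<close>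

lemma span_riesz_roots: "essential \<Phi> \<Longrightarrow> span (riesz ` \<Phi>) = UNIV"
  unfolding essential_def
  by (simp add: linear_span_image[OF linear_riesz]) (metis riesz_dualv surjI)

text \<open>The coroots play the part of \<open>C\<close>: they are nonzero multiples of the Riesz
  vectors of the roots and so span, and the integrality axiom of root systems makes the pairings
  integers.\<close>

lemma root_cone_normals:
  assumes "root_system \<Phi>" "essential \<Phi>"
  obtains N where "cone_normals (riesz ` \<Phi>) N"
proof -
  have rs: "finite \<Phi>" "0 \<notin> \<Phi>" "\<And>\<alpha> \<beta>. \<lbrakk>\<alpha> \<in> \<Phi>; \<beta> \<in> \<Phi>\<rbrakk> \<Longrightarrow> blinfun_apply \<alpha> (coroot \<beta>) \<in> \<int>"
    using assms(1) by (auto simp: root_system_def)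
  have "riesz ` \<Phi> \<subseteq> span (coroot ` \<Phi>)"
  proof
    fix v assume "v \<in> riesz ` \<Phi>"
    then obtain \<alpha> where \<alpha>: "\<alpha> \<in> \<Phi>" "v = riesz \<alpha>" by blast
    have "dual_inner \<alpha> \<alpha> \<noteq> 0" using \<alpha> rs(2) by (auto simp: dual_inner_self)
    then have "v = (dual_inner \<alpha> \<alpha> / 2) *\<^sub>R coroot \<alpha>" by (simp add: coroot_def \<alpha>)
    then show "v \<in> span (coroot ` \<Phi>)" using \<alpha> by (simp add: span_base span_scale)
  qed
  then have "span (coroot ` \<Phi>) = UNIV"
    using span_riesz_roots[OF assms(2)] span_minimal[OF _ subspace_span] by blast
  then show ?thesis
  proof (rule cone_normals_exist[OF _ span_riesz_roots[OF assms(2)] _ _ _ that, rotated 2])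
    show "a \<bullet> c \<in> \<int>" if "a \<in> riesz ` \<Phi>" "c \<in> coroot ` \<Phi>" for a c
      using that rs(3) by (auto simp: blinfun_apply_eq_riesz)
  qed (use rs(1) in auto)
qed

lemma root_lattice_step:
  assumes "finite \<Phi>" "z \<in> root_lattice \<Phi>" "\<alpha> \<in> \<Phi>"
  shows "z + \<alpha> \<in> root_lattice \<Phi> \<and> z - \<alpha> \<in> root_lattice \<Phi>"
proof -
  obtain c where c: "z = (\<Sum>\<beta>\<in>\<Phi>. of_int (c \<beta>) *\<^sub>R \<beta>)" using assms(2) by (auto simp: root_lattice_def)
  have *: "z + of_int k *\<^sub>R \<alpha> \<in> root_lattice \<Phi>" for k
  proof -
    have "(\<Sum>\<beta>\<in>\<Phi>. of_int (if \<beta> = \<alpha> then k else 0) *\<^sub>R \<beta>) = of_int k *\<^sub>R \<alpha>"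
    proof -
      have "(\<Sum>\<beta>\<in>\<Phi>. of_int (if \<beta> = \<alpha> then k else 0) *\<^sub>R \<beta>) = (\<Sum>\<beta>\<in>\<Phi>. if \<beta> = \<alpha> then of_int k *\<^sub>R \<alpha> else 0)"
        by (intro sum.cong) auto
      then show ?thesis using assms(1,3) by simp
    qed
    moreover define c' where "c' \<beta> = c \<beta> + (if \<beta> = \<alpha> then k else 0)" for \<beta>
    ultimately have "z + of_int k *\<^sub>R \<alpha> = (\<Sum>\<beta>\<in>\<Phi>. of_int (c' \<beta>) *\<^sub>R \<beta>)"
      by (simp only: c c'_def of_int_add scaleR_left_distrib sum.distrib)
    then show ?thesis by (auto simp: root_lattice_def)
  qed
  from *[of 1] *[of "- 1"] show ?thesis by simp
qed

lemma root_lattice_integral: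
  assumes "\<And>\<alpha>. \<alpha> \<in> \<Phi> \<Longrightarrow> n \<bullet> riesz \<alpha> \<in> \<int>" "z \<in> riesz ` root_lattice \<Phi>"
  shows "n \<bullet> z \<in> \<int>"
proof -
  obtain c :: "'a dual \<Rightarrow> int" where "z = riesz (\<Sum>\<beta>\<in>\<Phi>. of_int (c \<beta>) *\<^sub>R \<beta>)"
    using assms(2) by (auto simp: root_lattice_def)
  then have "z = (\<Sum>\<beta>\<in>\<Phi>. of_int (c \<beta>) *\<^sub>R riesz \<beta>)"
    by (simp add: linear_sum[OF linear_riesz] linear_scale[OF linear_riesz])
  then show ?thesis using assms(1)
    by (auto simp: inner_sum_right intro!: Ints_sum Ints_mult)
qed

lemma integral_L_convex_polyhedron_saturated:
  assumes "integral_L_convex_polyhedron \<Phi> S"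
  shows "cell_saturated (riesz ` \<Phi>) S"
  unfolding cell_saturated_def
proof (intro ballI subsetI)
  fix x y assume x: "x \<in> S" and y: "y \<in> cell (riesz ` \<Phi>) x"
  obtain \<gamma> where \<gamma>: "\<And>\<alpha>. \<alpha> \<in> \<Phi> \<Longrightarrow> \<gamma> \<alpha> \<in> Z_inf" "S = gamma_polyhedron \<Phi> \<gamma>"
    using assms by (auto simp: integral_L_convex_polyhedron_def)
  have "ereal (blinfun_apply \<alpha> y) \<le> \<gamma> \<alpha>" if \<alpha>: "\<alpha> \<in> \<Phi>" for \<alpha>
  proof (cases "\<gamma> \<alpha> = \<infinity>")
    case False
    then obtain k :: int where k: "\<gamma> \<alpha> = ereal (of_int k)" using \<gamma>(1)[OF \<alpha>] by (auto simp: Z_inf_def)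
    have "riesz \<alpha> \<bullet> x \<le> of_int k"
      using x \<alpha> k by (auto simp: \<gamma>(2) gamma_polyhedron_def blinfun_apply_eq_riesz)
    then have "real_of_int \<lceil>riesz \<alpha> \<bullet> x\<rceil> \<le> of_int k" by (simp add: ceiling_le_iff)
    moreover have "riesz \<alpha> \<bullet> y \<le> of_int \<lceil>riesz \<alpha> \<bullet> x\<rceil>" using y \<alpha> by (auto simp: cell_def)
    ultimately show ?thesis by (simp add: k blinfun_apply_eq_riesz)
  qed simp
  then show "y \<in> S" by (simp add: \<gamma>(2) gamma_polyhedron_def)
qed

section \<open>Bounded cells and their extreme points\<close>

lemma bounded_cell:
  fixes R :: "'b::euclidean_space set"
  assumes "span R = UNIV"
  shows "bounded (cell R x)"
proof -
  \<comment> \<open>The functionals bounded on the cell form a subspace; containing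
    \<open>R\<close>, it is everything.\<close>
  define T where "T = {v. \<exists>B. \<forall>y\<in>cell R x. \<bar>v \<bullet> y\<bar> \<le> B}"
  have "subspace T"
    unfolding subspace_def
  proof (intro conjI ballI allI)
    show "0 \<in> T" by (auto simp: T_def intro: exI[of _ 0])
    show "v + w \<in> T" if vw: "v \<in> T" "w \<in> T" for v w
    proof -
      obtain A B where "\<forall>y\<in>cell R x. \<bar>v \<bullet> y\<bar> \<le> A" "\<forall>y\<in>cell R x. \<bar>w \<bullet> y\<bar> \<le> B"
        using vw by (auto simp: T_def)
      then have "\<forall>y\<in>cell R x. \<bar>(v + w) \<bullet> y\<bar> \<le> A + B"
        by (fastforce simp: inner_add_left intro: order_trans[OF abs_triangle_ineq add_mono])
      then show ?thesis by (auto simp: T_def)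
    qed
    show "c *\<^sub>R v \<in> T" if v: "v \<in> T" for c v
    proof -
      obtain A where "\<forall>y\<in>cell R x. \<bar>v \<bullet> y\<bar> \<le> A" using v by (auto simp: T_def)
      then have "\<forall>y\<in>cell R x. \<bar>(c *\<^sub>R v) \<bullet> y\<bar> \<le> \<bar>c\<bar> * A"
        by (auto simp: abs_mult intro: mult_left_mono)
      then show ?thesis by (auto simp: T_def)
    qed
  qed
  moreover have "R \<subseteq> T"
  proof
    fix n assume n: "n \<in> R"
    have "\<bar>n \<bullet> y\<bar> \<le> \<bar>n \<bullet> x\<bar> + 1" if "y \<in> cell R x" for y
    proof -
      have "of_int \<lfloor>n \<bullet> x\<rfloor> \<le> n \<bullet> y" "n \<bullet> y \<le> of_int \<lceil>n \<bullet> x\<rceil>" using that n by (auto simp: cell_def)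
      then show ?thesis by linarith
    qed
    then show "n \<in> T" by (auto simp: T_def)
  qed
  ultimately have "T = UNIV" using span_minimal[of R T] assms by blast
  then have "\<forall>b\<in>Basis. \<exists>B. \<forall>y\<in>cell R x. \<bar>b \<bullet> y\<bar> \<le> B" by (auto simp: T_def)
  then obtain B where B: "\<And>b y. \<lbrakk>b \<in> Basis; y \<in> cell R x\<rbrakk> \<Longrightarrow> \<bar>b \<bullet> y\<bar> \<le> B b" by metis
  have "norm y \<le> (\<Sum>b\<in>Basis. B b)" if "y \<in> cell R x" for y
    using B that by (intro order_trans[OF norm_le_l1] sum_mono) (auto simp: inner_commute)
  then show ?thesis by (auto simp: bounded_iff)
qed

text \<open>An inequality of the cell can be tight at \<open>e\<close> only if its root has an
  integer value there. If \<open>d\<close> is orthogonal to all such roots, a short segment about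
  \<open>e\<close> in direction \<open>d\<close> stays in the cell, which is impossible at an
  extreme point unless \<open>d = 0\<close>.\<close>

lemma extreme_point_of_cell:
  fixes R :: "'b::euclidean_space set"
  assumes "finite R" "e extreme_point_of cell R x" "\<And>a. \<lbrakk>a \<in> R; a \<bullet> e \<in> \<int>\<rbrakk> \<Longrightarrow> d \<bullet> a = 0"
  shows "d = 0"
proof (rule ccontr)
  assume "d \<noteq> 0"
  have e: "e \<in> cell R x" using assms(2) by (simp add: extreme_point_of_def)
  have ev: "\<forall>\<^sub>F t in at_right 0. \<forall>a\<in>R. of_int \<lfloor>a \<bullet> x\<rfloor> \<le> a \<bullet> (e + t *\<^sub>R v) \<and> a \<bullet> (e + t *\<^sub>R v) \<le> of_int \<lceil>a \<bullet> x\<rceil>"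
    if v: "v = d \<or> v = - d" for v
  proof (rule eventually_ball_finite[OF assms(1)], rule ballI)
    fix a assume a: "a \<in> R"
    have b: "of_int \<lfloor>a \<bullet> x\<rfloor> \<le> a \<bullet> e" "a \<bullet> e \<le> of_int \<lceil>a \<bullet> x\<rceil>" using e a by (auto simp: cell_def)
    show "\<forall>\<^sub>F t in at_right 0. of_int \<lfloor>a \<bullet> x\<rfloor> \<le> a \<bullet> (e + t *\<^sub>R v) \<and> a \<bullet> (e + t *\<^sub>R v) \<le> of_int \<lceil>a \<bullet> x\<rceil>"
    proof (cases "a \<bullet> e \<in> \<int>")
      case True
      then have "a \<bullet> v = 0" using assms(3)[OF a] v by (auto simp: inner_commute)
      then show ?thesis using b by (simp add: inner_add_right)
    next
      case False
      then have s: "of_int \<lfloor>a \<bullet> x\<rfloor> < a \<bullet> e" "a \<bullet> e < of_int \<lceil>a \<bullet> x\<rceil>"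
        using b by (metis Ints_of_int order_le_less)+
      have "((\<lambda>t. a \<bullet> (e + t *\<^sub>R v)) \<longlongrightarrow> a \<bullet> (e + 0 *\<^sub>R v)) (at_right 0)" by (intro tendsto_intros)
      then have "\<forall>\<^sub>F t in at_right 0. of_int \<lfloor>a \<bullet> x\<rfloor> < a \<bullet> (e + t *\<^sub>R v)"
        "\<forall>\<^sub>F t in at_right 0. a \<bullet> (e + t *\<^sub>R v) < of_int \<lceil>a \<bullet> x\<rceil>"
        using s by (auto intro: order_tendstoD)
      then show ?thesis by eventually_elim auto
    qed
  qed
  have "\<forall>\<^sub>F t in at_right (0::real). t > 0" by (simp add: eventually_at_right_less)
  then have "\<forall>\<^sub>F t in at_right (0::real). t > 0 \<and>
      (\<forall>a\<in>R. of_int \<lfloor>a \<bullet> x\<rfloor> \<le> a \<bullet> (e + t *\<^sub>R d) \<and> a \<bullet> (e + t *\<^sub>R d) \<le> of_int \<lceil>a \<bullet> x\<rceil>) \<and>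
      (\<forall>a\<in>R. of_int \<lfloor>a \<bullet> x\<rfloor> \<le> a \<bullet> (e + t *\<^sub>R (- d)) \<and> a \<bullet> (e + t *\<^sub>R (- d)) \<le> of_int \<lceil>a \<bullet> x\<rceil>)"
    by (intro eventually_conj ev) simp_all
  from eventually_happens'[OF trivial_limit_at_right_real this]
  obtain t :: real where t: "t > 0" "e + t *\<^sub>R d \<in> cell R x" "e + t *\<^sub>R (- d) \<in> cell R x"
    unfolding cell_def by blast
  have "e = midpoint (e + t *\<^sub>R d) (e + t *\<^sub>R (- d))" by (simp add: midpoint_def algebra_simps scaleR_2[symmetric])
  moreover have "e + t *\<^sub>R d \<noteq> e + t *\<^sub>R (- d)"
    using t(1) \<open>d \<noteq> 0\<close> by (auto simp: algebra_simps scaleR_2[symmetric] simp flip: scaleR_add_left)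
  ultimately have "e \<in> open_segment (e + t *\<^sub>R d) (e + t *\<^sub>R (- d))"
    by (metis midpoint_in_open_segment)
  then show False using assms(2) t(2,3) by (auto simp: extreme_point_of_def)
qed

text \<open>The hypothesis says that the roots with an integer value at \<open>e\<close> span the dual space.\<close>

lemma coxeter_vertex_if:
  assumes "\<And>d. (\<And>\<alpha>. \<lbrakk>\<alpha> \<in> \<Phi>; blinfun_apply \<alpha> e \<in> \<int>\<rbrakk> \<Longrightarrow> blinfun_apply \<alpha> d = 0) \<Longrightarrow> d = 0"
  shows "e \<in> coxeter_vertices \<Phi>"
proof -
  have "{x. \<forall>\<alpha>\<in>\<Phi>. \<forall>k. sgn (blinfun_apply \<alpha> x - of_int k) = sgn (blinfun_apply \<alpha> e - of_int k)} = {e}"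
  proof (intro equalityI subsetI)
    fix x assume x: "x \<in> {x. \<forall>\<alpha>\<in>\<Phi>. \<forall>k. sgn (blinfun_apply \<alpha> x - of_int k) = sgn (blinfun_apply \<alpha> e - of_int k)}"
    have "x - e = 0"
    proof (rule assms)
      fix \<alpha> assume \<alpha>: "\<alpha> \<in> \<Phi>" "blinfun_apply \<alpha> e \<in> \<int>"
      then obtain k where k: "blinfun_apply \<alpha> e = of_int k" by (auto elim: Ints_cases)
      then have "sgn (blinfun_apply \<alpha> x - of_int k) = 0" using x \<alpha>(1) by auto
      then have "blinfun_apply \<alpha> x = of_int k" by (simp add: sgn_eq_0_iff)
      then show "blinfun_apply \<alpha> (x - e) = 0" by (simp add: k blinfun.diff_right)
    qed
    then show "x \<in> {e}" by simp
  qed auto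
  then have "{e} = {x. \<forall>\<alpha>\<in>\<Phi>. \<forall>k. sgn (blinfun_apply \<alpha> x - of_int k) = sgn (blinfun_apply \<alpha> e - of_int k)}" ..
  then show ?thesis unfolding coxeter_vertices_def coxeter_cells_def
    by (auto intro!: exI[of _ "\<lambda>\<alpha> k. sgn (blinfun_apply \<alpha> e - of_int k)"])
qed

text \<open>The closed cell is compact because the roots span, so it is the hull of its extreme
  points, and by \<open>extreme_point_of_cell\<close> these are vertices of the Coxeter
  complex.\<close>

lemma in_hull_of_cell_vertices:
  assumes "finite \<Phi>" "essential \<Phi>"
  shows "x \<in> convex hull (cell (riesz ` \<Phi>) x \<inter> coxeter_vertices \<Phi>)"
proof -
  define R where "R = riesz ` \<Phi>"
  have "finite R" using assms(1) by (simp add: R_def)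
  have "compact (cell R x)"
    using bounded_cell[OF span_riesz_roots[OF assms(2)]] closed_cell
    by (simp add: compact_eq_bounded_closed R_def)
  then have "x \<in> convex hull {e. e extreme_point_of cell R x}"
    using Krein_Milman_Minkowski[OF _ convex_cell] cell_self by blast
  moreover have "{e. e extreme_point_of cell R x} \<subseteq> cell R x \<inter> coxeter_vertices \<Phi>"
  proof clarify
    fix e assume e: "e extreme_point_of cell R x"
    have "e \<in> coxeter_vertices \<Phi>"
    proof (rule coxeter_vertex_if)
      fix d assume "\<And>\<alpha>. \<lbrakk>\<alpha> \<in> \<Phi>; blinfun_apply \<alpha> e \<in> \<int>\<rbrakk> \<Longrightarrow> blinfun_apply \<alpha> d = 0"
      then show "d = 0"
        by (intro extreme_point_of_cell[OF \<open>finite R\<close> e]) (auto simp: R_def blinfun_apply_eq_riesz inner_commute)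
    qed
    then show "e \<in> cell R x \<inter> coxeter_vertices \<Phi>" using e by (simp add: extreme_point_of_def)
  qed
  ultimately show ?thesis using hull_mono unfolding R_def by blast
qed

subsection \<open>Linear programming duality\<close>

lemma cone_fun_feasible_le:
  assumes "finite \<Phi>" "x \<in> gamma_polyhedron \<Phi> \<gamma>"
    and "\<forall>\<alpha>. \<mu> \<alpha> \<ge> 0" "d = (\<Sum>\<alpha>\<in>{\<alpha>\<in>\<Phi>. \<gamma> \<alpha> < \<infinity>}. \<mu> \<alpha> *\<^sub>R \<alpha>)"
  shows "ereal (blinfun_apply d x) \<le> (\<Sum>\<alpha>\<in>{\<alpha>\<in>\<Phi>. \<gamma> \<alpha> < \<infinity>}. ereal (\<mu> \<alpha>) * \<gamma> \<alpha>)"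
proof -
  have "ereal (blinfun_apply d x) = (\<Sum>\<alpha>\<in>{\<alpha>\<in>\<Phi>. \<gamma> \<alpha> < \<infinity>}. ereal (\<mu> \<alpha> * blinfun_apply \<alpha> x))"
    unfolding assms(4) by (simp add: blinfun.sum_left blinfun.scaleR_left)
  also have "\<dots> \<le> (\<Sum>\<alpha>\<in>{\<alpha>\<in>\<Phi>. \<gamma> \<alpha> < \<infinity>}. ereal (\<mu> \<alpha>) * \<gamma> \<alpha>)"
  proof (rule sum_mono)
    fix \<alpha> assume "\<alpha> \<in> {\<alpha>\<in>\<Phi>. \<gamma> \<alpha> < \<infinity>}"
    then have "ereal (blinfun_apply \<alpha> x) \<le> \<gamma> \<alpha>" using assms(2) by (auto simp: gamma_polyhedron_def)
    then have "ereal (\<mu> \<alpha>) * ereal (blinfun_apply \<alpha> x) \<le> ereal (\<mu> \<alpha>) * \<gamma> \<alpha>"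
      using assms(3) by (intro ereal_mult_left_mono) auto
    then show "ereal (\<mu> \<alpha> * blinfun_apply \<alpha> x) \<le> ereal (\<mu> \<alpha>) * \<gamma> \<alpha>" by simp
  qed
  finally show ?thesis .
qed

lemma cone_fun_ge:
  assumes "finite \<Phi>" "x \<in> gamma_polyhedron \<Phi> \<gamma>"
  shows "ereal (blinfun_apply d x) \<le> cone_fun \<Phi> \<gamma> d"
  unfolding cone_fun_def
proof (rule Inf_greatest)
  fix v assume "v \<in> {\<Sum>\<alpha>\<in>{\<alpha>\<in>\<Phi>. \<gamma> \<alpha> < \<infinity>}. ereal (\<mu> \<alpha>) * \<gamma> \<alpha> | \<mu> :: 'a dual \<Rightarrow> real.
      (\<forall>\<alpha>. \<mu> \<alpha> \<ge> 0) \<and> d = (\<Sum>\<alpha>\<in>{\<alpha>\<in>\<Phi>. \<gamma> \<alpha> < \<infinity>}. \<mu> \<alpha> *\<^sub>R \<alpha>)}"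
  then show "ereal (blinfun_apply d x) \<le> v"
    using cone_fun_feasible_le[OF assms] by blast
qed

lemma cone_fun_root_le:
  assumes "finite \<Phi>" "\<alpha> \<in> \<Phi>"
  shows "cone_fun \<Phi> \<gamma> \<alpha> \<le> \<gamma> \<alpha>"
proof (cases "\<gamma> \<alpha> < \<infinity>")
  case True
  define \<mu> :: "'a dual \<Rightarrow> real" where "\<mu> = (\<lambda>\<beta>. if \<beta> = \<alpha> then 1 else 0)"
  define A where "A = {\<beta>\<in>\<Phi>. \<gamma> \<beta> < \<infinity>}"
  have A: "finite A" "\<alpha> \<in> A" using assms True by (auto simp: A_def)
  have "(\<Sum>\<beta>\<in>A. \<mu> \<beta> *\<^sub>R \<beta>) = (\<Sum>\<beta>\<in>A. if \<beta> = \<alpha> then \<alpha> else 0)"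
    by (intro sum.cong) (auto simp: \<mu>_def)
  moreover have "(\<Sum>\<beta>\<in>A. ereal (\<mu> \<beta>) * \<gamma> \<beta>) = (\<Sum>\<beta>\<in>A. if \<beta> = \<alpha> then \<gamma> \<alpha> else 0)"
    by (intro sum.cong) (auto simp: \<mu>_def one_ereal_def[symmetric] zero_ereal_def[symmetric])
  ultimately have "\<alpha> = (\<Sum>\<beta>\<in>A. \<mu> \<beta> *\<^sub>R \<beta>)" "\<gamma> \<alpha> = (\<Sum>\<beta>\<in>A. ereal (\<mu> \<beta>) * \<gamma> \<beta>)"
    using A by simp_all
  then show ?thesis unfolding cone_fun_def A_def
    by (intro Inf_lower CollectI exI[of _ \<mu>]) (auto simp: \<mu>_def)
qed simp

text \<open>Homogenized Farkas lemma. If \<open>(riesz d, M)\<close> lay outside the cone of the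
  vectors \<open>(riesz \<alpha>, c \<alpha>)\<close> and \<open>(0, 1)\<close>, a separator
  \<open>(n, s)\<close> would have \<open>s \<le> 0\<close>: for \<open>s < 0\<close> the point
  \<open>n / (- s)\<close> is feasible and exceeds the bound, and for \<open>s = 0\<close> the ray
  from \<open>x0\<close> along \<open>n\<close> does so.\<close>

lemma farkas_gamma:
  assumes fin: "finite A" and "0 \<notin> A"
    and x0: "\<And>\<alpha>. \<alpha> \<in> A \<Longrightarrow> riesz \<alpha> \<bullet> x0 \<le> c \<alpha>"
    and M: "\<And>x. (\<And>\<alpha>. \<alpha> \<in> A \<Longrightarrow> riesz \<alpha> \<bullet> x \<le> c \<alpha>) \<Longrightarrow> riesz d \<bullet> x \<le> M"
  obtains \<mu> where "\<And>\<alpha>. \<mu> \<alpha> \<ge> 0" "d = (\<Sum>\<alpha>\<in>A. \<mu> \<alpha> *\<^sub>R \<alpha>)" "(\<Sum>\<alpha>\<in>A. \<mu> \<alpha> * c \<alpha>) \<le> M"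
proof -
  define F where "F \<alpha> = (riesz \<alpha>, c \<alpha>)" for \<alpha>
  define S where "S = insert (0, 1) (F ` A)"
  have finS: "finite S" using fin by (simp add: S_def)
  have injF: "inj_on F A" using inj_riesz by (auto simp: F_def inj_on_def inj_def)
  \<comment> \<open>Keeps the slack generator apart from the others when the sum over
    \<open>S\<close> is split.\<close>
  have nin: "(0, 1) \<notin> F ` A" using assms(2) by (auto simp: F_def riesz_eq_0_iff)
  have "(riesz d, M) \<in> convex_cone hull S"
  proof (rule ccontr)
    assume "(riesz d, M) \<notin> convex_cone hull S"
    then obtain ns where ns: "\<And>z. z \<in> convex_cone hull S \<Longrightarrow> ns \<bullet> z \<le> 0" "ns \<bullet> (riesz d, M) > 0"
      using convex_cone_separation[OF convex_cone_convex_cone_hull closed_convex_cone_hull[OF finS]] by metis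
    obtain n s where nseq: "ns = (n, s)" by force
    have nA: "n \<bullet> riesz \<alpha> + s * c \<alpha> \<le> 0" if "\<alpha> \<in> A" for \<alpha>
      using ns(1)[OF hull_inc, of "F \<alpha>"] that by (simp add: S_def F_def nseq)
    have s: "s \<le> 0" using ns(1)[OF hull_inc, of "(0, 1)"] by (simp add: S_def nseq)
    have nd: "n \<bullet> riesz d + s * M > 0" using ns(2) by (simp add: nseq)
    show False
    proof (cases "s = 0")
      case False
      define x where "x = (1 / (- s)) *\<^sub>R n"
      have xv: "v \<bullet> x = (n \<bullet> v) / (- s)" for v by (simp add: x_def inner_commute)
      have "riesz \<alpha> \<bullet> x \<le> c \<alpha>" if "\<alpha> \<in> A" for \<alpha>
        using nA[OF that] s False unfolding xv by (subst pos_divide_le_eq) (auto simp: mult.commute)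
      then have "riesz d \<bullet> x \<le> M" by (rule M)
      then have "n \<bullet> riesz d \<le> M * (- s)"
        using s False unfolding xv by (subst (asm) pos_divide_le_eq) auto
      then show False using nd by (simp add: mult.commute)
    next
      case True
      define t where "t = (\<bar>M\<bar> + \<bar>riesz d \<bullet> x0\<bar> + 1) / (n \<bullet> riesz d)"
      have pos: "n \<bullet> riesz d > 0" using nd True by simp
      then have t: "t \<ge> 0" unfolding t_def by (intro divide_nonneg_pos) auto
      have "riesz \<alpha> \<bullet> (x0 + t *\<^sub>R n) \<le> c \<alpha>" if "\<alpha> \<in> A" for \<alpha>
      proof -
        have "t * (n \<bullet> riesz \<alpha>) \<le> 0" using nA[OF that] True t by (simp add: mult_nonneg_nonpos)
        then show ?thesis using x0[OF that] by (simp add: inner_add_right inner_commute)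
      qed
      then have "riesz d \<bullet> (x0 + t *\<^sub>R n) \<le> M" by (rule M)
      then have "riesz d \<bullet> x0 + t * (n \<bullet> riesz d) \<le> M"
        by (simp add: inner_add_right inner_commute)
      moreover have "t * (n \<bullet> riesz d) = \<bar>M\<bar> + \<bar>riesz d \<bullet> x0\<bar> + 1" using pos by (simp add: t_def)
      ultimately show False by linarith
    qed
  qed
  then obtain u where u: "(riesz d, M) = (\<Sum>z\<in>S. u z *\<^sub>R z)" "\<forall>z\<in>S. 0 \<le> u z"
    by (auto simp: convex_cone_hull_finite[OF finS])
  \<comment> \<open>Off \<open>A\<close> the sign of \<open>u\<close> is unknown, while nonnegative
    weights are wanted everywhere.\<close>
  define \<mu> where "\<mu> \<alpha> = max 0 (u (F \<alpha>))" for \<alpha>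
  have \<mu>: "\<mu> \<alpha> = u (F \<alpha>)" if "\<alpha> \<in> A" for \<alpha> using u(2) that by (simp add: \<mu>_def S_def)
  have "(\<Sum>z\<in>S. u z *\<^sub>R z) = u (0, 1) *\<^sub>R (0, 1) + (\<Sum>z\<in>F ` A. u z *\<^sub>R z)"
    unfolding S_def using nin fin by simp
  also have "(\<Sum>z\<in>F ` A. u z *\<^sub>R z) = (\<Sum>\<alpha>\<in>A. \<mu> \<alpha> *\<^sub>R F \<alpha>)"
    using \<mu> by (simp add: sum.reindex[OF injF])
  also have "\<dots> = (\<Sum>\<alpha>\<in>A. \<mu> \<alpha> *\<^sub>R riesz \<alpha>, \<Sum>\<alpha>\<in>A. \<mu> \<alpha> * c \<alpha>)"
    by (simp add: F_def sum_prod)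
  finally have eq: "riesz d = (\<Sum>\<alpha>\<in>A. \<mu> \<alpha> *\<^sub>R riesz \<alpha>)" "M = u (0, 1) + (\<Sum>\<alpha>\<in>A. \<mu> \<alpha> * c \<alpha>)"
    using u(1) by auto
  show ?thesis
  proof
    show "\<mu> \<alpha> \<ge> 0" for \<alpha> by (simp add: \<mu>_def)
    have "riesz d = riesz (\<Sum>\<alpha>\<in>A. \<mu> \<alpha> *\<^sub>R \<alpha>)"
      unfolding eq by (simp add: linear_sum[OF linear_riesz] linear_scale[OF linear_riesz])
    then show "d = (\<Sum>\<alpha>\<in>A. \<mu> \<alpha> *\<^sub>R \<alpha>)" by (rule injD[OF inj_riesz])
    show "(\<Sum>\<alpha>\<in>A. \<mu> \<alpha> * c \<alpha>) \<le> M" using eq(2) u(2) by (simp add: S_def)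
  qed
qed

text \<open>Strong duality: a finite supremum is the bound \<open>M\<close> fed to
  \<open>farkas_gamma\<close>, which returns feasible weights of cost at most \<open>M\<close>.
  Integral M-sublinear functions thereby become support functions of integral L-convex
  polyhedra.\<close>

lemma cone_fun_eq_support:
  assumes fin: "finite \<Phi>" and "0 \<notin> \<Phi>" and \<gamma>: "\<And>\<alpha>. \<alpha> \<in> \<Phi> \<Longrightarrow> \<gamma> \<alpha> \<in> Z_inf"
    and ne: "gamma_polyhedron \<Phi> \<gamma> \<noteq> {}"
  shows "cone_fun \<Phi> \<gamma> d = (SUP x\<in>gamma_polyhedron \<Phi> \<gamma>. ereal (riesz d \<bullet> x))"
proof (rule antisym)
  show "(SUP x\<in>gamma_polyhedron \<Phi> \<gamma>. ereal (riesz d \<bullet> x)) \<le> cone_fun \<Phi> \<gamma> d"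
    using cone_fun_ge[OF fin] by (intro SUP_least) (simp add: blinfun_apply_eq_riesz[symmetric])
  define A where "A = {\<alpha>\<in>\<Phi>. \<gamma> \<alpha> < \<infinity>}"
  define c where "c = (\<lambda>\<alpha>. real_of_ereal (\<gamma> \<alpha>))"
  have c: "\<gamma> \<alpha> = ereal (c \<alpha>)" if "\<alpha> \<in> A" for \<alpha>
    using \<gamma>[of \<alpha>] that by (auto simp: A_def c_def Z_inf_def)
  have G: "x \<in> gamma_polyhedron \<Phi> \<gamma> \<longleftrightarrow> (\<forall>\<alpha>\<in>A. riesz \<alpha> \<bullet> x \<le> c \<alpha>)" for x
  proof -
    have "ereal (blinfun_apply \<alpha> x) \<le> \<gamma> \<alpha> \<longleftrightarrow> (\<alpha> \<in> A \<longrightarrow> riesz \<alpha> \<bullet> x \<le> c \<alpha>)" if "\<alpha> \<in> \<Phi>" for \<alpha>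
      using c[of \<alpha>] that by (cases "\<alpha> \<in> A") (auto simp: A_def blinfun_apply_eq_riesz)
    then show ?thesis unfolding gamma_polyhedron_def by (auto simp: A_def)
  qed
  obtain x0 where x0: "x0 \<in> gamma_polyhedron \<Phi> \<gamma>" using ne by blast
  define s where "s = (SUP x\<in>gamma_polyhedron \<Phi> \<gamma>. ereal (riesz d \<bullet> x))"
  have s: "ereal (riesz d \<bullet> x) \<le> s" if "x \<in> gamma_polyhedron \<Phi> \<gamma>" for x
    unfolding s_def using that by (rule SUP_upper)
  show "cone_fun \<Phi> \<gamma> d \<le> s"
  proof (cases s)
    case (real M)
    have "\<exists>\<mu>. (\<forall>\<alpha>. \<mu> \<alpha> \<ge> 0) \<and> d = (\<Sum>\<alpha>\<in>A. \<mu> \<alpha> *\<^sub>R \<alpha>) \<and> (\<Sum>\<alpha>\<in>A. \<mu> \<alpha> * c \<alpha>) \<le> M"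
    proof (rule farkas_gamma[of A x0 c d M])
      show "finite A" "0 \<notin> A" using fin assms(2) by (auto simp: A_def)
      show "riesz \<alpha> \<bullet> x0 \<le> c \<alpha>" if "\<alpha> \<in> A" for \<alpha> using x0 G that by blast
      show "riesz d \<bullet> x \<le> M" if "\<And>\<alpha>. \<alpha> \<in> A \<Longrightarrow> riesz \<alpha> \<bullet> x \<le> c \<alpha>" for x
        using s[of x] that G real by auto
    qed blast
    then obtain \<mu> where \<mu>: "\<forall>\<alpha>. \<mu> \<alpha> \<ge> 0" "d = (\<Sum>\<alpha>\<in>A. \<mu> \<alpha> *\<^sub>R \<alpha>)" "(\<Sum>\<alpha>\<in>A. \<mu> \<alpha> * c \<alpha>) \<le> M" by blast
    have "(\<Sum>\<alpha>\<in>A. ereal (\<mu> \<alpha>) * \<gamma> \<alpha>) = ereal (\<Sum>\<alpha>\<in>A. \<mu> \<alpha> * c \<alpha>)"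
      unfolding sum_ereal[symmetric] using c by (intro sum.cong) auto
    then have "(\<Sum>\<alpha>\<in>A. ereal (\<mu> \<alpha>) * \<gamma> \<alpha>) \<le> s" using \<mu>(3) real by simp
    moreover have "cone_fun \<Phi> \<gamma> d \<le> (\<Sum>\<alpha>\<in>A. ereal (\<mu> \<alpha>) * \<gamma> \<alpha>)"
      unfolding cone_fun_def A_def using \<mu>(1,2) by (intro Inf_lower) (auto simp: A_def)
    ultimately show ?thesis by (rule order_trans[rotated])
  next
    case MInf
    then show ?thesis using s[OF x0] by simp
  qed simp
qed

subsection \<open>From local data to cellwise affine functions\<close>

text \<open>Closedness is local, and inside a box around the limit the set is a polytope.\<close>

lemma locally_polyhedral_imp_closed:
  fixes S :: "'b::euclidean_space set"
  assumes "locally_polyhedral S"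
  shows "closed S"
  unfolding closed_sequential_limits
proof (intro allI impI, elim conjE)
  fix X z assume X: "\<forall>n. X n \<in> S" "X \<longlonglongrightarrow> z"
  obtain a where a: "cball z 1 \<subseteq> cbox (- a) a"
    using bounded_subset_cbox_symmetric[OF bounded_cball] by blast
  have "polytope (S \<inter> cbox (- a) a)"
    using assms polytope_interval[of "- a" a] unfolding locally_polyhedral_def by blast
  then have cl: "closed (S \<inter> cbox (- a) a)" by (rule polytope_imp_closed)
  have "\<forall>\<^sub>F n in sequentially. dist (X n) z < 1" using X(2) by (rule tendstoD) simp
  then have "\<forall>\<^sub>F n in sequentially. X n \<in> S \<inter> cbox (- a) a"
  proof eventually_elim
    case (elim n)
    then have "X n \<in> cball z 1" by (simp add: dist_commute)
    then show ?case using a X(1) by blast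
  qed
  then have "z \<in> S \<inter> cbox (- a) a" using Lim_in_closed_set[OF cl _ _ X(2)] by simp
  then show "z \<in> S" by simp
qed

text \<open>The difference quotients increase with \<open>t\<close>, so the limit exists and is
  their infimum; the bound is the quotient at \<open>t = 1\<close>. This holds before any cellwise
  structure is known.\<close>

lemma dir_deriv_le:
  assumes conv: "convex (repi D r)" and x: "x \<in> D" and y: "y \<in> D"
  shows "dir_deriv (fext D r) x (y - x) \<le> ereal (r y - r x)"
proof -
  define q where "q t = (r (x + t *\<^sub>R (y - x)) - r x) / t" for t
  have D: "x + t *\<^sub>R (y - x) \<in> D" if "0 < t" "t \<le> 1" for t
    using convex_repiD(1)[OF conv x y] that by simp
  have mono: "q s \<le> q t" if st: "0 < s" "s \<le> t" "t \<le> 1" for s t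
  proof -
    have tD: "x + t *\<^sub>R (y - x) \<in> D" using D st by simp
    have "r (x + (s / t) *\<^sub>R ((x + t *\<^sub>R (y - x)) - x)) \<le> r x + (s / t) * (r (x + t *\<^sub>R (y - x)) - r x)"
      using st by (intro convex_repiD(2)[OF conv x tD]) auto
    then have "r (x + s *\<^sub>R (y - x)) - r x \<le> s * q t" using st by (simp add: q_def)
    then show ?thesis using st by (simp add: q_def[of s] pos_divide_le_eq mult.commute)
  qed
  define L where "L = (INF t\<in>{0<..1}. ereal (q t))"
  have L: "L \<le> ereal (q t)" if "0 < t" "t \<le> 1" for t unfolding L_def using that by (intro INF_lower) auto
  have lim: "((\<lambda>t. ereal (q t)) \<longlongrightarrow> L) (at_right 0)"
  proof (rule order_tendstoI)
    fix a assume a: "a < L"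
    show "\<forall>\<^sub>F t in at_right 0. a < ereal (q t)"
      using L a by (auto simp: eventually_at_right_field intro!: exI[of _ 1] intro: less_le_trans)
  next
    fix a assume "L < a"
    then obtain t where t: "0 < t" "t \<le> 1" "ereal (q t) < a" by (auto simp: L_def INF_less_iff)
    have "ereal (q s) < a" if "0 < s" "s < t" for s
      using mono[of s t] t that by (intro le_less_trans[OF _ t(3)]) auto
    then show "\<forall>\<^sub>F t in at_right 0. ereal (q t) < a"
      using t(1) by (auto simp: eventually_at_right_field)
  qed
  have "\<forall>\<^sub>F t in at_right 0. (fext D r (x + t *\<^sub>R (y - x)) - fext D r x) / ereal t = ereal (q t)"
    using D x by (auto simp: eventually_at_right_field fext_def q_def intro!: exI[of _ 1])
  then have "((\<lambda>t. (fext D r (x + t *\<^sub>R (y - x)) - fext D r x) / ereal t) \<longlongrightarrow> L) (at_right 0)"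
    using lim by (simp add: tendsto_cong)
  then have "dir_deriv (fext D r) x (y - x) = L"
    unfolding dir_deriv_def by (intro tendsto_Lim) auto
  then show ?thesis using L[of 1] by (simp add: q_def)
qed

lemma subgrad_if_le_dir_deriv:
  assumes "convex (repi D r)" "x \<in> D" "\<And>d. ereal (p \<bullet> d) \<le> dir_deriv (fext D r) x d"
  shows "p \<in> subgrad D r x"
  unfolding subgrad_def
proof (intro CollectI ballI)
  fix y assume y: "y \<in> D"
  have "ereal (p \<bullet> (y - x)) \<le> ereal (r y - r x)"
    using assms(3) dir_deriv_le[OF assms(1,2) y] by (rule order_trans)
  then show "r x + p \<bullet> (y - x) \<le> r y" by simp
qed

text \<open>A subgradient \<open>p\<close> at \<open>x\<close> is shared by the whole cell of
  \<open>x\<close>, and the two subgradient inequalities between \<open>x\<close> and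
  \<open>y\<close> together force equality.\<close>

lemma cellwise_affineI:
  assumes "closed_subdiff D r"
    and sat: "\<And>x p. \<lbrakk>x \<in> D; p \<in> subgrad D r x\<rbrakk> \<Longrightarrow> cell_saturated N {y\<in>D. p \<in> subgrad D r y}"
  shows "cellwise_affine N D r"
  unfolding cellwise_affine_def
proof (intro conjI ballI)
  fix x p y assume x: "x \<in> D" and p: "p \<in> subgrad D r x" and y: "y \<in> cell N x"
  have yp: "y \<in> D" "p \<in> subgrad D r y" using sat[OF x p] x p y by (auto simp: cell_saturated_def)
  show "y \<in> D" by fact
  have "r x + p \<bullet> (y - x) \<le> r y" "r y + p \<bullet> (x - y) \<le> r x"
    using x p yp by (auto simp: subgrad_def)
  then show "r y = r x + p \<bullet> (y - x)" by (simp add: inner_diff_right)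
qed (use assms(1) in \<open>auto simp: closed_subdiff_def\<close>)

text \<open>\<open>x\<close> is a convex combination of points of \<open>V\<close> at which
  \<open>r\<close> agrees with one affine function of slope \<open>q\<close>. At one of them
  \<open>p - q\<close> is at least as large as at \<open>x\<close>, so restricting the supremum to
  \<open>V\<close> loses nothing.\<close>

lemma conj_eq_SUP_subset:
  assumes D: "D \<noteq> {}" and hull: "\<And>x. x \<in> D \<Longrightarrow> \<exists>q. x \<in> convex hull {y \<in> V \<inter> D. r y = r x + q \<bullet> (y - x)}"
  shows "(SUP x\<in>V \<inter> D. ereal (p \<bullet> x - r x)) = fext (conj_dom D r) (conj_val D r) p"
proof -
  define s where "s = (SUP x\<in>V \<inter> D. ereal (p \<bullet> x - r x))"
  have ub: "ereal (p \<bullet> x - r x) \<le> s" if x: "x \<in> D" for x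
  proof -
    obtain q where q: "x \<in> convex hull {y \<in> V \<inter> D. r y = r x + q \<bullet> (y - x)}" using hull[OF x] by blast
    obtain y where y: "y \<in> V \<inter> D" "r y = r x + q \<bullet> (y - x)" "(p - q) \<bullet> x \<le> (p - q) \<bullet> y"
      using hull_attains[OF q, of "p - q"] by blast
    have "p \<bullet> x - r x \<le> p \<bullet> y - r y" using y(2,3) by (simp add: inner_diff_left inner_diff_right)
    then have "ereal (p \<bullet> x - r x) \<le> ereal (p \<bullet> y - r y)" by simp
    also have "\<dots> \<le> s" unfolding s_def using y(1) by (rule SUP_upper)
    finally show ?thesis .
  qed
  obtain x0 where x0: "x0 \<in> D" using D by blast
  have "s = fext (conj_dom D r) (conj_val D r) p"
  proof (cases s)
    case (real m)
    then have m: "p \<bullet> x - r x \<le> m" if "x \<in> D" for x using ub[OF that] by simp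
    have p: "p \<in> conj_dom D r" by (rule conj_domI[OF m])
    have "s \<le> ereal (conj_val D r p)"
      unfolding s_def using conj_val_upper[OF p] by (intro SUP_least) auto
    moreover have "conj_val D r p \<le> m" by (rule conj_val_least[OF D m])
    ultimately show ?thesis using p real by (simp add: fext_def)
  next
    case PInf
    have "p \<notin> conj_dom D r"
    proof
      assume p: "p \<in> conj_dom D r"
      have "s \<le> ereal (conj_val D r p)"
        unfolding s_def using conj_val_upper[OF p] by (intro SUP_least) auto
      then show False using PInf by simp
    qed
    then show ?thesis using PInf by (simp add: fext_def)
  next
    case MInf
    then show ?thesis using ub[OF x0] by simp
  qed
  then show ?thesis by (simp add: s_def)
qed

section \<open>Tangent cones, normal cones and support functions\<close>

lemma convex_cone_tangent_cone:
  fixes P :: "'b::euclidean_space set"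
  shows "convex_cone (tangent_cone P q)"
proof -
  define K where "K = convex_cone hull ((\<lambda>z. z - q) ` P)"
  have "convex_cone K" unfolding K_def by (rule convex_cone_convex_cone_hull)
  then have "convex_cone (closure K)"
    unfolding convex_cone_def by (simp add: convex_closure conic_closure)
  then show ?thesis by (simp add: tangent_cone_def K_def)
qed

text \<open>Both sides are closed convex cones with the same polar, so separation gives both
  inclusions.\<close>

lemma tangent_cone_eq_cone:
  fixes P :: "'b::euclidean_space set"
  assumes fin: "finite R'" and eq: "\<And>n. (\<forall>z\<in>P. n \<bullet> z \<le> n \<bullet> q) \<longleftrightarrow> (\<forall>a\<in>R'. n \<bullet> a \<le> 0)"
  shows "tangent_cone P q = convex_cone hull R'"
proof
  have "(\<lambda>z. z - q) ` P \<subseteq> convex_cone hull R'"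
  proof (rule image_subsetI, rule ccontr)
    fix z assume z: "z \<in> P" "z - q \<notin> convex_cone hull R'"
    obtain n where n: "\<And>v. v \<in> convex_cone hull R' \<Longrightarrow> n \<bullet> v \<le> 0" "n \<bullet> (z - q) > 0"
      using convex_cone_separation[OF convex_cone_convex_cone_hull closed_convex_cone_hull[OF fin] z(2)] by blast
    then have "\<forall>a\<in>R'. n \<bullet> a \<le> 0" by (simp add: hull_inc)
    then have "n \<bullet> z \<le> n \<bullet> q" using eq z(1) by blast
    then show False using n(2) by (simp add: inner_diff_right)
  qed
  then have "convex_cone hull ((\<lambda>z. z - q) ` P) \<subseteq> convex_cone hull R'"
    by (intro hull_minimal convex_cone_convex_cone_hull)
  then show "tangent_cone P q \<subseteq> convex_cone hull R'"
    unfolding tangent_cone_def by (intro closure_minimal closed_convex_cone_hull[OF fin])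
  have "R' \<subseteq> tangent_cone P q"
  proof (rule subsetI, rule ccontr)
    fix a assume a: "a \<in> R'" "a \<notin> tangent_cone P q"
    have "closed (tangent_cone P q)" by (simp add: tangent_cone_def)
    then obtain n where n: "\<And>v. v \<in> tangent_cone P q \<Longrightarrow> n \<bullet> v \<le> 0" "n \<bullet> a > 0"
      using convex_cone_separation[OF convex_cone_tangent_cone _ a(2)] by blast
    have "n \<bullet> z \<le> n \<bullet> q" if "z \<in> P" for z
      using n(1)[OF in_tangent_cone[OF that, of q]] by (simp add: inner_diff_right)
    then have "n \<bullet> a \<le> 0" using eq a(1) by blast
    then show False using n(2) by simp
  qed
  then show "convex_cone hull R' \<subseteq> tangent_cone P q"
    by (intro hull_minimal convex_cone_tangent_cone)
qed

lemma closed_convex_subgrad: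
  fixes D :: "'b::real_inner set"
  shows "closed (subgrad D r x)" "convex (subgrad D r x)"
proof -
  have *: "subgrad D r x = (\<Inter>y\<in>D. {p. (y - x) \<bullet> p \<le> r y - r x})"
    by (auto simp: subgrad_def inner_commute algebra_simps)
  show "closed (subgrad D r x)" "convex (subgrad D r x)"
    unfolding * by (intro closed_INT ballI closed_halfspace_le convex_INT convex_halfspace_le)+
qed

text \<open>The difference is nonnegative and vanishes at \<open>0\<close>, so its minimum is
  \<open>0\<close> and the minimizers form the normal cone of \<open>P\<close> at
  \<open>q\<close>.\<close>

lemma argmin_support:
  fixes P :: "'b::real_inner set"
  assumes q: "q \<in> P"
  shows "argmin_set (\<lambda>d. (SUP p\<in>P. ereal (p \<bullet> d)) - ereal (q \<bullet> d)) = {d. \<forall>z\<in>P. z \<bullet> d \<le> q \<bullet> d}"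
proof -
  define s where "s d = (SUP p\<in>P. ereal (p \<bullet> d))" for d
  have s: "ereal (p \<bullet> d) \<le> s d" if "p \<in> P" for p d unfolding s_def using that by (rule SUP_upper)
  have nn: "0 \<le> s d - ereal (q \<bullet> d)" for d using s[OF q, of d] by (cases "s d") auto
  have "P \<noteq> {}" using q by blast
  then have s0: "s 0 = 0" by (simp add: s_def zero_ereal_def[symmetric])
  have iff: "s d - ereal (q \<bullet> d) \<le> 0 \<longleftrightarrow> (\<forall>z\<in>P. z \<bullet> d \<le> q \<bullet> d)" for d
  proof -
    have "s d - ereal (q \<bullet> d) \<le> 0 \<longleftrightarrow> s d \<le> ereal (q \<bullet> d)" by (cases "s d") auto
    also have "\<dots> \<longleftrightarrow> (\<forall>z\<in>P. z \<bullet> d \<le> q \<bullet> d)" by (auto simp: s_def SUP_le_iff)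
    finally show ?thesis .
  qed
  have "d \<in> argmin_set (\<lambda>d. s d - ereal (q \<bullet> d)) \<longleftrightarrow> s d - ereal (q \<bullet> d) \<le> 0" for d
  proof
    assume "d \<in> argmin_set (\<lambda>d. s d - ereal (q \<bullet> d))"
    then have "s d - ereal (q \<bullet> d) \<le> s 0 - ereal (q \<bullet> 0)"
      unfolding argmin_set_def mem_Collect_eq by (rule spec)
    then show "s d - ereal (q \<bullet> d) \<le> 0" by (simp add: s0 zero_ereal_def[symmetric])
  next
    assume "s d - ereal (q \<bullet> d) \<le> 0"
    then show "d \<in> argmin_set (\<lambda>d. s d - ereal (q \<bullet> d))"
      unfolding argmin_set_def using nn order_trans by blast
  qed
  then show ?thesis using iff unfolding s_def by auto
qed

subsection \<open>Conjugates of L-convex functions\<close>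

lemma Max_representation_le:
  assumes "finite B" "b \<in> B" "proper_fun s"
    and "\<And>v. v \<in> edom s \<Longrightarrow> s v = ereal (Max ((\<lambda>p. blinfun_apply p v) ` B))"
  shows "ereal (riesz b \<bullet> v) \<le> s v"
proof (cases "v \<in> edom s")
  case True
  have "blinfun_apply b v \<le> Max ((\<lambda>p. blinfun_apply p v) ` B)" using assms(1,2) by (intro Max_ge) auto
  then show ?thesis using assms(4)[OF True] by (simp add: blinfun_apply_eq_riesz)
next
  case False
  then have "s v = \<infinity>" using assms(3) by (auto simp: edom_def proper_fun_def)
  then show ?thesis by simp
qed

text \<open>The normal cone of \<open>P\<close> at \<open>q\<close> is a member of \<Pi> of the
  support function, hence cut out by roots, and its polar is the tangent cone. For the second claim,
  the maximum over \<open>B\<close> is attained at a lattice point; as a minorant of the support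
  function this point lies in \<open>P\<close>.\<close>

lemma L_sublinear_support:
  fixes \<Phi> :: "'a::euclidean_space dual set"
  assumes fin: "finite \<Phi>" and P: "P \<noteq> {}" "closed P" "convex P"
    and \<sigma>: "integral_L_sublinear \<Phi> (\<lambda>d. SUP p\<in>P. ereal (p \<bullet> d))"
    and mem: "\<And>p. (\<And>d. ereal (p \<bullet> d) \<le> (SUP p\<in>P. ereal (p \<bullet> d))) \<Longrightarrow> p \<in> P"
  shows "root_tangent (riesz ` \<Phi>) P"
    and "\<And>d q. \<lbrakk>q \<in> P; \<And>z. z \<in> P \<Longrightarrow> d \<bullet> z \<le> d \<bullet> q\<rbrakk> \<Longrightarrow> \<exists>b\<in>P \<inter> riesz ` root_lattice \<Phi>. d \<bullet> b = d \<bullet> q"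
proof -
  define s where "s d = (SUP p\<in>P. ereal (p \<bullet> d))" for d
  have s: "ereal (p \<bullet> d) \<le> s d" if "p \<in> P" for p d unfolding s_def using that by (rule SUP_upper)
  have s_isl: "integral_L_sublinear \<Phi> s" using \<sigma> by (simp add: s_def[abs_def])
  show "root_tangent (riesz ` \<Phi>) P"
    unfolding root_tangent_def
  proof (intro conjI ballI P)
    fix q assume q: "q \<in> P"
    have eq: "argmin_set (\<lambda>d. s d - ereal (blinfun_apply (dualv q) d)) = {d. \<forall>z\<in>P. z \<bullet> d \<le> q \<bullet> d}"
      using argmin_support[OF q] by (simp add: s_def dualv_apply)
    have "0 \<in> {d. \<forall>z\<in>P. z \<bullet> d \<le> q \<bullet> d}" by simp
    then have "{d. \<forall>z\<in>P. z \<bullet> d \<le> q \<bullet> d} \<noteq> {}" by blast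
    then have "{d. \<forall>z\<in>P. z \<bullet> d \<le> q \<bullet> d} \<in> Pi_V s" unfolding Pi_V_def using eq by blast
    then have "L_convex_cone \<Phi> {d. \<forall>z\<in>P. z \<bullet> d \<le> q \<bullet> d}"
      using s_isl by (simp add: integral_L_sublinear_def L_sublinear_def)
    then obtain \<Phi>' where \<Phi>': "\<Phi>' \<subseteq> \<Phi>" "{d. \<forall>z\<in>P. z \<bullet> d \<le> q \<bullet> d} = {d. \<forall>\<alpha>\<in>\<Phi>'. blinfun_apply \<alpha> d \<le> 0}"
      by (auto simp: L_convex_cone_def)
    have "(\<forall>z\<in>P. n \<bullet> z \<le> n \<bullet> q) \<longleftrightarrow> (\<forall>a\<in>riesz ` \<Phi>'. n \<bullet> a \<le> 0)" for n
    proof -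
      have "n \<in> {d. \<forall>z\<in>P. z \<bullet> d \<le> q \<bullet> d} \<longleftrightarrow> n \<in> {d. \<forall>\<alpha>\<in>\<Phi>'. blinfun_apply \<alpha> d \<le> 0}" using \<Phi>'(2) by simp
      then show ?thesis by (simp add: blinfun_apply_eq_riesz inner_commute)
    qed
    moreover have "finite (riesz ` \<Phi>')" using fin \<Phi>'(1) finite_subset by blast
    ultimately have "tangent_cone P q = convex_cone hull (riesz ` \<Phi>')" by (intro tangent_cone_eq_cone)
    then show "\<exists>R'\<subseteq>riesz ` \<Phi>. tangent_cone P q = convex_cone hull R'" using \<Phi>'(1) by blast
  qed
  fix d q assume q: "q \<in> P" and max: "\<And>z. z \<in> P \<Longrightarrow> d \<bullet> z \<le> d \<bullet> q"
  have pr: "proper_fun s" using s_isl by (simp add: integral_L_sublinear_def L_sublinear_def)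
  obtain B where B: "B \<noteq> {}" "finite B" "B \<subseteq> root_lattice \<Phi>"
    "\<And>x. x \<in> edom s \<Longrightarrow> s x = ereal (Max ((\<lambda>p. blinfun_apply p x) ` B))"
    using s_isl by (auto simp: integral_L_sublinear_def)
  have sd: "s d = ereal (q \<bullet> d)"
    using s[OF q, of d] max unfolding s_def by (intro antisym SUP_least) (auto simp: inner_commute)
  then have "d \<in> edom s" by (simp add: edom_def)
  then have "Max ((\<lambda>p. blinfun_apply p d) ` B) = q \<bullet> d" using B(4) sd by fastforce
  then have "q \<bullet> d \<in> (\<lambda>p. blinfun_apply p d) ` B" using Max_in[of "(\<lambda>p. blinfun_apply p d) ` B"] B(1,2) by auto
  then obtain b where b: "b \<in> B" "blinfun_apply b d = q \<bullet> d" by auto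
  have "riesz b \<in> P"
  proof (rule mem)
    show "ereal (riesz b \<bullet> v) \<le> (SUP p\<in>P. ereal (p \<bullet> v))" for v
      unfolding s_def[symmetric] by (rule Max_representation_le[OF B(2) b(1) pr B(4)])
  qed
  then show "\<exists>b\<in>P \<inter> riesz ` root_lattice \<Phi>. d \<bullet> b = d \<bullet> q"
    using b B(3) by (intro bexI[of _ "riesz b"]) (auto simp: blinfun_apply_eq_riesz inner_commute)
qed

lemma roots_finite:
  assumes "root_system \<Phi>"
  shows "finite \<Phi>" "0 \<notin> \<Phi>"
  using assms by (auto simp: root_system_def)

lemma lattice_step:
  assumes "root_system \<Phi>" "z \<in> riesz ` root_lattice \<Phi>" "a \<in> riesz ` \<Phi>"
  shows "z + a \<in> riesz ` root_lattice \<Phi> \<and> z - a \<in> riesz ` root_lattice \<Phi>"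
  using root_lattice_step[OF roots_finite(1)[OF assms(1)]] assms(2,3)
  by (auto simp: linear_add[OF linear_riesz, symmetric] linear_diff[OF linear_riesz, symmetric])

lemma lattice_integral:
  "\<lbrakk>cone_normals (riesz ` \<Phi>) N; n \<in> N; z \<in> riesz ` root_lattice \<Phi>\<rbrakk> \<Longrightarrow> n \<bullet> z \<in> \<int>"
  by (rule root_lattice_integral[of \<Phi>]) (auto simp: cone_normals_def)

lemma conj_subgrad_eq:
  fixes D :: "'b::euclidean_space set"
  assumes "closed_subdiff D r"
  shows "p \<in> conj_dom D r \<Longrightarrow> subgrad (conj_dom D r) (conj_val D r) p = {x\<in>D. p \<in> subgrad D r x}"
    and "x \<in> D \<Longrightarrow> {p\<in>conj_dom D r. x \<in> subgrad (conj_dom D r) (conj_val D r) p} = subgrad D r x"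
proof -
  show "subgrad (conj_dom D r) (conj_val D r) p = {x\<in>D. p \<in> subgrad D r x}" if p: "p \<in> conj_dom D r"
  proof (intro equalityI subsetI)
    fix x assume "x \<in> subgrad (conj_dom D r) (conj_val D r) p"
    from subgrad_conj_converse[OF assms p this] show "x \<in> {x\<in>D. p \<in> subgrad D r x}" by blast
  next
    fix x assume "x \<in> {x\<in>D. p \<in> subgrad D r x}"
    then show "x \<in> subgrad (conj_dom D r) (conj_val D r) p" using subgrad_conj(3)[of x D p r] by blast
  qed
  show "{p\<in>conj_dom D r. x \<in> subgrad (conj_dom D r) (conj_val D r) p} = subgrad D r x" if x: "x \<in> D"
  proof (intro equalityI subsetI)
    fix p assume "p \<in> {p\<in>conj_dom D r. x \<in> subgrad (conj_dom D r) (conj_val D r) p}"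
    then show "p \<in> subgrad D r x" using subgrad_conj_converse(2)[OF assms] by blast
  next
    fix p assume "p \<in> subgrad D r x"
    from subgrad_conj(1,3)[OF x this]
    show "p \<in> {p\<in>conj_dom D r. x \<in> subgrad (conj_dom D r) (conj_val D r) p}" by blast
  qed
qed

context
  fixes \<Phi> :: "'a::euclidean_space dual set" and D :: "'a set" and r :: "'a \<Rightarrow> real"
  assumes rs: "root_system \<Phi>" and ess: "essential \<Phi>" and D: "D \<noteq> {}"
begin

text \<open>The elements of \<open>B\<close> lie below the directional derivative and hence are
  subgradients. Only convexity is used, so this can precede \<open>L_cellwise\<close>.\<close>

lemma L_closed_subdiff:
  assumes "integral_locpoly_L_convex \<Phi> (fext D r)"
  shows "closed_subdiff D r"
proof -
  have lp: "locally_polyhedral (repi D r)"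
    and sl: "\<And>x. x \<in> D \<Longrightarrow> integral_L_sublinear \<Phi> (dir_deriv (fext D r) x)"
    using assms by (auto simp: integral_locpoly_L_convex_def locally_polyhedral_convex_fun_def epi_fext edom_fext)
  have conv: "convex (repi D r)" using lp by (simp add: locally_polyhedral_def)
  have "subgrad D r x \<noteq> {}" if x: "x \<in> D" for x
  proof -
    define s where "s = dir_deriv (fext D r) x"
    obtain B where B: "B \<noteq> {}" "finite B"
      "\<And>v. v \<in> edom s \<Longrightarrow> s v = ereal (Max ((\<lambda>p. blinfun_apply p v) ` B))"
      and pr: "proper_fun s"
      using sl[OF x] by (auto simp: integral_L_sublinear_def L_sublinear_def s_def)
    obtain b where b: "b \<in> B" using B(1) by blast
    have "ereal (riesz b \<bullet> v) \<le> s v" for v by (rule Max_representation_le[OF B(2) b pr B(3)])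
    then have "riesz b \<in> subgrad D r x" using subgrad_if_le_dir_deriv[OF conv x] by (simp add: s_def)
    then show ?thesis by blast
  qed
  then show ?thesis using D conv locally_polyhedral_imp_closed[OF lp] by (simp add: closed_subdiff_def)
qed

lemma L_argmin:
  assumes "integral_locpoly_L_convex \<Phi> (fext D r)" "x \<in> D" "p \<in> subgrad D r x"
  shows "integral_L_convex_polyhedron \<Phi> {y\<in>D. p \<in> subgrad D r y}"
proof -
  have eq: "argmin_set (\<lambda>x. fext D r x - ereal (blinfun_apply (dualv p) x)) = {y\<in>D. p \<in> subgrad D r y}"
    using argmin_fext[OF D, of r p] by (simp add: dualv_apply)
  have "{y\<in>D. p \<in> subgrad D r y} \<noteq> {}" using assms(2,3) by blast
  then have "{y\<in>D. p \<in> subgrad D r y} \<in> Pi_V (fext D r)" unfolding Pi_V_def using eq by blast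
  then show ?thesis using assms(1) by (simp add: integral_locpoly_L_convex_def)
qed

lemma L_cellwise:
  assumes "integral_locpoly_L_convex \<Phi> (fext D r)"
  shows "cellwise_affine (riesz ` \<Phi>) D r"
  using L_closed_subdiff[OF assms] integral_L_convex_polyhedron_saturated[OF L_argmin[OF assms]]
  by (rule cellwise_affineI)

text \<open>By now the derivative at \<open>x\<close> is the support function of the
  subdifferential, so \<open>L_sublinear_support\<close> supplies the lattice points that
  \<open>root_tangent_integral\<close> asks for.\<close>

lemma L_subgrad:
  assumes "integral_locpoly_L_convex \<Phi> (fext D r)" "x \<in> D"
  shows "root_tangent (riesz ` \<Phi>) (subgrad D r x)"
    and "subgrad D r x = convex hull (subgrad D r x \<inter> riesz ` root_lattice \<Phi>)"
proof -
  have finR: "finite (riesz ` \<Phi>)" using roots_finite(1)[OF rs] by blast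
  note cw = L_cellwise[OF assms(1)]
  have supp: "dir_deriv (fext D r) x = (\<lambda>d. SUP p\<in>subgrad D r x. ereal (p \<bullet> d))"
    using cellwise_dir_deriv_support[OF finR cw assms(2)] by blast
  have sl: "integral_L_sublinear \<Phi> (\<lambda>d. SUP p\<in>subgrad D r x. ereal (p \<bullet> d))"
    using assms by (auto simp: integral_locpoly_L_convex_def edom_fext supp[symmetric])
  have ne: "subgrad D r x \<noteq> {}" by (rule cellwise_facts(3)[OF finR cw assms(2)])
  have mem: "p \<in> subgrad D r x" if "\<And>d. ereal (p \<bullet> d) \<le> (SUP p\<in>subgrad D r x. ereal (p \<bullet> d))" for p
    using that subgrad_if_le_dir_deriv[OF cellwise_facts(2)[OF finR cw] assms(2)] by (simp add: supp)
  note L = L_sublinear_support[OF roots_finite(1)[OF rs] ne closed_convex_subgrad sl mem]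
  show rt: "root_tangent (riesz ` \<Phi>) (subgrad D r x)" by (rule L(1))
  obtain N where N: "cone_normals (riesz ` \<Phi>) N" using root_cone_normals[OF rs ess] .
  show "subgrad D r x = convex hull (subgrad D r x \<inter> riesz ` root_lattice \<Phi>)"
    by (rule root_tangent_integral[OF finR N rt lattice_step[OF rs] L(2)])
qed

lemma L_subgrad_saturated:
  assumes "integral_locpoly_L_convex \<Phi> (fext D r)" "x \<in> D" "cone_normals (riesz ` \<Phi>) N"
  shows "cell_saturated N (subgrad D r x)"
  by (rule integral_root_tangent_saturated[OF assms(3) L_subgrad[OF assms(1,2)] lattice_integral[OF assms(3)]])

lemma conj_of_L_convex:
  assumes h: "integral_locpoly_L_convex \<Phi> (fext D r)"
  shows "integral_locpoly_M_convex \<Phi> (\<lambda>p. fext (conj_dom D r) (conj_val D r) (riesz p))"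
proof -
  note cs = L_closed_subdiff[OF h]
  obtain N where N: "cone_normals (riesz ` \<Phi>) N" using root_cone_normals[OF rs ess] .
  have finN: "finite N" using N by (simp add: cone_normals_def)
  define E s where "E = conj_dom D r" and "s = conj_val D r"
  have cw: "cellwise_affine N E s"
    unfolding E_def s_def by (rule cellwise_affine_conj[OF finN cs L_subgrad_saturated[OF h _ N]])
  have E: "E \<noteq> {}" by (rule cellwise_facts(1)[OF finN cw])
  have edomE: "p \<in> edom (\<lambda>p. fext E s (riesz p)) \<longleftrightarrow> riesz p \<in> E" for p
    by (auto simp: edom_def fext_def)
  show ?thesis
    unfolding integral_locpoly_M_convex_def E_def[symmetric] s_def[symmetric]
  proof (intro conjI ballI)
    obtain e where "e \<in> E" using E by blast
    then show "proper_fun (\<lambda>p. fext E s (riesz p))"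
      by (auto simp: proper_fun_def fext_def riesz_dualv intro!: exI[of _ "dualv e"])
    show "locally_polyhedral_convex_fun (\<lambda>p. fext E s (riesz p))"
      unfolding locally_polyhedral_convex_fun_def locally_polyhedral_epi_riesz epi_fext
      by (rule cellwise_locally_polyhedral[OF finN cw])
  next
    fix S assume "S \<in> Pi_dual (\<lambda>p. fext E s (riesz p))"
    then obtain x where S: "S \<noteq> {}" "S = dualv ` {p\<in>E. x \<in> subgrad E s p}"
      by (auto simp: Pi_dual_def argmin_riesz argmin_fext[OF E])
    then obtain p where p: "p \<in> E" "x \<in> subgrad E s p" by blast
    have x: "x \<in> D" using subgrad_conj_converse(1)[OF cs] p by (simp add: E_def s_def)
    have "riesz ` S = subgrad D r x"
      using conj_subgrad_eq(2)[OF cs x] S(2) by (simp add: image_image riesz_dualv E_def s_def)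
    then show "integral_M_convex_polyhedron \<Phi> S"
      using L_subgrad[OF h x] by (simp add: integral_M_convex_polyhedron_riesz)
  next
    fix p assume "p \<in> edom (\<lambda>p. fext E s (riesz p))"
    then have pE: "riesz p \<in> E" by (simp add: edomE)
    \<comment> \<open>The subdifferential of the conjugate is a member of \<Pi> of the original
      function, hence the polyhedron of some integral \<gamma>.\<close>
    then have eq: "subgrad E s (riesz p) = {x\<in>D. riesz p \<in> subgrad D r x}"
      using conj_subgrad_eq(1)[OF cs] by (simp add: E_def s_def)
    obtain x where x: "x \<in> D" "riesz p \<in> subgrad D r x" using cellwise_facts(3)[OF finN cw pE] eq by blast
    obtain \<gamma> where \<gamma>: "\<forall>\<alpha>\<in>\<Phi>. \<gamma> \<alpha> \<in> Z_inf" "subgrad E s (riesz p) = gamma_polyhedron \<Phi> \<gamma>"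
      using L_argmin[OF h x] eq by (auto simp: integral_L_convex_polyhedron_def)
    have ne: "gamma_polyhedron \<Phi> \<gamma> \<noteq> {}" using cellwise_facts(3)[OF finN cw pE] \<gamma>(2) by simp
    have "dir_deriv (\<lambda>p. fext E s (riesz p)) p d = cone_fun \<Phi> \<gamma> d" for d
      using cone_fun_eq_support[OF roots_finite[OF rs] _ ne, of d] \<gamma>
      by (simp add: dir_deriv_riesz cellwise_dir_deriv_support[OF finN cw pE] inner_commute)
    then show "integral_M_sublinear \<Phi> (dir_deriv (\<lambda>p. fext E s (riesz p)) p)"
      unfolding integral_M_sublinear_def using \<gamma>(1) ne by blast
  qed
qed

lemma conj_L_eq_conj:
  assumes h: "integral_locpoly_L_convex \<Phi> (fext D r)" and f: "\<forall>x\<in>coxeter_vertices \<Phi>. f x = fext D r x"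
  shows "conj_L \<Phi> f p = fext (conj_dom D r) (conj_val D r) (riesz p)"
proof -
  have finR: "finite (riesz ` \<Phi>)" using roots_finite(1)[OF rs] by blast
  note cw = L_cellwise[OF h]
  have "coxeter_vertices \<Phi> \<inter> edom f = coxeter_vertices \<Phi> \<inter> D"
    using f by (auto simp: edom_def fext_def split: if_splits)
  then have "conj_L \<Phi> f p = (SUP x\<in>coxeter_vertices \<Phi> \<inter> D. ereal (riesz p \<bullet> x - r x))"
    unfolding conj_L_def using f by (intro SUP_cong) (auto simp: fext_def blinfun_apply_eq_riesz)
  also have "\<dots> = fext (conj_dom D r) (conj_val D r) (riesz p)"
  proof (rule conj_eq_SUP_subset[OF D])
    fix x assume x: "x \<in> D"
    obtain q where q: "q \<in> subgrad D r x" using cellwise_facts(3)[OF finR cw x] by blast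
    \<comment> \<open>A subgradient at \<open>x\<close> is the slope of \<open>r\<close> on the
      whole cell, so all vertices in the cell are admissible.\<close>
    have "cell (riesz ` \<Phi>) x \<inter> coxeter_vertices \<Phi> \<subseteq> {y \<in> coxeter_vertices \<Phi> \<inter> D. r y = r x + q \<bullet> (y - x)}"
      using cellwise_facts(4)[OF finR cw x q] cellwise_facts(5)[OF finR cw x] by blast
    then have "x \<in> convex hull {y \<in> coxeter_vertices \<Phi> \<inter> D. r y = r x + q \<bullet> (y - x)}"
      using in_hull_of_cell_vertices[OF roots_finite(1)[OF rs] ess, of x] hull_mono by blast
    then show "\<exists>q. x \<in> convex hull {y \<in> coxeter_vertices \<Phi> \<inter> D. r y = r x + q \<bullet> (y - x)}" by blast
  qed
  finally show ?thesis .
qed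

end

subsection \<open>Conjugates of M-convex functions\<close>

text \<open>For \<open>q\<close> outside \<open>P\<close> a separating functional gives a ray along
  which the difference tends to minus infinity, so no minimizer exists. Hence only members of
  \<open>P\<close> contribute to \<Pi> of its support function.\<close>

lemma argmin_support_mem:
  fixes P :: "'b::euclidean_space set"
  assumes P: "P \<noteq> {}" "closed P" "convex P"
    and d0: "d0 \<in> argmin_set (\<lambda>d. (SUP p\<in>P. ereal (p \<bullet> d)) - ereal (q \<bullet> d))"
  shows "q \<in> P"
proof (rule ccontr)
  assume "q \<notin> P"
  then obtain a b where ab: "a \<bullet> q < b" "\<And>z. z \<in> P \<Longrightarrow> a \<bullet> z > b"
    using separating_hyperplane_closed_point[OF P(3,2)] by metis
  obtain z where z: "z \<in> P" using P(1) by blast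
  define s where "s d = (SUP p\<in>P. ereal (p \<bullet> d))" for d
  define t where "t = (\<bar>z \<bullet> d0 - q \<bullet> d0\<bar> + 1) / (b - a \<bullet> q)"
  have t: "t \<ge> 0" unfolding t_def using ab(1) by (intro divide_nonneg_pos) auto
  have "s ((- t) *\<^sub>R a) \<le> ereal (- t * b)"
    unfolding s_def
  proof (rule SUP_least)
    fix p assume "p \<in> P"
    then have "t * b \<le> t * (a \<bullet> p)" using ab(2)[of p] t by (intro mult_left_mono) auto
    then show "ereal (p \<bullet> ((- t) *\<^sub>R a)) \<le> ereal (- t * b)" by (simp add: inner_commute)
  qed
  then have "s ((- t) *\<^sub>R a) - ereal (q \<bullet> ((- t) *\<^sub>R a)) \<le> ereal (- t * b) - ereal (q \<bullet> ((- t) *\<^sub>R a))"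
    by (rule ereal_minus_mono) simp
  moreover have "s d0 - ereal (q \<bullet> d0) \<le> s ((- t) *\<^sub>R a) - ereal (q \<bullet> ((- t) *\<^sub>R a))"
    using d0 unfolding argmin_set_def mem_Collect_eq s_def by (rule spec)
  moreover have "ereal (z \<bullet> d0) - ereal (q \<bullet> d0) \<le> s d0 - ereal (q \<bullet> d0)"
    by (rule ereal_minus_mono) (use z in \<open>auto simp: s_def intro: SUP_upper\<close>)
  ultimately have "ereal (z \<bullet> d0) - ereal (q \<bullet> d0) \<le> ereal (- t * b) - ereal (q \<bullet> ((- t) *\<^sub>R a))"
    by (meson order_trans)
  then have "z \<bullet> d0 - q \<bullet> d0 \<le> - (t * (b - a \<bullet> q))" by (simp add: inner_commute algebra_simps)
  moreover have "t * (b - a \<bullet> q) = \<bar>z \<bullet> d0 - q \<bullet> d0\<bar> + 1" using ab(1) by (simp add: t_def)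
  ultimately show False by linarith
qed

text \<open>\<open>B\<close> consists of one subgradient for each of the finitely many cells near \<open>x\<close>.\<close>

lemma dir_deriv_eq_Max:
  fixes R :: "'b::euclidean_space set"
  assumes fin: "finite R" and cw: "cellwise_affine R E s" and x: "x \<in> E"
    and lat: "\<And>y. y \<in> E \<Longrightarrow> subgrad E s y \<inter> L \<noteq> {}"
  obtains B where "B \<noteq> {}" "finite B" "B \<subseteq> L"
    "\<And>d. d \<in> edom (dir_deriv (fext E s) x) \<Longrightarrow> dir_deriv (fext E s) x d = ereal (Max ((\<lambda>p. p \<bullet> d) ` B))"
proof -
  obtain e where e: "e > 0"
    "\<And>d p u. \<lbrakk>norm d < e; x + d \<in> E; p \<in> subgrad E s (x + d); 0 \<le> u; u \<le> 1\<rbrakk> \<Longrightarrow>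
       p \<in> subgrad E s x \<and> x + u *\<^sub>R d \<in> E \<and> s (x + u *\<^sub>R d) = s x + u * (p \<bullet> d)"
    using cellwise_direction[OF fin cw x] by metis
  define Y where "Y = E \<inter> ball x e"
  have finY: "finite (cell R ` Y)"
    using finite_cells[OF fin, of Y] bounded_ball by (auto simp: Y_def intro: bounded_subset)
  have "\<forall>c\<in>cell R ` Y. \<exists>y p. y \<in> Y \<and> cell R y = c \<and> p \<in> subgrad E s y \<inter> L"
  proof
    fix c assume "c \<in> cell R ` Y"
    then obtain y where y: "y \<in> Y" "cell R y = c" by blast
    moreover obtain p where "p \<in> subgrad E s y \<inter> L" using lat[of y] y(1) by (auto simp: Y_def)
    ultimately show "\<exists>y p. y \<in> Y \<and> cell R y = c \<and> p \<in> subgrad E s y \<inter> L" by blast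
  qed
  then obtain f p where fp: "\<And>c. c \<in> cell R ` Y \<Longrightarrow> f c \<in> Y \<and> cell R (f c) = c \<and> p c \<in> subgrad E s (f c) \<inter> L"
    by metis
  define B where "B = p ` cell R ` Y"
  have sub: "p (cell R y) \<in> subgrad E s y" if y: "y \<in> Y" for y
  proof (rule cellwise_subgrad_mono[OF fin cw])
    have *: "f (cell R y) \<in> Y \<and> cell R (f (cell R y)) = cell R y \<and> p (cell R y) \<in> subgrad E s (f (cell R y)) \<inter> L"
      by (rule fp) (use y in blast)
    then show "f (cell R y) \<in> E" "p (cell R y) \<in> subgrad E s (f (cell R y))" by (auto simp: Y_def)
    show "y \<in> cell R (f (cell R y))" using * cell_self[of y R] by simp
  qed
  \<comment> \<open>The case \<open>u = 0\<close> of the local description moves the subgradient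
    from \<open>y\<close> to \<open>x\<close>.\<close>
  have subx: "p (cell R y) \<in> subgrad E s x" if y: "y \<in> Y" for y
    using e(2)[of "y - x" "p (cell R y)" 0] sub[OF y] y by (auto simp: Y_def dist_norm norm_minus_commute)
  show ?thesis
  proof (rule that[of B])
    have "x \<in> Y" using x e(1) by (simp add: Y_def)
    then show "B \<noteq> {}" by (auto simp: B_def)
    show finB: "finite B" using finY by (simp add: B_def)
    show "B \<subseteq> L" using fp by (auto simp: B_def)
    fix d assume d: "d \<in> edom (dir_deriv (fext E s) x)"
    have "\<exists>u>0. x + u *\<^sub>R d \<in> E"
    proof (rule ccontr)
      assume "\<not> (\<exists>u>0. x + u *\<^sub>R d \<in> E)"
      then have "dir_deriv (fext E s) x d = \<infinity>" by (intro cellwise_dir_deriv_out[OF fin cw x]) blast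
      then show False using d by (simp add: edom_def)
    qed
    then obtain u0 where "u0 > 0" "x + u0 *\<^sub>R d \<in> E" by blast
    then obtain u where u: "u > 0" "norm (u *\<^sub>R d) < e" "x + u *\<^sub>R d \<in> E"
      using cellwise_scaled_direction[OF fin cw x _ _ e(1)] by metis
    have yY: "x + u *\<^sub>R d \<in> Y" using u by (simp add: Y_def dist_norm)
    define q where "q = p (cell R (x + u *\<^sub>R d))"
    have q: "q \<in> subgrad E s (x + u *\<^sub>R d)" unfolding q_def by (rule sub[OF yY])
    have lin: "x + v *\<^sub>R d \<in> E \<and> s (x + v *\<^sub>R d) = s x + v * (q \<bullet> d)" if v: "0 \<le> v" "v \<le> u" for v
      using e(2)[OF u(2,3) q, of "v / u"] v u(1) by simp
    have dd: "dir_deriv (fext E s) x d = ereal (q \<bullet> d)"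
      using cellwise_dir_deriv_in[OF fin cw x u(1)] lin by blast
    have "b \<bullet> d \<le> q \<bullet> d" if b: "b \<in> B" for b
    proof -
      have "b \<in> subgrad E s x" using b subx by (auto simp: B_def)
      then show ?thesis using lin[of u] u(1,3) by (intro cellwise_subgrad_le[OF fin cw x _ u(1)]) auto
    qed
    moreover have "q \<in> B" using yY by (auto simp: B_def q_def)
    ultimately have "Max ((\<lambda>p. p \<bullet> d) ` B) = q \<bullet> d"
      using finB by (intro Max_eqI) auto
    then show "dir_deriv (fext E s) x d = ereal (Max ((\<lambda>p. p \<bullet> d) ` B))" using dd by simp
  qed
qed

context
  fixes \<Phi> :: "'a::euclidean_space dual set" and D :: "'a set" and r :: "'a \<Rightarrow> real"
  assumes rs: "root_system \<Phi>" and ess: "essential \<Phi>" and D: "D \<noteq> {}"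
    and h: "integral_locpoly_M_convex \<Phi> (\<lambda>p. fext D r (riesz p))"
begin

lemma M_convex_repi: "locally_polyhedral (repi D r)" "convex (repi D r)"
proof -
  show "locally_polyhedral (repi D r)"
    using h by (simp add: integral_locpoly_M_convex_def locally_polyhedral_convex_fun_def
        locally_polyhedral_epi_riesz epi_fext)
  then show "convex (repi D r)" by (simp add: locally_polyhedral_def)
qed

lemma M_dir_deriv:
  assumes p: "p \<in> D"
  shows "\<exists>\<gamma>. (\<forall>\<alpha>\<in>\<Phi>. \<gamma> \<alpha> \<in> Z_inf) \<and> gamma_polyhedron \<Phi> \<gamma> \<noteq> {} \<and>
    (\<forall>d. dir_deriv (fext D r) p (riesz d) = cone_fun \<Phi> \<gamma> d)"
proof -
  have "dualv p \<in> edom (\<lambda>p. fext D r (riesz p))" using p by (simp add: edom_def fext_def riesz_dualv)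
  then have "integral_M_sublinear \<Phi> (dir_deriv (\<lambda>p. fext D r (riesz p)) (dualv p))"
    using h by (simp add: integral_locpoly_M_convex_def)
  then obtain \<gamma> where \<gamma>: "\<forall>\<alpha>\<in>\<Phi>. \<gamma> \<alpha> \<in> Z_inf" "gamma_polyhedron \<Phi> \<gamma> \<noteq> {}"
    "dir_deriv (\<lambda>p. fext D r (riesz p)) (dualv p) = cone_fun \<Phi> \<gamma>"
    by (auto simp: integral_M_sublinear_def)
  have "dir_deriv (fext D r) p (riesz d) = cone_fun \<Phi> \<gamma> d" for d
    using fun_cong[OF \<gamma>(3), of d] by (simp add: dir_deriv_riesz riesz_dualv)
  then show ?thesis using \<gamma>(1,2) by blast
qed

text \<open>This is weak duality only, so it is available before \<open>r\<close> is known to be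
  cellwise affine, and it supplies the first subgradients.\<close>

lemma M_gamma_subgrad:
  assumes p: "p \<in> D" and \<gamma>: "\<And>d. dir_deriv (fext D r) p (riesz d) = cone_fun \<Phi> \<gamma> d"
  shows "gamma_polyhedron \<Phi> \<gamma> \<subseteq> subgrad D r p"
proof
  fix x assume x: "x \<in> gamma_polyhedron \<Phi> \<gamma>"
  show "x \<in> subgrad D r p"
  proof (rule subgrad_if_le_dir_deriv[OF M_convex_repi(2) p])
    fix d
    have "ereal (blinfun_apply (dualv d) x) \<le> cone_fun \<Phi> \<gamma> (dualv d)"
      by (rule cone_fun_ge[OF roots_finite(1)[OF rs] x])
    then show "ereal (x \<bullet> d) \<le> dir_deriv (fext D r) p d"
      using \<gamma>[of "dualv d"] by (simp add: dualv_apply riesz_dualv inner_commute)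
  qed
qed

lemma M_closed_subdiff: "closed_subdiff D r"
proof -
  have "subgrad D r p \<noteq> {}" if p: "p \<in> D" for p
  proof -
    obtain \<gamma> where \<gamma>: "gamma_polyhedron \<Phi> \<gamma> \<noteq> {}"
      "\<forall>d. dir_deriv (fext D r) p (riesz d) = cone_fun \<Phi> \<gamma> d"
      using M_dir_deriv[OF p] by blast
    show ?thesis using M_gamma_subgrad[OF p spec[OF \<gamma>(2)]] \<gamma>(1) by blast
  qed
  then show ?thesis
    using D M_convex_repi locally_polyhedral_imp_closed by (auto simp: closed_subdiff_def)
qed

lemma M_argmin:
  assumes "p \<in> D" "x \<in> subgrad D r p"
  shows "root_tangent (riesz ` \<Phi>) {q\<in>D. x \<in> subgrad D r q}"
    "{q\<in>D. x \<in> subgrad D r q} = convex hull ({q\<in>D. x \<in> subgrad D r q} \<inter> riesz ` root_lattice \<Phi>)"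
proof -
  define S where "S = {q\<in>D. x \<in> subgrad D r q}"
  have "argmin_set (\<lambda>p. fext D r (riesz p) - ereal (blinfun_apply p x)) = dualv ` S"
    by (simp add: argmin_riesz argmin_fext[OF D] S_def)
  moreover have "dualv ` S \<noteq> {}" using assms by (auto simp: S_def)
  ultimately have "dualv ` S \<in> Pi_dual (\<lambda>p. fext D r (riesz p))" unfolding Pi_dual_def by blast
  then have "integral_M_convex_polyhedron \<Phi> (dualv ` S)" using h by (simp add: integral_locpoly_M_convex_def)
  moreover have "riesz ` dualv ` S = S" by (simp add: image_image riesz_dualv)
  ultimately have "root_tangent (riesz ` \<Phi>) S \<and> S = convex hull (S \<inter> riesz ` root_lattice \<Phi>)"
    unfolding integral_M_convex_polyhedron_riesz by simp
  then show "root_tangent (riesz ` \<Phi>) {q\<in>D. x \<in> subgrad D r q}"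
    "{q\<in>D. x \<in> subgrad D r q} = convex hull ({q\<in>D. x \<in> subgrad D r q} \<inter> riesz ` root_lattice \<Phi>)"
    unfolding S_def by blast+
qed

lemma M_cellwise:
  assumes N: "cone_normals (riesz ` \<Phi>) N"
  shows "cellwise_affine N D r"
proof (rule cellwise_affineI[OF M_closed_subdiff])
  fix p x assume px: "p \<in> D" "x \<in> subgrad D r p"
  show "cell_saturated N {q\<in>D. x \<in> subgrad D r q}"
    by (rule integral_root_tangent_saturated[OF N M_argmin[OF px] lattice_integral[OF N]])
qed

text \<open>The subdifferential is the polyhedron of \<gamma> itself: its support function is
  \<open>cone_fun \<Phi> \<gamma>\<close>, whose value at a root \<alpha> is at most
  \<open>\<gamma> \<alpha>\<close>. The other inclusion is \<open>M_gamma_subgrad\<close>.\<close>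

lemma M_subgrad:
  assumes p: "p \<in> D"
  shows "integral_L_convex_polyhedron \<Phi> (subgrad D r p)"
proof -
  obtain N where N: "cone_normals (riesz ` \<Phi>) N" using root_cone_normals[OF rs ess] .
  have finN: "finite N" using N by (simp add: cone_normals_def)
  obtain \<gamma> where \<gamma>: "\<forall>\<alpha>\<in>\<Phi>. \<gamma> \<alpha> \<in> Z_inf" "gamma_polyhedron \<Phi> \<gamma> \<noteq> {}"
    "\<forall>d. dir_deriv (fext D r) p (riesz d) = cone_fun \<Phi> \<gamma> d"
    using M_dir_deriv[OF p] by blast
  have "subgrad D r p \<subseteq> gamma_polyhedron \<Phi> \<gamma>"
  proof
    fix x assume x: "x \<in> subgrad D r p"
    have "ereal (blinfun_apply \<alpha> x) \<le> \<gamma> \<alpha>" if \<alpha>: "\<alpha> \<in> \<Phi>" for \<alpha>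
    proof -
      have "ereal (x \<bullet> riesz \<alpha>) \<le> dir_deriv (fext D r) p (riesz \<alpha>)"
        unfolding cellwise_dir_deriv_support[OF finN M_cellwise[OF N] p] using x by (rule SUP_upper)
      also have "\<dots> \<le> \<gamma> \<alpha>" unfolding spec[OF \<gamma>(3)] by (rule cone_fun_root_le[OF roots_finite(1)[OF rs] \<alpha>])
      finally show ?thesis by (simp add: blinfun_apply_eq_riesz inner_commute)
    qed
    then show "x \<in> gamma_polyhedron \<Phi> \<gamma>" by (simp add: gamma_polyhedron_def)
  qed
  then have "subgrad D r p = gamma_polyhedron \<Phi> \<gamma>" using M_gamma_subgrad[OF p spec[OF \<gamma>(3)]] by blast
  then show ?thesis
    unfolding integral_L_convex_polyhedron_def using \<gamma>(1,2) by (intro conjI exI[of _ \<gamma>]) auto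
qed

lemma conj_of_M_convex: "integral_locpoly_L_convex \<Phi> (fext (conj_dom D r) (conj_val D r))"
proof -
  note cs = M_closed_subdiff
  have finR: "finite (riesz ` \<Phi>)" using roots_finite(1)[OF rs] by blast
  define E s where "E = conj_dom D r" and "s = conj_val D r"
  have cw: "cellwise_affine (riesz ` \<Phi>) E s"
    unfolding E_def s_def
    by (rule cellwise_affine_conj[OF finR cs integral_L_convex_polyhedron_saturated[OF M_subgrad]])
  have E: "E \<noteq> {}" by (rule cellwise_facts(1)[OF finR cw])
  have sube: "subgrad E s x = {p\<in>D. x \<in> subgrad D r p}" if "x \<in> E" for x
    using conj_subgrad_eq(1)[OF cs] that by (simp add: E_def s_def)
  have P: "root_tangent (riesz ` \<Phi>) (subgrad E s x) \<and>
      subgrad E s x = convex hull (subgrad E s x \<inter> riesz ` root_lattice \<Phi>)" if x: "x \<in> E" for x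
  proof -
    obtain p where "p \<in> D" "x \<in> subgrad D r p"
      using cellwise_facts(3)[OF finR cw x] sube[OF x] by blast
    from M_argmin[OF this] show ?thesis unfolding sube[OF x] by blast
  qed
  show ?thesis
    unfolding integral_locpoly_L_convex_def E_def[symmetric] s_def[symmetric] edom_fext
  proof (intro conjI ballI)
    show "proper_fun (fext E s)" by (rule proper_fext[OF E])
    show "locally_polyhedral_convex_fun (fext E s)"
      unfolding locally_polyhedral_convex_fun_def epi_fext by (rule cellwise_locally_polyhedral[OF finR cw])
  next
    fix S assume "S \<in> Pi_V (fext E s)"
    then obtain p where S: "S \<noteq> {}" "S = argmin_set (\<lambda>x. fext E s x - ereal (blinfun_apply p x))"
      by (auto simp: Pi_V_def)
    then have S2: "S = {x\<in>E. riesz p \<in> subgrad E s x}"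
      using argmin_fext[OF E, of s "riesz p"] by (simp add: blinfun_apply_eq_riesz)
    then obtain x where "x \<in> E" "riesz p \<in> subgrad E s x" using S(1) by blast
    then have pD: "riesz p \<in> D" using sube by blast
    then have "S = subgrad D r (riesz p)"
      using conj_subgrad_eq(2)[OF cs pD] S2 by (simp add: E_def s_def)
    then show "integral_L_convex_polyhedron \<Phi> S" using M_subgrad[OF pD] by simp
  next
    fix x assume x: "x \<in> E"
    define P where "P = subgrad E s x"
    have Pne: "P \<noteq> {}" unfolding P_def by (rule cellwise_facts(3)[OF finR cw x])
    have supp: "dir_deriv (fext E s) x d = (SUP p\<in>P. ereal (p \<bullet> d))" for d
      unfolding P_def by (rule cellwise_dir_deriv_support[OF finR cw x])
    have suppf: "dir_deriv (fext E s) x = (\<lambda>d. SUP p\<in>P. ereal (p \<bullet> d))" using supp by blast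
    have rt: "root_tangent (riesz ` \<Phi>) P" using P[OF x] by (simp add: P_def)
    obtain z where z: "z \<in> P" using Pne by blast
    have lb: "ereal (z \<bullet> d) \<le> dir_deriv (fext E s) x d" for d
      unfolding supp using z by (rule SUP_upper)
    show "integral_L_sublinear \<Phi> (dir_deriv (fext E s) x)"
      unfolding integral_L_sublinear_def L_sublinear_def
    proof (intro conjI ballI)
      show "proper_fun (dir_deriv (fext E s) x)"
        unfolding proper_fun_def
      proof (intro conjI allI exI[of _ 0])
        show "dir_deriv (fext E s) x d \<noteq> - \<infinity>" for d using lb[of d] by auto
        show "dir_deriv (fext E s) x 0 \<noteq> \<infinity>" using Pne by (simp add: supp zero_ereal_def[symmetric])
      qed
      show "polyhedral_sublinear (dir_deriv (fext E s) x)"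
        by (rule cellwise_dir_deriv_polyhedral[OF finR cw x])
    next
      fix C assume "C \<in> Pi_V (dir_deriv (fext E s) x)"
      then obtain p where C: "C \<noteq> {}"
        "C = argmin_set (\<lambda>d. (SUP p\<in>P. ereal (p \<bullet> d)) - ereal (riesz p \<bullet> d))"
        by (auto simp: Pi_V_def suppf blinfun_apply_eq_riesz)
      \<comment> \<open>The functional ranges over the whole dual, but a minimizer exists only for
        members of \<open>P\<close>.\<close>
      then obtain d0 where "d0 \<in> argmin_set (\<lambda>d. (SUP p\<in>P. ereal (p \<bullet> d)) - ereal (riesz p \<bullet> d))" by blast
      then have q: "riesz p \<in> P"
        using argmin_support_mem[OF Pne] closed_convex_subgrad[of E s x] by (simp add: P_def)
      obtain R' where R': "R' \<subseteq> riesz ` \<Phi>" "tangent_cone P (riesz p) = convex_cone hull R'"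
        using rt q unfolding root_tangent_def by blast
      obtain \<Phi>' where \<Phi>': "\<Phi>' \<subseteq> \<Phi>" "R' = riesz ` \<Phi>'" using R'(1) by (auto simp: subset_image_iff)
      have "C = {d. \<forall>z\<in>P. z \<bullet> d \<le> riesz p \<bullet> d}" using C(2) argmin_support[OF q] by simp
      \<comment> \<open>The normal cone is polar to the tangent cone, so the roots spanning the
        latter cut it out.\<close>
      also have "\<dots> = {d. \<forall>\<alpha>\<in>\<Phi>'. blinfun_apply \<alpha> d \<le> 0}"
      proof (intro equalityI subsetI CollectI ballI)
        fix d \<alpha> assume d: "d \<in> {d. \<forall>z\<in>P. z \<bullet> d \<le> riesz p \<bullet> d}" and \<alpha>: "\<alpha> \<in> \<Phi>'"
        have "riesz \<alpha> \<in> tangent_cone P (riesz p)" using R'(2) \<Phi>'(2) \<alpha> by (simp add: hull_inc)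
        then have "d \<bullet> riesz \<alpha> \<le> 0" using d by (intro tangent_cone_le[of P d "riesz p"]) (auto simp: inner_commute)
        then show "blinfun_apply \<alpha> d \<le> 0" by (simp add: blinfun_apply_eq_riesz inner_commute)
      next
        fix d w assume d: "d \<in> {d. \<forall>\<alpha>\<in>\<Phi>'. blinfun_apply \<alpha> d \<le> 0}" and w: "w \<in> P"
        have "convex_cone hull R' \<subseteq> {v. d \<bullet> v \<le> 0}"
          using d \<Phi>'(2) by (intro hull_minimal convex_cone_halfspace_le)
            (auto simp: blinfun_apply_eq_riesz inner_commute)
        then have "d \<bullet> (w - riesz p) \<le> 0" using in_tangent_cone[OF w, of "riesz p"] R'(2) by blast
        then show "w \<bullet> d \<le> riesz p \<bullet> d" by (simp add: inner_diff_right inner_commute)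
      qed
      finally show "L_convex_cone \<Phi> C" unfolding L_convex_cone_def using \<Phi>'(1) by blast
    next
      \<comment> \<open>A nonempty hull of lattice points contains a lattice point, so the finitely
        many slopes can be chosen in the lattice.\<close>
      have "subgrad E s y \<inter> riesz ` root_lattice \<Phi> \<noteq> {}" if y: "y \<in> E" for y
      proof
        assume "subgrad E s y \<inter> riesz ` root_lattice \<Phi> = {}"
        then have "subgrad E s y = {}" using P[OF y] by simp
        then show False using cellwise_facts(3)[OF finR cw y] by simp
      qed
      from dir_deriv_eq_Max[OF finR cw x this] obtain B where B: "B \<noteq> {}" "finite B"
        "B \<subseteq> riesz ` root_lattice \<Phi>" "\<And>d. d \<in> edom (dir_deriv (fext E s) x) \<Longrightarrow>
          dir_deriv (fext E s) x d = ereal (Max ((\<lambda>p. p \<bullet> d) ` B))" by blast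
      have "dualv ` B \<subseteq> root_lattice \<Phi>" using B(3) by (auto simp: dualv_riesz)
      moreover have "(\<lambda>p. blinfun_apply p d) ` dualv ` B = (\<lambda>p. p \<bullet> d) ` B" for d
        by (simp add: image_image dualv_apply)
      ultimately show "\<exists>B. B \<noteq> {} \<and> finite B \<and> B \<subseteq> root_lattice \<Phi> \<and>
          (\<forall>d\<in>edom (dir_deriv (fext E s) x).
             dir_deriv (fext E s) x d = ereal (Max ((\<lambda>p. blinfun_apply p d) ` B)))"
        using B by (intro exI[of _ "dualv ` B"]) simp
    qed
  qed
qed

lemma conj_M_eq_conj:
  assumes g: "\<forall>p\<in>root_lattice \<Phi>. g p = fext D r (riesz p)"
  shows "conj_M \<Phi> g x = fext (conj_dom D r) (conj_val D r) x"
proof -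
  obtain N where N: "cone_normals (riesz ` \<Phi>) N" using root_cone_normals[OF rs ess] .
  have finN: "finite N" using N by (simp add: cone_normals_def)
  note cw = M_cellwise[OF N]
  have gp: "ereal (blinfun_apply p x) - g p = ereal (x \<bullet> riesz p - r (riesz p))"
    if "p \<in> root_lattice \<Phi>" "riesz p \<in> D" for p
    using g that by (simp add: fext_def blinfun_apply_eq_riesz inner_commute)
  have dom: "root_lattice \<Phi> \<inter> edom g = {p\<in>root_lattice \<Phi>. riesz p \<in> D}"
    using g by (auto simp: edom_def fext_def split: if_splits)
  have img: "riesz ` {p\<in>root_lattice \<Phi>. riesz p \<in> D} = riesz ` root_lattice \<Phi> \<inter> D" by auto
  have "conj_M \<Phi> g x = (SUP p\<in>{p\<in>root_lattice \<Phi>. riesz p \<in> D}. ereal (x \<bullet> riesz p - r (riesz p)))"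
    unfolding conj_M_def dom using gp by (intro SUP_cong) auto
  also have "\<dots> = (SUP q\<in>riesz ` root_lattice \<Phi> \<inter> D. ereal (x \<bullet> q - r q))"
    unfolding img[symmetric] by (simp add: image_image)
  also have "\<dots> = fext (conj_dom D r) (conj_val D r) x"
  proof (rule conj_eq_SUP_subset[OF D])
    fix p assume p: "p \<in> D"
    obtain y where y: "y \<in> subgrad D r p" using cellwise_facts(3)[OF finN cw p] by blast
    \<comment> \<open>Points with a common subgradient \<open>y\<close> lie on the graph of one
      affine function of slope \<open>y\<close>.\<close>
    have "r q = r p + y \<bullet> (q - p)" if "q \<in> D" "y \<in> subgrad D r q" for q
    proof -
      have "r p + y \<bullet> (q - p) \<le> r q" "r q + y \<bullet> (p - q) \<le> r p"
        using y that p by (auto simp: subgrad_def)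
      then show ?thesis by (simp add: inner_diff_right)
    qed
    then have "{q\<in>D. y \<in> subgrad D r q} \<inter> riesz ` root_lattice \<Phi> \<subseteq>
        {q \<in> riesz ` root_lattice \<Phi> \<inter> D. r q = r p + y \<bullet> (q - p)}" by blast
    moreover have "p \<in> convex hull ({q\<in>D. y \<in> subgrad D r q} \<inter> riesz ` root_lattice \<Phi>)"
      using M_argmin(2)[OF p y] p y by blast
    ultimately have "p \<in> convex hull {q \<in> riesz ` root_lattice \<Phi> \<inter> D. r q = r p + y \<bullet> (q - p)}"
      using hull_mono by blast
    then show "\<exists>y. p \<in> convex hull {q \<in> riesz ` root_lattice \<Phi> \<inter> D. r q = r p + y \<bullet> (q - p)}" by blast
  qed
  finally show ?thesis .
qed

end

lemma fext_biconj:
  fixes D :: "'b::euclidean_space set"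
  assumes "closed_subdiff D r"
  shows "fext (conj_dom (conj_dom D r) (conj_val D r)) (conj_val (conj_dom D r) (conj_val D r)) = fext D r"
  using biconj(1,2)[OF assms] by (auto simp: fext_def fun_eq_iff)

lemma conj_dom_nonempty:
  assumes "closed_subdiff D r"
  shows "conj_dom D r \<noteq> {}"
proof -
  obtain x p where "x \<in> D" "p \<in> subgrad D r x" using assms unfolding closed_subdiff_def by blast
  then have "p \<in> conj_dom D r" by (rule subgrad_conj(1))
  then show ?thesis by blast
qed

theorem theorem6p11:
  fixes \<Phi> :: "'a::euclidean_space dual set"
    and f :: "'a \<Rightarrow> ereal"
    and g :: "'a dual \<Rightarrow> ereal"
  assumes "root_system \<Phi>"
    and "essential \<Phi>"
    and "irreducible_roots \<Phi>"
    and "classical_type \<Phi>"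
    and "\<forall>x\<in>coxeter_vertices \<Phi>. f x \<noteq> - \<infinity>"
    and "\<forall>p\<in>root_lattice \<Phi>. g p \<noteq> - \<infinity>"
  shows "(integral_L_convex \<Phi> f \<longrightarrow>
           (\<forall>p\<in>root_lattice \<Phi>. conj_L \<Phi> f p \<noteq> - \<infinity>) \<and>
           integral_M_convex \<Phi> (conj_L \<Phi> f) \<and>
           (\<forall>x\<in>coxeter_vertices \<Phi>. f x = conj_M \<Phi> (conj_L \<Phi> f) x)) \<and>
         (integral_M_convex \<Phi> g \<longrightarrow>
           (\<forall>x\<in>coxeter_vertices \<Phi>. conj_M \<Phi> g x \<noteq> - \<infinity>) \<and>
           integral_L_convex \<Phi> (conj_M \<Phi> g) \<and>
           (\<forall>p\<in>root_lattice \<Phi>. g p = conj_L \<Phi> (conj_M \<Phi> g) p))"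
proof (rule conjI; rule impI)
  note rs = assms(1) and ess = assms(2)
  assume "integral_L_convex \<Phi> f"
  then obtain h where h: "integral_locpoly_L_convex \<Phi> h" "\<forall>x\<in>coxeter_vertices \<Phi>. f x = h x"
    by (auto simp: integral_L_convex_def)
  define D r where "D = edom h" and "r = (\<lambda>x. real_of_ereal (h x))"
  have "proper_fun h" using h(1) by (simp add: integral_locpoly_L_convex_def)
  then have hD: "h = fext D r" and D: "D \<noteq> {}" unfolding D_def r_def by (rule proper_eq_fext)+
  have hL: "integral_locpoly_L_convex \<Phi> (fext D r)" using h(1) hD by simp
  note cs = L_closed_subdiff[OF rs ess D hL]
  have conj: "conj_L \<Phi> f = (\<lambda>p. fext (conj_dom D r) (conj_val D r) (riesz p))"
    using conj_L_eq_conj[OF rs ess D hL] h(2) hD by auto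
  note hM = conj_of_L_convex[OF rs ess D hL]
  show "(\<forall>p\<in>root_lattice \<Phi>. conj_L \<Phi> f p \<noteq> - \<infinity>) \<and> integral_M_convex \<Phi> (conj_L \<Phi> f) \<and>
      (\<forall>x\<in>coxeter_vertices \<Phi>. f x = conj_M \<Phi> (conj_L \<Phi> f) x)"
  proof (intro conjI ballI)
    show "conj_L \<Phi> f p \<noteq> - \<infinity>" for p by (simp add: conj fext_def)
    show "integral_M_convex \<Phi> (conj_L \<Phi> f)" using hM conj by (auto simp: integral_M_convex_def)
    fix x assume "x \<in> coxeter_vertices \<Phi>"
    \<comment> \<open>The conjugate restricts an M-convex function, so its discrete conjugate is the
      full biconjugate, which returns \<open>h\<close>.\<close>
    then show "f x = conj_M \<Phi> (conj_L \<Phi> f) x"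
      using conj_M_eq_conj[OF rs ess conj_dom_nonempty[OF cs] hM, of "conj_L \<Phi> f"] h(2)
      by (simp add: conj fext_biconj[OF cs] hD)
  qed
next
  note rs = assms(1) and ess = assms(2)
  assume "integral_M_convex \<Phi> g"
  then obtain h where h: "integral_locpoly_M_convex \<Phi> h" "\<forall>p\<in>root_lattice \<Phi>. g p = h p"
    by (auto simp: integral_M_convex_def)
  \<comment> \<open>The function on the dual is pulled back to \<open>V\<close>, where the
    conjugation theory is formulated.\<close>
  define D r where "D = riesz ` edom h" and "r = (\<lambda>x. real_of_ereal (h (dualv x)))"
  have "proper_fun h" using h(1) by (simp add: integral_locpoly_M_convex_def)
  note pr = proper_eq_fext[OF this]
  have D: "D \<noteq> {}" using pr(2) by (simp add: D_def)
  have "h p = fext D r (riesz p)" for p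
    using fun_cong[OF pr(1), of p]
    unfolding fext_def D_def r_def riesz_image mem_Collect_eq dualv_riesz .
  then have hD: "h = (\<lambda>p. fext D r (riesz p))" by blast
  have hM: "integral_locpoly_M_convex \<Phi> (\<lambda>p. fext D r (riesz p))" using h(1) hD by simp
  note cs = M_closed_subdiff[OF rs ess D hM]
  have conj: "conj_M \<Phi> g = fext (conj_dom D r) (conj_val D r)"
    using conj_M_eq_conj[OF rs ess D hM] h(2) hD by auto
  note hL = conj_of_M_convex[OF rs ess D hM]
  show "(\<forall>x\<in>coxeter_vertices \<Phi>. conj_M \<Phi> g x \<noteq> - \<infinity>) \<and> integral_L_convex \<Phi> (conj_M \<Phi> g) \<and>
      (\<forall>p\<in>root_lattice \<Phi>. g p = conj_L \<Phi> (conj_M \<Phi> g) p)"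
  proof (intro conjI ballI)
    show "conj_M \<Phi> g x \<noteq> - \<infinity>" for x by (simp add: conj fext_def)
    show "integral_L_convex \<Phi> (conj_M \<Phi> g)" using hL conj by (auto simp: integral_L_convex_def)
    fix p assume "p \<in> root_lattice \<Phi>"
    then show "g p = conj_L \<Phi> (conj_M \<Phi> g) p"
      using conj_L_eq_conj[OF rs ess conj_dom_nonempty[OF cs] hL, of "conj_M \<Phi> g"] h(2)
      by (simp add: conj fext_biconj[OF cs] hD)
  qed
qed

end
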